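(* The operad $\operatorname{Leib}$ has a unique structure of anticyclic operad such that the inclusion map $\operatorname{Leib}\to\operatorname{Dias}$ is a morphism of anticyclic operads.
   Context: All vector spaces are over $\mathbb{Q}$. The symmetric group $\mathfrak{S}_n$ acts on $\mathcal{P}(n)$ by $(\sigma\cdot E)(x_1,\dots,x_n)=E(x_{\sigma(1)},\dots,x_{\sigma(n)})$. An anticyclic operad is a symmetric operad $\mathcal{P}$ (unit $1\in\mathcal{P}(1)$, partial compositions $\circ_i$) together with an action of $\mathfrak{S}_{n+1}$ on each $\mathcal{P}(n)$ extending the action of $\mathfrak{S}_n$ (the stabilizer of $n+1$), such that, writing $\tau_n$ for the action of the long cycle $(n+1,n,\dots,2,1)$ ($1\mapsto n+1$, $i\mapsto i-1$ for $i\ge 2$): $\tau_1(1)=-1$ and, for $f\in\mathcal{P}(m)$, $g\in\mathcal{P}(n)$, $\tau(f\circ_i g)=\tau_m(f)\circ_{i-1}g$ for $2\le i\le m$ and $\tau(f\circ_1 g)=-\tau_n(g)\circ_n\tau_m(f)$. A morphism of anticyclic operads is a morphism of operads commuting with the actions of $\mathfrak{S}_{n+1}$. A non-symmetric anticyclic operad is a non-symmetric operad with endomorphisms $\tau_n$ of $\mathcal{P}(n)$ satisfying $\tau_n^{n+1}=\mathrm{Id}$ and these same identities. If $\mathcal{P}$ is a non-symmetric anticyclic operad, the symmetric operad with components $\mathcal{P}(n)\otimes\mathbb{Q}\mathfrak{S}_n\cong\operatorname{Ind}_{\mathbb{Z}/(n+1)\mathbb{Z}}^{\mathfrak{S}_{n+1}}\mathcal{P}(n)$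 is naturally an anticyclic operad, with $\tau_n(E\otimes 1)=\tau_n(E)\otimes 1$. The non-symmetric operad $\operatorname{Dias}$ is generated by binary operations $x\dashv y$, $x\vdash y$ with relations $x\dashv(y\vdash z)=x\dashv(y\dashv z)=(x\dashv y)\dashv z$, $x\vdash(y\dashv z)=(x\vdash y)\dashv z$, $x\vdash(y\vdash z)=(x\vdash y)\vdash z=(x\dashv y)\vdash z$. It is a non-symmetric anticyclic operad with the unique structure such that $\tau_1=-\mathrm{Id}$, $\tau_2(x_1\dashv x_2)=-x_1\vdash x_2$, $\tau_2(x_1\vdash x_2)=x_1\dashv x_2-x_1\vdash x_2$. In the claim, $\operatorname{Dias}$ denotes the associated (symmetric) anticyclic operad. $\operatorname{Leib}$ is the sub-operad of the symmetric operad $\operatorname{Dias}$ generated by $[x_1,x_2]=x_1\dashv x_2-x_2\vdash x_1$; it is presented by the binary product $[x,y]$ (no symmetry) with relation $[x,[y,z]]=[[x,y],z]-[[x,z],y]$. *)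

theory Defs
  imports Complex_Main "HOL-Library.Poly_Mapping" "HOL-Library.FuncSet"
    "HOL-Combinatorics.Permutations"
begin

section \<open>Operads over the rationals\<close>

text \<open>
  The components \<open>P(n)\<close>, \<open>n \<ge> 1\<close>, of an operad are subspaces of one ambient rational vector space
  (for instance of the direct sum of all the components); \<open>op_comp P m n i f g\<close> is
  the partial composition of \<open>f\<close> in \<open>P(m)\<close> with \<open>g\<close> in \<open>P(n)\<close> at the \<open>i\<close>-th input.
  Nothing is assumed about the values of the operations outside the components, nor about
  \<open>op_space P 0\<close>.
\<close>

record 'a operad =
  op_scale :: "rat \<Rightarrow> 'a \<Rightarrow> 'a"
  op_space :: "nat \<Rightarrow> 'a set"
  op_unit :: 'a
  op_comp :: "nat \<Rightarrow> nat \<Rightarrow> nat \<Rightarrow> 'a \<Rightarrow> 'a \<Rightarrow> 'a"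

definition linear_map_on ::
  "(rat \<Rightarrow> 'a \<Rightarrow> 'a) \<Rightarrow> 'a set \<Rightarrow> (rat \<Rightarrow> 'b \<Rightarrow> 'b) \<Rightarrow> 'b set \<Rightarrow> ('a::ab_group_add \<Rightarrow> 'b::ab_group_add) \<Rightarrow> bool"
where
  "linear_map_on sV V sW W f \<longleftrightarrow>
     (\<forall>x\<in>V. f x \<in> W) \<and>
     (\<forall>x\<in>V. \<forall>y\<in>V. f (x + y) = f x + f y) \<and>
     (\<forall>c. \<forall>x\<in>V. f (sV c x) = sW c (f x))"

locale ns_operad = vector_space "op_scale P"
  for P :: "('a::ab_group_add, 'm) operad_scheme" +
  assumes subspace_op_space: "1 \<le> n \<Longrightarrow> subspace (op_space P n)"
    and unit_in: "op_unit P \<in> op_space P 1"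
    and comp_linear_left: "\<lbrakk>1 \<le> i; i \<le> m; 1 \<le> n; g \<in> op_space P n\<rbrakk> \<Longrightarrow>
      linear_map_on (op_scale P) (op_space P m) (op_scale P) (op_space P (m + n - 1))
        (\<lambda>f. op_comp P m n i f g)"
    and comp_linear_right: "\<lbrakk>1 \<le> i; i \<le> m; 1 \<le> n; f \<in> op_space P m\<rbrakk> \<Longrightarrow>
      linear_map_on (op_scale P) (op_space P n) (op_scale P) (op_space P (m + n - 1))
        (\<lambda>g. op_comp P m n i f g)"
    and comp_unit_right: "\<lbrakk>1 \<le> i; i \<le> m; f \<in> op_space P m\<rbrakk> \<Longrightarrow> op_comp P m 1 i f (op_unit P) = f"
    and comp_unit_left: "\<lbrakk>1 \<le> n; g \<in> op_space P n\<rbrakk> \<Longrightarrow> op_comp P 1 n 1 (op_unit P) g = g"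
    and comp_assoc_seq:
      "\<lbrakk>1 \<le> i; i \<le> l; 1 \<le> j; j \<le> m; 1 \<le> n;
        f \<in> op_space P l; g \<in> op_space P m; h \<in> op_space P n\<rbrakk> \<Longrightarrow>
       op_comp P (l + m - 1) n (i - 1 + j) (op_comp P l m i f g) h =
       op_comp P l (m + n - 1) i f (op_comp P m n j g h)"
    and comp_assoc_par:
      "\<lbrakk>1 \<le> i; i < k; k \<le> l; 1 \<le> m; 1 \<le> n;
        f \<in> op_space P l; g \<in> op_space P m; h \<in> op_space P n\<rbrakk> \<Longrightarrow>
       op_comp P (l + m - 1) n (k - 1 + m) (op_comp P l m i f g) h =
       op_comp P (l + n - 1) m i (op_comp P l n k f h) g"

text \<open>
  Writing \<open>(\<sigma>\<cdot>f)(x\<^sub>1,\<dots>,x\<^sub>m) = f(x\<^bsub>\<sigma>(1)\<^esub>,\<dots>,x\<^bsub>\<sigma>(m)\<^esub>)\<close>, one has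
  \<open>(\<sigma>\<cdot>f) \<circ>\<^sub>i (\<pi>\<cdot>g) = perm_comp m n i \<sigma> \<pi> \<cdot> (f \<circ>\<^sub>p g)\<close> with \<open>p = \<sigma>\<^sup>-\<^sup>1(i)\<close>: the word
  \<open>\<sigma>(1)\<dots>\<sigma>(m)\<close> has its letter \<open>i\<close>, in position \<open>p\<close>, replaced by the word of \<open>\<pi>\<close> shifted by \<open>i - 1\<close>,
  and its letters above \<open>i\<close> are shifted by \<open>n - 1\<close>.
\<close>

definition perm_comp :: "nat \<Rightarrow> nat \<Rightarrow> nat \<Rightarrow> (nat \<Rightarrow> nat) \<Rightarrow> (nat \<Rightarrow> nat) \<Rightarrow> nat \<Rightarrow> nat" where
  "perm_comp m n i \<sigma> \<pi> = (\<lambda>q.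
     let p = inv \<sigma> i; shift = (\<lambda>j. if j < i then j else j + n - 1) in
     if q < 1 \<or> m + n - 1 < q then q
     else if q < p then shift (\<sigma> q)
     else if q < p + n then i - 1 + \<pi> (q - p + 1)
     else shift (\<sigma> (q - n + 1)))"

record 'a sym_operad = "'a operad" +
  op_act :: "nat \<Rightarrow> (nat \<Rightarrow> nat) \<Rightarrow> 'a \<Rightarrow> 'a"

locale symmetric_operad = ns_operad P
  for P :: "('a::ab_group_add, 'm) sym_operad_scheme" +
  assumes act_linear: "\<lbrakk>1 \<le> n; \<sigma> permutes {1..n}\<rbrakk> \<Longrightarrow>
      linear_map_on (op_scale P) (op_space P n) (op_scale P) (op_space P n) (op_act P n \<sigma>)"
    and act_id: "\<lbrakk>1 \<le> n; f \<in> op_space P n\<rbrakk> \<Longrightarrow> op_act P n id f = f"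
    and act_comp: "\<lbrakk>1 \<le> n; \<sigma> permutes {1..n}; \<pi> permutes {1..n}; f \<in> op_space P n\<rbrakk> \<Longrightarrow>
      op_act P n (\<sigma> \<circ> \<pi>) f = op_act P n \<sigma> (op_act P n \<pi> f)"
    and equivariance:
      "\<lbrakk>1 \<le> i; i \<le> m; 1 \<le> n; \<sigma> permutes {1..m}; \<pi> permutes {1..n};
        f \<in> op_space P m; g \<in> op_space P n\<rbrakk> \<Longrightarrow>
       op_comp P m n i (op_act P m \<sigma> f) (op_act P n \<pi> g) =
       op_act P (m + n - 1) (perm_comp m n i \<sigma> \<pi>) (op_comp P m n (inv \<sigma> i) f g)"


section \<open>Anticyclic operads\<close>

definition long_cycle :: "nat \<Rightarrow> nat \<Rightarrow> nat" where
  "long_cycle n = (\<lambda>i. if i = 1 then n + 1 else if 2 \<le> i \<and> i \<le> n + 1 then i - 1 else i)"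

definition anticyclic_identities ::
  "('a::ab_group_add, 'm) operad_scheme \<Rightarrow> (nat \<Rightarrow> 'a \<Rightarrow> 'a) \<Rightarrow> bool"
where
  "anticyclic_identities P \<tau> \<longleftrightarrow>
     \<tau> 1 (op_unit P) = - op_unit P \<and>
     (\<forall>m\<ge>1. \<forall>n\<ge>1. \<forall>f\<in>op_space P m. \<forall>g\<in>op_space P n.
        (\<forall>i\<in>{2..m}. \<tau> (m + n - 1) (op_comp P m n i f g) = op_comp P m n (i - 1) (\<tau> m f) g) \<and>
        \<tau> (m + n - 1) (op_comp P m n 1 f g) = - op_comp P n m n (\<tau> n g) (\<tau> m f))"

locale ns_anticyclic_operad = ns_operad P
  for P :: "('a::ab_group_add, 'm) operad_scheme" and \<tau> :: "nat \<Rightarrow> 'a \<Rightarrow> 'a" +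
  assumes tau_linear: "1 \<le> n \<Longrightarrow>
      linear_map_on (op_scale P) (op_space P n) (op_scale P) (op_space P n) (\<tau> n)"
    and tau_power: "\<lbrakk>1 \<le> n; f \<in> op_space P n\<rbrakk> \<Longrightarrow> (\<tau> n ^^ (n + 1)) f = f"
    and tau_identities: "anticyclic_identities P \<tau>"

locale anticyclic_operad = symmetric_operad P
  for P :: "('a::ab_group_add, 'm) sym_operad_scheme"
    and \<rho> :: "nat \<Rightarrow> (nat \<Rightarrow> nat) \<Rightarrow> 'a \<Rightarrow> 'a" +
  assumes rho_linear: "\<lbrakk>1 \<le> n; \<sigma> permutes {1..n + 1}\<rbrakk> \<Longrightarrow>
      linear_map_on (op_scale P) (op_space P n) (op_scale P) (op_space P n) (\<rho> n \<sigma>)"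
    and rho_comp: "\<lbrakk>1 \<le> n; \<sigma> permutes {1..n + 1}; \<pi> permutes {1..n + 1}; f \<in> op_space P n\<rbrakk> \<Longrightarrow>
      \<rho> n (\<sigma> \<circ> \<pi>) f = \<rho> n \<sigma> (\<rho> n \<pi> f)"
    and rho_extends: "\<lbrakk>1 \<le> n; \<sigma> permutes {1..n}; f \<in> op_space P n\<rbrakk> \<Longrightarrow>
      \<rho> n \<sigma> f = op_act P n \<sigma> f"
    and rho_identities: "anticyclic_identities P (\<lambda>n. \<rho> n (long_cycle n))"

locale anticyclic_morphism = dom: anticyclic_operad P \<rho> + cod: anticyclic_operad Q \<kappa>
  for P :: "('a::ab_group_add, 'm) sym_operad_scheme" and \<rho>
    and Q :: "('b::ab_group_add, 'n) sym_operad_scheme" and \<kappa>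
    and \<phi> :: "nat \<Rightarrow> 'a \<Rightarrow> 'b" +
  assumes map_linear: "1 \<le> n \<Longrightarrow>
      linear_map_on (op_scale P) (op_space P n) (op_scale Q) (op_space Q n) (\<phi> n)"
    and map_unit: "\<phi> 1 (op_unit P) = op_unit Q"
    and map_comp: "\<lbrakk>1 \<le> i; i \<le> m; 1 \<le> n; f \<in> op_space P m; g \<in> op_space P n\<rbrakk> \<Longrightarrow>
      \<phi> (m + n - 1) (op_comp P m n i f g) = op_comp Q m n i (\<phi> m f) (\<phi> n g)"
    and map_act: "\<lbrakk>1 \<le> n; \<sigma> permutes {1..n}; f \<in> op_space P n\<rbrakk> \<Longrightarrow>
      \<phi> n (op_act P n \<sigma> f) = op_act Q n \<sigma> (\<phi> n f)"
    and map_rho: "\<lbrakk>1 \<le> n; \<sigma> permutes {1..n + 1}; f \<in> op_space P n\<rbrakk> \<Longrightarrow>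
      \<phi> n (\<rho> n \<sigma> f) = \<kappa> n \<sigma> (\<phi> n f)"

text \<open>
  Families of self-maps of the \<open>P(n)\<close> indexed by \<open>n \<ge> 1\<close> and by the permutations of
  \<open>{1, \<dots>, n + 1}\<close>; they are extensional, so that two of them are equal as soon as they agree on
  these arguments.
\<close>

definition action_families ::
  "('a, 'm) operad_scheme \<Rightarrow> (nat \<Rightarrow> (nat \<Rightarrow> nat) \<Rightarrow> 'a \<Rightarrow> 'a) set"
where
  "action_families P =
     (\<Pi>\<^sub>E n\<in>{1..}. \<Pi>\<^sub>E \<sigma>\<in>{\<sigma>. \<sigma> permutes {1..n + 1}}. op_space P n \<rightarrow>\<^sub>E op_space P n)"


section \<open>The symmetric operad of a non-symmetric operad\<close>

text \<open>
  An element of \<open>P(n) \<otimes> \<rat>\<SS>\<^sub>n\<close> is a finitely supported function from permutations to \<open>P(n)\<close>;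
  \<open>E \<otimes> \<sigma>\<close> is \<open>Poly_Mapping.single \<sigma> E\<close> and stands for the operation \<open>E(x\<^bsub>\<sigma>(1)\<^esub>,\<dots>,x\<^bsub>\<sigma>(n)\<^esub>)\<close>, that is
  for \<open>\<sigma> \<cdot> (E \<otimes> 1)\<close>.
\<close>

definition symmetrization ::
  "('a::ab_group_add, 'm) operad_scheme \<Rightarrow> ((nat \<Rightarrow> nat) \<Rightarrow>\<^sub>0 'a) sym_operad"
where
  "symmetrization P = \<lparr>
     op_scale = (\<lambda>c. Poly_Mapping.map (op_scale P c)),
     op_space = (\<lambda>n. {f. Poly_Mapping.keys f \<subseteq> {\<sigma>. \<sigma> permutes {1..n}} \<and>
                         (\<forall>\<sigma>\<in>Poly_Mapping.keys f. Poly_Mapping.lookup f \<sigma> \<in> op_space P n)}),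
     op_unit = Poly_Mapping.single id (op_unit P),
     op_comp = (\<lambda>m n i f g. \<Sum>\<sigma>\<in>Poly_Mapping.keys f. \<Sum>\<pi>\<in>Poly_Mapping.keys g.
        Poly_Mapping.single (perm_comp m n i \<sigma> \<pi>)
          (op_comp P m n (inv \<sigma> i) (Poly_Mapping.lookup f \<sigma>) (Poly_Mapping.lookup g \<pi>))),
     op_act = (\<lambda>n \<sigma> f. \<Sum>\<pi>\<in>Poly_Mapping.keys f.
        Poly_Mapping.single (\<sigma> \<circ> \<pi>) (Poly_Mapping.lookup f \<pi>))\<rparr>"

text \<open>
  The induced action on \<open>P(n) \<otimes> \<rat>\<SS>\<^sub>n \<cong> Ind P(n)\<close>. Every permutation of \<open>{1, \<dots>, n + 1}\<close> is
  \<open>s \<circ> c\<^sup>k\<close> for a unique \<open>s\<close> fixing \<open>n + 1\<close> and a unique power \<open>c\<^sup>k\<close>, \<open>k \<le> n\<close>, of the long cycle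
  \<open>c\<close>. If \<open>\<sigma> \<circ> \<pi> = s \<circ> c\<^sup>k\<close>, then \<open>\<sigma> \<cdot> (E \<otimes> \<pi>) = s \<cdot> (c\<^sup>k \<cdot> (E \<otimes> 1)) = \<tau>\<^sup>k(E) \<otimes> s\<close>. Here \<open>k\<close> is
  read off from \<open>c\<^sup>k(k) = n + 1\<close> for \<open>1 \<le> k \<le> n\<close>.
\<close>

definition induced_action ::
  "(nat \<Rightarrow> 'a \<Rightarrow> 'a) \<Rightarrow> nat \<Rightarrow> (nat \<Rightarrow> nat) \<Rightarrow> ((nat \<Rightarrow> nat) \<Rightarrow>\<^sub>0 'a) \<Rightarrow> ((nat \<Rightarrow> nat) \<Rightarrow>\<^sub>0 'a::ab_group_add)"
where
  "induced_action \<tau> n \<sigma> f = (\<Sum>\<pi>\<in>Poly_Mapping.keys f.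
     let k = inv (\<sigma> \<circ> \<pi>) (n + 1) mod (n + 1);
         s = \<sigma> \<circ> \<pi> \<circ> inv (long_cycle n ^^ k)
     in Poly_Mapping.single s ((\<tau> n ^^ k) (Poly_Mapping.lookup f \<pi>)))"

lemma bij_long_cycle: "bij (long_cycle n)"
proof (rule o_bij)
  let ?d = "\<lambda>i. if i = n + 1 then 1 else if 1 \<le> i \<and> i \<le> n then i + 1 else i"
  show "?d \<circ> long_cycle n = id" "long_cycle n \<circ> ?d = id"
    by (auto simp: long_cycle_def fun_eq_iff)
qed

lemma induced_action_long_cycle:
  assumes "1 \<le> n" "\<tau> n 0 = 0"
  shows "induced_action \<tau> n (long_cycle n) (Poly_Mapping.single id E) =
    Poly_Mapping.single id (\<tau> n E)"
proof -
  have "inv (long_cycle n) (Suc n) = 1"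
    using bij_long_cycle[of n] by (intro inv_f_eq) (auto simp: bij_def long_cycle_def)
  moreover have "long_cycle n \<circ> inv (long_cycle n) = id"
    using bij_long_cycle[of n] by (simp add: bij_def surj_iff)
  ultimately show ?thesis
    using assms by (cases "E = 0") (auto simp: induced_action_def Let_def)
qed

lemma induced_action_extends:
  assumes "\<sigma> permutes {1..n}" "f \<in> op_space (symmetrization P) n"
  shows "induced_action \<tau> n \<sigma> f = op_act (symmetrization P) n \<sigma> f"
proof -
  have "inv (\<sigma> \<circ> \<pi>) (Suc n) = Suc n" if "\<pi> \<in> Poly_Mapping.keys f" for \<pi>
  proof -
    have "\<sigma> \<circ> \<pi> permutes {1..n}"
      using assms that by (intro permutes_compose) (auto simp: symmetrization_def)
    then have "inv (\<sigma> \<circ> \<pi>) permutes {1..n}" by (rule permutes_inv)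
    then show ?thesis by (simp add: permutes_not_in)
  qed
  then show ?thesis
    by (auto simp: induced_action_def symmetrization_def Let_def intro!: sum.cong)
qed


section \<open>The operad Dias\<close>

text \<open>
  Basis of the free non-symmetric operad on two binary generators: planar binary trees with
  two kinds of nodes, \<open>LProd s t\<close> for \<open>s \<stileturn> t\<close> and \<open>RProd s t\<close> for \<open>s \<turnstile> t\<close>.
\<close>

datatype dtree =
    Leaf
  | LProd dtree dtree
  | RProd dtree dtree

primrec leaves :: "dtree \<Rightarrow> nat" where
  "leaves Leaf = 1"
| "leaves (LProd s t) = leaves s + leaves t"
| "leaves (RProd s t) = leaves s + leaves t"

primrec tree_graft :: "nat \<Rightarrow> dtree \<Rightarrow> dtree \<Rightarrow> dtree" where
  "tree_graft i Leaf u = u"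
| "tree_graft i (LProd s t) u =
     (if i \<le> leaves s then LProd (tree_graft i s u) t else LProd s (tree_graft (i - leaves s) t u))"
| "tree_graft i (RProd s t) u =
     (if i \<le> leaves s then RProd (tree_graft i s u) t else RProd s (tree_graft (i - leaves s) t u))"

definition free_scale :: "rat \<Rightarrow> (dtree \<Rightarrow>\<^sub>0 rat) \<Rightarrow> (dtree \<Rightarrow>\<^sub>0 rat)" where
  "free_scale c = Poly_Mapping.map ((*) c)"

text \<open>
  The \<open>i\<close>-th partial composition, extended bilinearly to elements that need not be homogeneous;
  trees with fewer than \<open>i\<close> leaves contribute nothing.
\<close>

definition free_comp :: "nat \<Rightarrow> (dtree \<Rightarrow>\<^sub>0 rat) \<Rightarrow> (dtree \<Rightarrow>\<^sub>0 rat) \<Rightarrow> (dtree \<Rightarrow>\<^sub>0 rat)" where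
  "free_comp i f g = (\<Sum>s\<in>Poly_Mapping.keys f. \<Sum>t\<in>Poly_Mapping.keys g.
     if 1 \<le> i \<and> i \<le> leaves s
     then Poly_Mapping.single (tree_graft i s t) (Poly_Mapping.lookup f s * Poly_Mapping.lookup g t)
     else 0)"

abbreviation free_tree :: "dtree \<Rightarrow> (dtree \<Rightarrow>\<^sub>0 rat)" where
  "free_tree t \<equiv> Poly_Mapping.single t 1"

definition dias_relators :: "(dtree \<Rightarrow>\<^sub>0 rat) set" where
  "dias_relators =
    {free_tree (LProd Leaf (RProd Leaf Leaf)) - free_tree (LProd Leaf (LProd Leaf Leaf)),
     free_tree (LProd Leaf (LProd Leaf Leaf)) - free_tree (LProd (LProd Leaf Leaf) Leaf),
     free_tree (RProd Leaf (LProd Leaf Leaf)) - free_tree (LProd (RProd Leaf Leaf) Leaf),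
     free_tree (RProd Leaf (RProd Leaf Leaf)) - free_tree (RProd (RProd Leaf Leaf) Leaf),
     free_tree (RProd (RProd Leaf Leaf) Leaf) - free_tree (RProd (LProd Leaf Leaf) Leaf)}"

text \<open>
  The operadic ideal generated by the relators, as a subspace of the direct sum of the
  components of the free operad. It is graded, since the relators are homogeneous.
\<close>

inductive_set dias_ideal :: "(dtree \<Rightarrow>\<^sub>0 rat) set" where
  relator: "r \<in> dias_relators \<Longrightarrow> r \<in> dias_ideal"
| zero: "0 \<in> dias_ideal"
| add: "\<lbrakk>f \<in> dias_ideal; g \<in> dias_ideal\<rbrakk> \<Longrightarrow> f + g \<in> dias_ideal"
| scale: "f \<in> dias_ideal \<Longrightarrow> free_scale c f \<in> dias_ideal"
| comp_left: "f \<in> dias_ideal \<Longrightarrow> free_comp i f g \<in> dias_ideal"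
| comp_right: "g \<in> dias_ideal \<Longrightarrow> free_comp i f g \<in> dias_ideal"

lemma lookup_free_scale [simp]:
  "Poly_Mapping.lookup (free_scale c f) t = c * Poly_Mapping.lookup f t"
  unfolding free_scale_def by transfer (simp add: when_def)

lemma free_scale_diff: "free_scale c (f - g) = free_scale c f - free_scale c g"
  by (rule poly_mapping_eqI) (simp add: lookup_minus algebra_simps)

lemma dias_ideal_uminus: "f \<in> dias_ideal \<Longrightarrow> - f \<in> dias_ideal"
proof -
  have "- f = free_scale (- 1) f" by (rule poly_mapping_eqI) simp
  then show "f \<in> dias_ideal \<Longrightarrow> - f \<in> dias_ideal" by (simp add: dias_ideal.scale)
qed

lemma free_comp_superset:
  assumes "finite A" "finite B" "Poly_Mapping.keys f \<subseteq> A" "Poly_Mapping.keys g \<subseteq> B"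
  shows "free_comp i f g = (\<Sum>s\<in>A. \<Sum>t\<in>B.
     if 1 \<le> i \<and> i \<le> leaves s
     then Poly_Mapping.single (tree_graft i s t) (Poly_Mapping.lookup f s * Poly_Mapping.lookup g t)
     else 0)"
proof -
  have "(\<Sum>t\<in>Poly_Mapping.keys g. if 1 \<le> i \<and> i \<le> leaves s
     then Poly_Mapping.single (tree_graft i s t) (Poly_Mapping.lookup f s * Poly_Mapping.lookup g t)
     else 0) = (\<Sum>t\<in>B. if 1 \<le> i \<and> i \<le> leaves s
     then Poly_Mapping.single (tree_graft i s t) (Poly_Mapping.lookup f s * Poly_Mapping.lookup g t)
     else 0)" for s
    using assms by (intro sum.mono_neutral_left) (auto simp: in_keys_iff)
  then show ?thesis
    unfolding free_comp_def
    using assms by (simp, intro sum.mono_neutral_left) (auto simp: in_keys_iff intro!: sum.neutral)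
qed

lemma free_comp_diff_left: "free_comp i (f - f') g = free_comp i f g - free_comp i f' g"
proof -
  let ?A = "Poly_Mapping.keys f \<union> Poly_Mapping.keys f'" and ?B = "Poly_Mapping.keys g"
  have "Poly_Mapping.keys (f - f') \<subseteq> ?A" by (rule keys_diff)
  then show ?thesis
    by (subst (1 2 3) free_comp_superset[of ?A ?B])
      (simp_all only: sum_subtractf[symmetric] finite_keys finite_UnI Un_upper1 Un_upper2 subset_refl,
       auto simp: lookup_minus single_diff left_diff_distrib intro!: sum.cong)
qed

lemma free_comp_diff_right: "free_comp i f (g - g') = free_comp i f g - free_comp i f g'"
proof -
  let ?A = "Poly_Mapping.keys f" and ?B = "Poly_Mapping.keys g \<union> Poly_Mapping.keys g'"
  have "Poly_Mapping.keys (g - g') \<subseteq> ?B" by (rule keys_diff)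
  then show ?thesis
    by (subst (1 2 3) free_comp_superset[of ?A ?B])
      (simp_all only: sum_subtractf[symmetric] finite_keys finite_UnI Un_upper1 Un_upper2 subset_refl,
       auto simp: lookup_minus single_diff right_diff_distrib intro!: sum.cong)
qed

definition dias_rel :: "(dtree \<Rightarrow>\<^sub>0 rat) \<Rightarrow> (dtree \<Rightarrow>\<^sub>0 rat) \<Rightarrow> bool" where
  "dias_rel f g \<longleftrightarrow> f - g \<in> dias_ideal"

text \<open>The underlying space of \<open>dias\<close> is the direct sum of the components of Dias.\<close>

quotient_type dias = "dtree \<Rightarrow>\<^sub>0 rat" / dias_rel
proof (rule equivpI)
  show "reflp dias_rel" by (auto simp: reflp_def dias_rel_def dias_ideal.zero)
  show "symp dias_rel"
    unfolding symp_def dias_rel_def by (metis dias_ideal_uminus minus_diff_eq)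
  show "transp dias_rel"
  proof (rule transpI)
    fix f g h
    assume "dias_rel f g" "dias_rel g h"
    then have "(f - g) + (g - h) \<in> dias_ideal"
      unfolding dias_rel_def by (rule dias_ideal.add)
    then show "dias_rel f h" by (simp add: dias_rel_def)
  qed
qed

instantiation dias :: ab_group_add
begin

lift_definition zero_dias :: dias is 0 .

lift_definition plus_dias :: "dias \<Rightarrow> dias \<Rightarrow> dias" is "(+)"
proof -
  fix f f' g g'
  assume "dias_rel f f'" "dias_rel g g'"
  then have "(f - f') + (g - g') \<in> dias_ideal"
    unfolding dias_rel_def by (rule dias_ideal.add)
  then show "dias_rel (f + g) (f' + g')"
    by (simp add: dias_rel_def algebra_simps)
qed

lift_definition uminus_dias :: "dias \<Rightarrow> dias" is uminus
  unfolding dias_rel_def by (metis dias_ideal_uminus minus_diff_minus)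

lift_definition minus_dias :: "dias \<Rightarrow> dias \<Rightarrow> dias" is "(-)"
proof -
  fix f f' g g'
  assume "dias_rel f f'" "dias_rel g g'"
  then have "(f - f') + - (g - g') \<in> dias_ideal"
    unfolding dias_rel_def by (intro dias_ideal.add dias_ideal_uminus)
  then show "dias_rel (f - g) (f' - g')"
    by (simp add: dias_rel_def algebra_simps)
qed

instance
  by standard (transfer; simp add: dias_rel_def dias_ideal.zero algebra_simps)+

end

lift_definition dias_scale :: "rat \<Rightarrow> dias \<Rightarrow> dias" is free_scale
  unfolding dias_rel_def by (metis dias_ideal.scale free_scale_diff)

lift_definition dias_comp :: "nat \<Rightarrow> dias \<Rightarrow> dias \<Rightarrow> dias" is free_comp
proof -
  fix i f f' g g'
  assume "dias_rel f f'" "dias_rel g g'"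
  then have "free_comp i (f - f') g + free_comp i f' (g - g') \<in> dias_ideal"
    unfolding dias_rel_def by (intro dias_ideal.add dias_ideal.comp_left dias_ideal.comp_right)
  then show "dias_rel (free_comp i f g) (free_comp i f' g')"
    by (simp add: dias_rel_def free_comp_diff_left free_comp_diff_right)
qed

lift_definition dias_tree :: "dtree \<Rightarrow> dias" is "\<lambda>t. Poly_Mapping.single t 1" .

definition Dias_ns :: "dias operad" where
  "Dias_ns = \<lparr>
     op_scale = dias_scale,
     op_space = (\<lambda>n. abs_dias ` {f. \<forall>t\<in>Poly_Mapping.keys f. leaves t = n}),
     op_unit = dias_tree Leaf,
     op_comp = (\<lambda>m n i f g. dias_comp i f g)\<rparr>"

abbreviation dias_left :: dias where "dias_left \<equiv> dias_tree (LProd Leaf Leaf)"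
abbreviation dias_right :: dias where "dias_right \<equiv> dias_tree (RProd Leaf Leaf)"

text \<open>
  These conditions determine the values of \<open>\<tau> n\<close>, \<open>n \<ge> 1\<close>, on \<open>op_space Dias_ns n\<close>; the other
  values are irrelevant.
\<close>

definition dias_tau :: "nat \<Rightarrow> dias \<Rightarrow> dias" where
  "dias_tau = (SOME \<tau>. ns_anticyclic_operad Dias_ns \<tau> \<and>
     (\<forall>f\<in>op_space Dias_ns 1. \<tau> 1 f = - f) \<and>
     \<tau> 2 dias_left = - dias_right \<and>
     \<tau> 2 dias_right = dias_left - dias_right)"

definition Dias :: "((nat \<Rightarrow> nat) \<Rightarrow>\<^sub>0 dias) sym_operad" where
  "Dias = symmetrization Dias_ns"

definition Dias_action ::
  "nat \<Rightarrow> (nat \<Rightarrow> nat) \<Rightarrow> ((nat \<Rightarrow> nat) \<Rightarrow>\<^sub>0 dias) \<Rightarrow> ((nat \<Rightarrow> nat) \<Rightarrow>\<^sub>0 dias)" where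
  "Dias_action = induced_action dias_tau"


section \<open>The operad Leib\<close>

inductive generated ::
  "('a::ab_group_add, 'm) sym_operad_scheme \<Rightarrow> (nat \<Rightarrow> 'a set) \<Rightarrow> nat \<Rightarrow> 'a \<Rightarrow> bool"
  for P :: "('a, 'm) sym_operad_scheme" and G :: "nat \<Rightarrow> 'a set"
where
  gen: "\<lbrakk>1 \<le> n; x \<in> G n\<rbrakk> \<Longrightarrow> generated P G n x"
| unit: "generated P G 1 (op_unit P)"
| zero: "1 \<le> n \<Longrightarrow> generated P G n 0"
| add: "\<lbrakk>generated P G n x; generated P G n y\<rbrakk> \<Longrightarrow> generated P G n (x + y)"
| scale: "generated P G n x \<Longrightarrow> generated P G n (op_scale P c x)"
| comp: "\<lbrakk>1 \<le> i; i \<le> m; generated P G m x; generated P G n y\<rbrakk> \<Longrightarrow>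
    generated P G (m + n - 1) (op_comp P m n i x y)"
| act: "\<lbrakk>\<sigma> permutes {1..n}; generated P G n x\<rbrakk> \<Longrightarrow> generated P G n (op_act P n \<sigma> x)"

definition suboperad_generated ::
  "('a::ab_group_add, 'm) sym_operad_scheme \<Rightarrow> (nat \<Rightarrow> 'a set) \<Rightarrow> ('a, 'm) sym_operad_scheme"
where
  "suboperad_generated P G = P\<lparr>op_space := \<lambda>n. {x. generated P G n x}\<rparr>"

text \<open>\<open>[x\<^sub>1,x\<^sub>2] = x\<^sub>1 \<stileturn> x\<^sub>2 - x\<^sub>2 \<turnstile> x\<^sub>1\<close>\<close>

definition leib_bracket :: "(nat \<Rightarrow> nat) \<Rightarrow>\<^sub>0 dias" where
  "leib_bracket = Poly_Mapping.single id dias_left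
     - op_act Dias 2 (Transposition.transpose 1 2) (Poly_Mapping.single id dias_right)"

definition Leib :: "((nat \<Rightarrow> nat) \<Rightarrow>\<^sub>0 dias) sym_operad" where
  "Leib = suboperad_generated Dias (\<lambda>n. if n = 2 then {leib_bracket} else {})"

end

theory Submission
  imports Defs
begin

text \<open>
  An anticyclic structure on Leib for which the inclusion into Dias is a morphism has to be the
  restriction of the action on Dias, so it is unique, and it exists if and only if the subspaces
  \<open>Leib(n)\<close> are stable under the permutations of \<open>{1, \<dots>, n + 1}\<close>.

  Stability is a question about generators. The two anticyclic identities write
  \<open>\<tau>(f \<circ>\<^sub>i g)\<close>, up to sign, as a composition of \<open>\<tau>(f)\<close> with \<open>g\<close> or of \<open>\<tau>(g)\<close> with \<open>\<tau>(f)\<close>.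
  Hence the operations whose whole orbit is generated are closed under composition, and a
  suboperad generated by such operations is stable: \<open>generated_rho\<close> and, with
  uniqueness, \<open>suboperad_unique_anticyclic\<close>. For the bracket \<open>b\<close> and the transposition
  \<open>t = (1 2)\<close> one finds \<open>\<tau>(b) = t \<cdot> b\<close> and \<open>\<tau>\<^sup>2(b) = - b - t \<cdot> b\<close>, so its orbit lies in
  \<open>Leib(2)\<close> (\<open>leib_bracket_orbit\<close>).

  That Dias itself is anticyclic has two ingredients.

  The first is the existence of \<open>\<tau>\<close> on the non-symmetric operad. Modulo the relations a tree depends
  only on its number \<open>n\<close> of leaves and on one distinguished leaf \<open>i\<close>, the one reached from
  the root by following the pointed sides of the products. The resulting operations
  \<open>e\<^sub>1, \<dots>, e\<^sub>n\<close> span \<open>Dias(n)\<close>, and composition of basis elements is arithmetic on indices. The structure is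
  \<open>\<tau>(e\<^sub>i) = e\<^bsub>i-1\<^esub> - e\<^sub>n\<close> with \<open>e\<^sub>0 = 0\<close>. If one thinks of \<open>e\<^sub>i\<close> as
  \<open>x\<^sub>i - x\<^bsub>n+1\<^esub>\<close>, where the long cycle permutes \<open>x\<^sub>1, \<dots>, x\<^bsub>n+1\<^esub>\<close>, this is
  the action on vectors of coordinate sum zero; hence \<open>\<tau>\<close> has order \<open>n + 1\<close>. The anticyclic identities are
  checked on the basis (\<open>dias_rotation_ns_anticyclic\<close>).

  The second is general: the symmetrization of a non-symmetric anticyclic operad is anticyclic
  (\<open>symmetrization_anticyclic_operad\<close>). On tensors \<open>E \<otimes> \<sigma>\<close> every axiom splits into an
  identity between compositions of the \<open>E\<close> and an identity between permutations inserted
  into one another. For the anticyclic identities the permutation \<open>\<sigma>\<close> turns \<open>\<tau>\<close> into the power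
  \<open>\<tau>\<^sup>k\<close>, where \<open>k\<close> is the position of the letter \<open>1\<close>, so one has to follow a
  composition through a whole run of rotations (\<open>tau_pow_comp_inside\<close>,
  \<open>tau_pow_comp_outside\<close>).
\<close>

section \<open>Inserting one permutation into another\<close>

text \<open>
  The renumbering of the letters other than the letter \<open>p\<close> when \<open>p\<close> is replaced by a block of
  \<open>n\<close> letters. The block itself occupies \<open>p, \<dots>, p + n - 1\<close>, the numbers \<open>p - 1 + r\<close> with
  \<open>1 \<le> r \<le> n\<close>. It is applied to \<open>z \<noteq> p\<close> only.
\<close>

definition make_room :: "nat \<Rightarrow> nat \<Rightarrow> nat \<Rightarrow> nat" where
  "make_room p n z = (if z < p then z else z + n - 1)"

text \<open>
  Read on renumbered letters, an inserted permutation is \<open>\<sigma>\<close> off the block and \<open>\<pi>\<close> on the block. These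
  two rules and their converse \<open>perm_comp_eqI\<close> replace the case distinction in the definition,
  and every identity below is an identity of renumberings. The rule holds for
  all \<open>z \<noteq> p\<close>, including those outside \<open>{1..m}\<close>, since both sides are then fixed.
\<close>

lemma perm_comp_outer:
  assumes "\<sigma> permutes {1..m}" "\<sigma> p = i" "i \<in> {1..m}" "1 \<le> n" "z \<noteq> p"
  shows "perm_comp m n i \<sigma> \<pi> (make_room p n z) = make_room i n (\<sigma> z)"
proof -
  have p: "inv \<sigma> i = p" using assms by (metis permutes_inverses(2))
  have pm: "p \<in> {1..m}" using assms permutes_in_image by metis
  have ne: "\<sigma> z \<noteq> i" using assms by (metis permutes_inverses(2))
  show ?thesis
  proof (cases "z \<in> {1..m}")
    case True
    then show ?thesis
      using pm assms(3-5) ne by (auto simp: perm_comp_def Let_def p make_room_def)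
  next
    case False
    then have "\<sigma> z = z" using assms(1) by (simp add: permutes_not_in)
    then show ?thesis
      using False pm assms(3-5) by (auto simp: perm_comp_def Let_def p make_room_def)
  qed
qed

lemma perm_comp_inner:
  assumes "\<sigma> permutes {1..m}" "\<sigma> p = i" "i \<in> {1..m}" "r \<in> {1..n}"
  shows "perm_comp m n i \<sigma> \<pi> (p - 1 + r) = i - 1 + \<pi> r"
proof -
  have p: "inv \<sigma> i = p" using assms by (metis permutes_inverses(2))
  have pm: "p \<in> {1..m}" using assms permutes_in_image by metis
  then show ?thesis
    using assms(3-4) by (auto simp: perm_comp_def Let_def p)
qed

lemma make_room_cases:
  assumes "1 \<le> p" "1 \<le> n"
  obtains (outer) z where "z \<noteq> p" "x = make_room p n z" | (inner) r where "r \<in> {1..n}" "x = p - 1 + r"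
proof -
  consider "x < p" | "p \<le> x" "x < p + n" | "p + n \<le> x" by linarith
  then show thesis
  proof cases
    case 1 then show ?thesis by (intro outer[of x]) (auto simp: make_room_def)
  next
    case 2 then show ?thesis using assms by (intro inner[of "x + 1 - p"]) auto
  next
    case 3 then show ?thesis using assms by (intro outer[of "x + 1 - n"]) (auto simp: make_room_def)
  qed
qed

lemma perm_comp_eqI:
  assumes "\<sigma> permutes {1..m}" "\<sigma> p = i" "i \<in> {1..m}" "1 \<le> n"
    and outer: "\<And>z. z \<noteq> p \<Longrightarrow> h (make_room p n z) = make_room i n (\<sigma> z)"
    and inner: "\<And>r. r \<in> {1..n} \<Longrightarrow> h (p - 1 + r) = i - 1 + \<pi> r"
  shows "h = perm_comp m n i \<sigma> \<pi>"
proof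
  fix x
  have "1 \<le> p" using assms(1-3) permutes_in_image[of \<sigma> "{1..m}" p] by auto
  from this \<open>1 \<le> n\<close> show "h x = perm_comp m n i \<sigma> \<pi> x"
  proof (cases rule: make_room_cases[where x = x])
    case (outer z) then show ?thesis using assms by (simp add: perm_comp_outer)
  next
    case (inner r) then show ?thesis using assms perm_comp_inner[OF assms(1-3)] by simp
  qed
qed

lemma perm_comp_id:
  assumes "i \<in> {1..m}" "1 \<le> n"
  shows "perm_comp m n i id id = id"
  by (rule perm_comp_eqI[symmetric, of _ _ i]) (use assms in \<open>auto simp: permutes_id\<close>)

text \<open>
  Insertion is multiplicative, which is the equivariance of composition at the level of permutations.
\<close>

lemma perm_comp_comp:
  assumes "\<sigma> permutes {1..m}" "\<sigma>' permutes {1..m}" "\<pi>' permutes {1..n}"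
    "i \<in> {1..m}" "1 \<le> n"
  shows "perm_comp m n i \<sigma> \<pi> \<circ> perm_comp m n (inv \<sigma> i) \<sigma>' \<pi>' =
    perm_comp m n i (\<sigma> \<circ> \<sigma>') (\<pi> \<circ> \<pi>')"
proof (rule perm_comp_eqI[of _ _ "inv \<sigma>' (inv \<sigma> i)"])
  define p where "p = inv \<sigma> i"
  define p' where "p' = inv \<sigma>' p"
  have p: "\<sigma> p = i" "\<sigma>' p' = p" "p \<in> {1..m}"
    using assms permutes_in_image[OF permutes_inv[OF assms(1)]]
    by (simp_all add: p_def p'_def permutes_inverses)
  show "\<sigma> \<circ> \<sigma>' permutes {1..m}" using assms by (simp add: permutes_compose)
  show "(\<sigma> \<circ> \<sigma>') (inv \<sigma>' (inv \<sigma> i)) = i" using p by (simp add: p_def p'_def)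
  show "i \<in> {1..m}" "1 \<le> n" by fact+
  show "(perm_comp m n i \<sigma> \<pi> \<circ> perm_comp m n (inv \<sigma> i) \<sigma>' \<pi>') (make_room (inv \<sigma>' (inv \<sigma> i)) n z) =
    make_room i n ((\<sigma> \<circ> \<sigma>') z)" if "z \<noteq> inv \<sigma>' (inv \<sigma> i)" for z
  proof -
    have "\<sigma>' z \<noteq> p" using that assms(2) by (metis p_def permutes_inverses(2))
    then show ?thesis
      using that assms p perm_comp_outer[OF assms(2) p(2,3) assms(5), of z]
        perm_comp_outer[OF assms(1) p(1) assms(4,5), of "\<sigma>' z"]
      by (simp add: p_def[symmetric] p'_def[symmetric])
  qed
  show "(perm_comp m n i \<sigma> \<pi> \<circ> perm_comp m n (inv \<sigma> i) \<sigma>' \<pi>') (inv \<sigma>' (inv \<sigma> i) - 1 + r) =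
    i - 1 + (\<pi> \<circ> \<pi>') r" if "r \<in> {1..n}" for r
  proof -
    have "\<pi>' r \<in> {1..n}" using that assms(3) by (metis permutes_in_image)
    then show ?thesis
      using perm_comp_inner[OF assms(2) p(2,3) that, of \<pi>']
        perm_comp_inner[OF assms(1) p(1) assms(4), of "\<pi>' r" n \<pi>]
      by (simp add: p_def[symmetric] p'_def[symmetric])
  qed
qed

lemma bij_fixing_imp_permutes:
  assumes "bij f" "\<And>x. x \<notin> S \<Longrightarrow> f x = x"
  shows "f permutes S"
  using assms by (simp add: permutes_def bij_iff)

text \<open>
  Inserting the inverse permutations gives a two-sided inverse.
\<close>

lemma perm_comp_permutes:
  assumes "\<sigma> permutes {1..m}" "\<pi> permutes {1..n}" "i \<in> {1..m}" "1 \<le> n"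
  shows "perm_comp m n i \<sigma> \<pi> permutes {1..m + n - 1}"
proof (rule bij_fixing_imp_permutes)
  define p where "p = inv \<sigma> i"
  have p: "\<sigma> p = i" "p \<in> {1..m}" "inv (inv \<sigma>) p = i"
    using assms permutes_in_image[OF permutes_inv[OF assms(1)]]
    by (simp_all add: p_def permutes_inverses permutes_inv_inv)
  have "perm_comp m n i \<sigma> \<pi> \<circ> perm_comp m n p (inv \<sigma>) (inv \<pi>) = id"
    using assms p perm_comp_comp[of \<sigma> m "inv \<sigma>" "inv \<pi>" n i \<pi>]
    by (simp add: p_def[symmetric] permutes_inv permutes_inv_o perm_comp_id)
  moreover have "perm_comp m n p (inv \<sigma>) (inv \<pi>) \<circ> perm_comp m n i \<sigma> \<pi> = id"
    using assms p perm_comp_comp[of "inv \<sigma>" m \<sigma> \<pi> n p "inv \<pi>"]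
    by (simp add: permutes_inv permutes_inv_o perm_comp_id)
  ultimately show "bij (perm_comp m n i \<sigma> \<pi>)" by (metis o_bij)
qed (auto simp: perm_comp_def)

lemma inv_perm_comp_outer:
  assumes "\<sigma> permutes {1..m}" "\<pi> permutes {1..n}" "\<sigma> p = i" "i \<in> {1..m}" "1 \<le> n" "z \<noteq> p"
  shows "inv (perm_comp m n i \<sigma> \<pi>) (make_room i n (\<sigma> z)) = make_room p n z"
  using perm_comp_outer[OF assms(1,3-6), of \<pi>] permutes_inverses(2)[OF perm_comp_permutes[OF assms(1,2,4,5)]]
  by metis

lemma inv_perm_comp_inner:
  assumes "\<sigma> permutes {1..m}" "\<pi> permutes {1..n}" "\<sigma> p = i" "i \<in> {1..m}" "r \<in> {1..n}"
  shows "inv (perm_comp m n i \<sigma> \<pi>) (i - 1 + \<pi> r) = p - 1 + r"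
proof -
  have "1 \<le> n" using assms(5) by simp
  then show ?thesis
    using perm_comp_inner[OF assms(1,3-5), of \<pi>] permutes_inverses(2)[OF perm_comp_permutes[OF assms(1,2,4)]]
    by metis
qed

lemma perm_comp_unit_right:
  assumes "\<sigma> permutes {1..m}" "i \<in> {1..m}"
  shows "perm_comp m 1 i \<sigma> id = \<sigma>"
proof (rule perm_comp_eqI[symmetric, of _ _ "inv \<sigma> i"])
  show i: "\<sigma> (inv \<sigma> i) = i" using assms by (simp add: permutes_inverses)
  have "1 \<le> inv \<sigma> i" using assms permutes_in_image[OF permutes_inv[OF assms(1)]] by force
  then show "\<sigma> (inv \<sigma> i - 1 + r) = i - 1 + id r" if "r \<in> {1..1}" for r
    using that assms i by auto
qed (use assms in \<open>auto simp: make_room_def\<close>)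

lemma perm_comp_unit_left:
  assumes "\<pi> permutes {1..n}" "1 \<le> n"
  shows "perm_comp 1 n 1 id \<pi> = \<pi>"
proof (rule perm_comp_eqI[symmetric, of _ _ 1])
  show "\<pi> (make_room 1 n z) = make_room 1 n (id z)" if "z \<noteq> 1" for z
    using that assms by (auto simp: make_room_def intro!: permutes_not_in[OF assms(1)])
qed (use assms in \<open>auto simp: permutes_id\<close>)

text \<open>
  The permutation part of sequential associativity: each position belongs to the innermost block, to
  the rest of the block of \<open>\<pi>\<close>, or to \<open>\<sigma>\<close>.
\<close>

lemma perm_comp_assoc_seq:
  assumes "\<sigma> permutes {1..l}" "\<pi> permutes {1..m}" "\<rho> permutes {1..n}"
    and "\<sigma> p = i" "\<pi> q = j" "i \<in> {1..l}" "j \<in> {1..m}" "1 \<le> n"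
  shows "perm_comp (l + m - 1) n (i - 1 + j) (perm_comp l m i \<sigma> \<pi>) \<rho> =
    perm_comp l (m + n - 1) i \<sigma> (perm_comp m n j \<pi> \<rho>)"
    (is "?L = perm_comp _ _ _ _ ?R")
proof (rule perm_comp_eqI)
  have m: "1 \<le> m" using assms by simp
  have p: "p \<in> {1..l}" using assms by (metis permutes_in_image)
  have q: "q \<in> {1..m}" using assms by (metis permutes_in_image)
  have perm: "perm_comp l m i \<sigma> \<pi> permutes {1..l + m - 1}"
    by (rule perm_comp_permutes[OF assms(1,2,6) m])
  have val: "perm_comp l m i \<sigma> \<pi> (p - 1 + q) = i - 1 + j"
    using perm_comp_inner[OF assms(1,4,6) q] assms by simp
  have mem: "i - 1 + j \<in> {1..l + m - 1}" using assms by auto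
  show "\<sigma> permutes {1..l}" "\<sigma> p = i" "i \<in> {1..l}" by fact+
  show "1 \<le> m + n - 1" using m \<open>1 \<le> n\<close> by arith
  show "?L (make_room p (m + n - 1) z) = make_room i (m + n - 1) (\<sigma> z)" if "z \<noteq> p" for z
  proof -
    have "\<sigma> z \<noteq> i" using that assms by (metis permutes_inverses(2))
    have "make_room p (m + n - 1) z = make_room (p - 1 + q) n (make_room p m z)"
      "make_room p m z \<noteq> p - 1 + q"
      using that p q assms(8) by (auto simp: make_room_def)
    moreover have "make_room (i - 1 + j) n (make_room i m (\<sigma> z)) = make_room i (m + n - 1) (\<sigma> z)"
      using \<open>\<sigma> z \<noteq> i\<close> assms(6-8) by (auto simp: make_room_def)
    ultimately show ?thesis
      using perm_comp_outer[OF perm val mem \<open>1 \<le> n\<close>] perm_comp_outer[OF assms(1,4,6) m that] by simp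
  qed
  show "?L (p - 1 + y) = i - 1 + ?R y" if "y \<in> {1..m + n - 1}" for y
  proof -
    have q1: "1 \<le> q" using q by simp
    from q1 \<open>1 \<le> n\<close> show ?thesis
    proof (cases rule: make_room_cases[where x = y])
      case (outer w)
      have w: "w \<in> {1..m}" using that outer q assms(8) by (auto simp: make_room_def split: if_splits)
      then have wj: "\<pi> w \<in> {1..m}" using assms by (metis permutes_in_image)
      have "p - 1 + make_room q n w = make_room (p - 1 + q) n (p - 1 + w)" "p - 1 + w \<noteq> p - 1 + q"
        using outer p q w assms(8) by (auto simp: make_room_def)
      moreover have "make_room (i - 1 + j) n (i - 1 + \<pi> w) = i - 1 + make_room j n (\<pi> w)"
        using assms(6-8) wj by (auto simp: make_room_def)
      ultimately show ?thesis
        using perm_comp_outer[OF perm val mem \<open>1 \<le> n\<close>] perm_comp_inner[OF assms(1,4,6) w]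
          perm_comp_outer[OF assms(2,5,7,8) outer(1)] outer(2) by simp
    next
      case (inner u)
      have "p - 1 + (q - 1 + u) = p - 1 + q - 1 + u" using q by auto
      moreover have "i - 1 + (j - 1 + \<rho> u) = i - 1 + j - 1 + \<rho> u" using assms by auto
      ultimately show ?thesis
        using perm_comp_inner[OF perm val mem inner(1)] perm_comp_inner[OF assms(2,5,7) inner(1)] inner(2)
        by metis
    qed
  qed
qed

text \<open>
  The permutation part of parallel associativity. In the word of \<open>\<sigma>\<close> the letters \<open>i < k\<close> may occur in
  either order, so the position \<open>p\<close> may be smaller or larger than \<open>q\<close>.
\<close>

lemma perm_comp_assoc_par:
  assumes "\<sigma> permutes {1..l}" "\<pi> permutes {1..m}" "\<rho> permutes {1..n}"
    and "\<sigma> p = i" "\<sigma> q = k" "1 \<le> i" "i < k" "k \<le> l" "1 \<le> m" "1 \<le> n"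
  shows "perm_comp (l + m - 1) n (k - 1 + m) (perm_comp l m i \<sigma> \<pi>) \<rho> =
    perm_comp (l + n - 1) m i (perm_comp l n k \<sigma> \<rho>) \<pi>"
    (is "?L = ?R")
proof (rule perm_comp_eqI[symmetric])
  have ik: "i \<in> {1..l}" "k \<in> {1..l}" using assms by auto
  have p: "p \<in> {1..l}" "q \<in> {1..l}" "q \<noteq> p"
    using assms ik by (metis permutes_in_image, metis permutes_in_image, force)
  show perm: "perm_comp l m i \<sigma> \<pi> permutes {1..l + m - 1}"
    by (rule perm_comp_permutes[OF assms(1,2) ik(1) assms(9)])
  have perm': "perm_comp l n k \<sigma> \<rho> permutes {1..l + n - 1}"
    by (rule perm_comp_permutes[OF assms(1,3) ik(2) assms(10)])
  show val: "perm_comp l m i \<sigma> \<pi> (make_room p m q) = k - 1 + m"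
    using perm_comp_outer[OF assms(1,4) ik(1) assms(9) p(3), of \<pi>] assms by (simp add: make_room_def)
  have val': "perm_comp l n k \<sigma> \<rho> (make_room q n p) = i"
    using perm_comp_outer[OF assms(1,5) ik(2) assms(10) p(3)[symmetric], of \<rho>] assms by (simp add: make_room_def)
  show mem: "k - 1 + m \<in> {1..l + m - 1}" using assms by auto
  have mem': "i \<in> {1..l + n - 1}" using assms by auto
  show "1 \<le> n" by fact
  note outL = perm_comp_outer[OF assms(1,4) ik(1) assms(9)] and outR = perm_comp_outer[OF assms(1,5) ik(2) assms(10)]
    and inL = perm_comp_inner[OF assms(1,4) ik(1)] and inR = perm_comp_inner[OF assms(1,5) ik(2)]
    and OutR = perm_comp_outer[OF perm' val' mem' \<open>1 \<le> m\<close>] and InR = perm_comp_inner[OF perm' val' mem']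
  show "?R (make_room (make_room p m q) n y) = make_room (k - 1 + m) n (perm_comp l m i \<sigma> \<pi> y)"
    if "y \<noteq> make_room p m q" for y
  proof -
    have p1: "1 \<le> p" using p by simp
    from p1 \<open>1 \<le> m\<close> show ?thesis
    proof (cases rule: make_room_cases[where x = y])
      case (outer z)
      then have z: "z \<noteq> q" "z \<noteq> p" using that by auto
      then have sz: "\<sigma> z \<noteq> i" "\<sigma> z \<noteq> k" using assms(1,4,5) by (metis permutes_inverses(2))+
      have "make_room (make_room p m q) n (make_room p m z) = make_room (make_room q n p) m (make_room q n z)"
        "make_room q n z \<noteq> make_room q n p"
        using p z assms(9,10) by (auto simp: make_room_def)
      moreover have "make_room (k - 1 + m) n (make_room i m (\<sigma> z)) = make_room i m (make_room k n (\<sigma> z))"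
        using sz assms(7-10) by (auto simp: make_room_def)
      ultimately show ?thesis
        using OutR[of "make_room q n z" \<pi>] outL[OF z(2)] outR[OF z(1)] outer(2) by simp
    next
      case (inner r)
      have "make_room (make_room p m q) n (p - 1 + r) = make_room q n p - 1 + r"
        using p inner assms(9,10) by (auto simp: make_room_def)
      moreover have "\<pi> r \<in> {1..m}" using inner assms(2) by (metis permutes_in_image)
      then have "make_room (k - 1 + m) n (i - 1 + \<pi> r) = i - 1 + \<pi> r"
        using assms(6-10) by (auto simp: make_room_def)
      ultimately show ?thesis using InR[OF inner(1), of \<pi>] inL[OF inner(1), of \<pi>] inner(2) by simp
    qed
  qed
  show "?R (make_room p m q - 1 + r) = k - 1 + m - 1 + \<rho> r" if "r \<in> {1..n}" for r
  proof -
    have "make_room p m q - 1 + r = make_room (make_room q n p) m (q - 1 + r)" "q - 1 + r \<noteq> make_room q n p"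
      using p that assms(9,10) by (auto simp: make_room_def)
    moreover have "\<rho> r \<in> {1..n}" using that assms(3) by (metis permutes_in_image)
    then have "make_room i m (k - 1 + \<rho> r) = k - 1 + m - 1 + \<rho> r"
      using assms(6-10) by (auto simp: make_room_def)
    ultimately show ?thesis using OutR[of "q - 1 + r" \<pi>] inR[OF that, of \<rho>] by simp
  qed
qed

section \<open>Powers of the long cycle\<close>

lemma long_cycle_apply:
  "long_cycle n x = (if x = 1 then n + 1 else if 2 \<le> x \<and> x \<le> n + 1 then x - 1 else x)"
  by (simp add: long_cycle_def)

lemma long_cycle_permutes: "long_cycle n permutes {1..n + 1}"
  by (rule bij_fixing_imp_permutes[OF bij_long_cycle]) (auto simp: long_cycle_apply)

lemma long_cycle_power:
  assumes "k \<le> n + 1"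
  shows "(long_cycle n ^^ k) x =
    (if x = 0 \<or> n + 1 < x then x else if k < x then x - k else x + (n + 1) - k)"
  using assms
proof (induction k)
  case (Suc k)
  define y where "y = (if x = 0 \<or> n + 1 < x then x else if k < x then x - k else x + (n + 1) - k)"
  have "(long_cycle n ^^ Suc k) x = long_cycle n y" using Suc by (simp add: y_def)
  also have "\<dots> = (if x = 0 \<or> n + 1 < x then x
      else if Suc k < x then x - Suc k else x + (n + 1) - Suc k)"
    using Suc.prems by (auto simp: y_def long_cycle_apply)
  finally show ?case .
qed auto

lemma long_cycle_power_permutes: "long_cycle n ^^ k permutes {1..n + 1}"
proof (induction k)
  case (Suc k)
  then show ?case using permutes_compose[OF Suc long_cycle_permutes] by (simp only: funpow.simps)
qed (simp add: permutes_def)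

lemma long_cycle_power_mod: "long_cycle n ^^ k = long_cycle n ^^ (k mod (n + 1))"
proof -
  have "long_cycle n ^^ (n + 1) = id" by (rule ext, subst long_cycle_power) auto
  then have "(long_cycle n ^^ (n + 1)) ^^ j = id" for j by (induction j) auto
  moreover have "long_cycle n ^^ k =
      (long_cycle n ^^ (n + 1)) ^^ (k div (n + 1)) \<circ> long_cycle n ^^ (k mod (n + 1))"
    by (simp only: funpow_add[symmetric] funpow_mult mult_div_mod_eq)
  ultimately show ?thesis by (simp only: id_comp)
qed

text \<open>
  The cycle moves the preimage of \<open>n + 1\<close> to \<open>n + 1\<close>, so that composing with the inverse power
  yields a permutation that fixes \<open>n + 1\<close>. The exponent is the one in the definition of the induced action.
\<close>

lemma permutes_Suc_decomposition:
  assumes "\<mu> permutes {1..n + 1}"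
  defines "k \<equiv> inv \<mu> (n + 1) mod (n + 1)"
  shows "\<mu> \<circ> inv (long_cycle n ^^ k) permutes {1..n}"
    and "\<mu> = (\<mu> \<circ> inv (long_cycle n ^^ k)) \<circ> long_cycle n ^^ k"
proof -
  let ?c = "long_cycle n ^^ k"
  have c: "?c permutes {1..n + 1}" by (rule long_cycle_power_permutes)
  have perm: "\<mu> \<circ> inv ?c permutes {1..n + 1}"
    using assms c by (intro permutes_compose permutes_inv) auto
  have im: "inv \<mu> (n + 1) \<in> {1..n + 1}"
    using permutes_in_image[OF permutes_inv[OF assms(1)]] by simp
  have "?c (inv \<mu> (n + 1)) = n + 1"
  proof (cases "inv \<mu> (n + 1) = n + 1")
    case True
    then have "k = 0" by (simp add: k_def)
    then show ?thesis using True by simp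
  next
    case False
    then have "k = inv \<mu> (n + 1)" using im by (simp add: k_def)
    then show ?thesis using im by (subst long_cycle_power) auto
  qed
  then have "inv ?c (n + 1) = inv \<mu> (n + 1)" using c by (metis permutes_inverses(2))
  then have "(\<mu> \<circ> inv ?c) (n + 1) = n + 1" using assms(1) by (simp add: permutes_inverses)
  note fixed = this
  show "\<mu> \<circ> inv ?c permutes {1..n}"
  proof (rule permutes_superset[OF perm])
    fix x assume "x \<in> {1..n + 1} - {1..n}"
    then have "x = n + 1" by auto
    then show "(\<mu> \<circ> inv ?c) x = x" using fixed by simp
  qed
  show "\<mu> = (\<mu> \<circ> inv ?c) \<circ> ?c" using c by (simp add: o_assoc[symmetric] permutes_inv_o)
qed

text \<open>
  The exponent is determined modulo \<open>n + 1\<close> by any such factorization, which makes the induced action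
  computable from whatever factorization is at hand.
\<close>

lemma permutes_Suc_decomposition_unique:
  fixes k :: nat
  assumes "s permutes {1..n}"
  defines "\<mu> \<equiv> s \<circ> long_cycle n ^^ k"
  shows "inv \<mu> (n + 1) mod (n + 1) = k mod (n + 1)"
proof -
  \<comment> \<open>The power \<open>0\<close> fixes \<open>n + 1\<close>; the power \<open>k > 0\<close> sends \<open>k\<close> to \<open>n + 1\<close>.\<close>
  define k' where "k' = k mod (n + 1)"
  have \<mu>: "\<mu> permutes {1..n + 1}" unfolding \<mu>_def
    by (intro permutes_compose long_cycle_power_permutes permutes_subset[OF assms(1)]) auto
  let ?x = "if k' = 0 then n + 1 else k'"
  have k: "k' \<le> n" by (simp add: k'_def less_Suc_eq_le[symmetric])
  have "(long_cycle n ^^ k') ?x = n + 1" using k by (subst long_cycle_power) auto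
  then have "\<mu> ?x = s (n + 1)" unfolding \<mu>_def o_apply by (subst long_cycle_power_mod) (simp add: k'_def)
  also have "\<dots> = n + 1" using assms(1) by (simp add: permutes_not_in)
  finally have "inv \<mu> (n + 1) = ?x" by (simp only: permutes_inv_eq[OF \<mu>])
  then have "inv \<mu> (n + 1) mod (n + 1) = k'" using k by auto
  then show ?thesis by (simp only: k'_def)
qed

text \<open>
  Rotating \<open>q\<close> steps and then opening a gap agrees with opening the gap and then rotating until
  the letter \<open>q\<close> has left; if the gap lies before \<open>q\<close>, its \<open>n\<close> letters are passed as well.
\<close>

lemma long_cycle_power_make_room:
  assumes "p \<in> {1..m}" "q \<in> {1..m}" "q \<noteq> p" "z \<noteq> p" "1 \<le> n"
  shows "(long_cycle (m + n - 1) ^^ make_room p n q) (make_room p n z) =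
    make_room ((long_cycle m ^^ q) p) n ((long_cycle m ^^ q) z)"
proof -
  define k x p' z' where "k = make_room p n q" and "x = make_room p n z"
    and "p' = (long_cycle m ^^ q) p" and "z' = (long_cycle m ^^ q) z"
  note defs = k_def x_def make_room_def
  have p': "p' = (if q < p then p - q else p + (m + 1) - q)"
    using assms unfolding p'_def by (subst long_cycle_power) auto
  have z': "z' = (if z = 0 \<or> m + 1 < z then z else if q < z then z - q else z + (m + 1) - q)"
    using assms unfolding z'_def by (subst long_cycle_power) auto
  have "k \<le> m + n - 1 + 1" using assms by (auto simp: defs)
  then have "(long_cycle (m + n - 1) ^^ k) x =
      (if x = 0 \<or> m + n < x then x else if k < x then x - k else x + (m + n) - k)"
    using assms(5) by (subst long_cycle_power) simp_all
  moreover consider "z = 0" | "m + 1 < z" | "0 < z" "z \<le> m + 1" "q < z" | "0 < z" "z \<le> q"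
    by linarith
  then have "(if x = 0 \<or> m + n < x then x else if k < x then x - k else x + (m + n) - k) =
      make_room p' n z'"
  proof cases
    case 1 then show ?thesis using assms by (simp add: defs p' z')
  next
    case 2 then show ?thesis using assms by (cases "q < p") (auto simp: defs p' z')
  next
    case 3 then show ?thesis using assms by (cases "q < p"; cases "z < p") (auto simp: defs p' z')
  next
    case 4 then show ?thesis using assms by (cases "q < p"; cases "z < p") (auto simp: defs p' z')
  qed
  ultimately show ?thesis by (simp add: k_def x_def p'_def z'_def)
qed

text \<open>
  The permutation part of \<open>\<tau>(f \<circ>\<^sub>i g) = \<tau>(f) \<circ>\<^bsub>i-1\<^esub> g\<close>. Here \<open>q\<close> is the position
  of the letter \<open>1\<close>, so \<open>s\<close> is the permutation left over when \<open>\<sigma>\<close> is rotated. The word of \<open>\<pi>\<close> moves as one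
  block, from position \<open>p\<close> to position \<open>p'\<close>.
\<close>

lemma long_cycle_perm_comp:
  assumes "\<sigma> permutes {1..m}" "\<pi> permutes {1..n}" "s permutes {1..m}"
    and "\<sigma> p = i" "\<sigma> q = 1" "i \<in> {2..m}" "1 \<le> n"
    and s: "long_cycle m \<circ> \<sigma> = s \<circ> long_cycle m ^^ q"
  defines "p' \<equiv> (long_cycle m ^^ q) p"
  shows "s p' = i - 1"
    and "long_cycle (m + n - 1) \<circ> perm_comp m n i \<sigma> \<pi> =
      perm_comp m n (i - 1) s \<pi> \<circ> long_cycle (m + n - 1) ^^ make_room p n q"
proof -
  have im: "i \<in> {1..m}" "i - 1 \<in> {1..m}" and m: "1 \<in> {1..m}" using assms(6) by auto
  have p: "p \<in> {1..m}" "q \<in> {1..m}" "q \<noteq> p"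
    using assms(1,4,5,6) im m by (metis permutes_in_image, metis permutes_in_image, force)
  show p': "s p' = i - 1"
    using fun_cong[OF s, of p] assms(4,6) by (simp add: p'_def long_cycle_apply)
  have p'_eq: "p' = (if q < p then p - q else p + (m + 1) - q)"
    using p unfolding p'_def by (subst long_cycle_power) auto
  have qn: "make_room p n q \<le> m + n - 1 + 1" using p assms(7) by (auto simp: make_room_def)
  show "long_cycle (m + n - 1) \<circ> perm_comp m n i \<sigma> \<pi> =
      perm_comp m n (i - 1) s \<pi> \<circ> long_cycle (m + n - 1) ^^ make_room p n q"
  proof
    fix x
    have p1: "1 \<le> p" using p by simp
    from p1 assms(7) show "(long_cycle (m + n - 1) \<circ> perm_comp m n i \<sigma> \<pi>) x =
      (perm_comp m n (i - 1) s \<pi> \<circ> long_cycle (m + n - 1) ^^ make_room p n q) x"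
    proof (cases rule: make_room_cases[where x = x])
      case (outer z)
      let ?z = "(long_cycle m ^^ q) z"
      have z': "?z \<noteq> p'" using outer(1) permutes_inj[OF long_cycle_power_permutes[of q m]]
        by (auto simp: p'_def inj_eq)
      have sz: "\<sigma> z \<noteq> i" using outer assms(1,4) by (metis permutes_inverses(2))
      have "(long_cycle (m + n - 1) ^^ make_room p n q) (make_room p n z) = make_room p' n ?z"
        unfolding p'_def by (rule long_cycle_power_make_room[OF p outer(1) assms(7)])
      moreover have "long_cycle (m + n - 1) (make_room i n (\<sigma> z)) = make_room (i - 1) n (long_cycle m (\<sigma> z))"
        using sz assms(6,7) by (auto simp: make_room_def long_cycle_apply)
      moreover have "long_cycle m (\<sigma> z) = s ?z" using fun_cong[OF s, of z] by simp
      ultimately show ?thesis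
        using perm_comp_outer[OF assms(1,4) im(1) assms(7) outer(1), of \<pi>]
          perm_comp_outer[OF assms(3) p' im(2) assms(7) z', of \<pi>] outer(2) by simp
    next
      case (inner r)
      have "(long_cycle (m + n - 1) ^^ make_room p n q) (p - 1 + r) = p' - 1 + r"
        unfolding p'_eq using p inner assms(7)
        by (subst long_cycle_power[OF qn]) (auto simp: make_room_def)
      moreover have "\<pi> r \<in> {1..n}" using inner assms(2) by (metis permutes_in_image)
      then have "long_cycle (m + n - 1) (i - 1 + \<pi> r) = i - 1 - 1 + \<pi> r"
        using assms(6,7) by (auto simp: long_cycle_apply)
      ultimately show ?thesis
        using perm_comp_inner[OF assms(1,4) im(1) inner(1), of \<pi>]
          perm_comp_inner[OF assms(3) p' im(2) inner(1), of \<pi>] inner(2) by simp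
    qed
  qed
qed

text \<open>
  The permutation part of \<open>\<tau>(f \<circ>\<^sub>1 g) = - \<tau>(g) \<circ>\<^sub>n \<tau>(f)\<close>. Now the letter \<open>1\<close> lies
  inside the block of \<open>\<pi>\<close>, so the rotation cuts the block open: the
  remaining letters of \<open>\<sigma>\<close> become the inserted block and those of \<open>\<pi>\<close> surround it.
\<close>

lemma long_cycle_perm_comp_1:
  assumes "\<sigma> permutes {1..m}" "\<pi> permutes {1..n}" "s permutes {1..m}" "t permutes {1..n}"
    and "\<sigma> p = 1" "\<pi> q = 1" "1 \<le> m" "1 \<le> n"
    and s: "long_cycle m \<circ> \<sigma> = s \<circ> long_cycle m ^^ p"
    and t: "long_cycle n \<circ> \<pi> = t \<circ> long_cycle n ^^ q"
  shows "t (n + 1 - q) = n"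
    and "long_cycle (m + n - 1) \<circ> perm_comp m n 1 \<sigma> \<pi> =
      perm_comp n m n t s \<circ> long_cycle (m + n - 1) ^^ (p - 1 + q)"
proof -
  have mn: "1 \<in> {1..m}" "1 \<in> {1..n}" "n \<in> {1..n}" using assms by auto
  have p: "p \<in> {1..m}" "q \<in> {1..n}"
    using assms(1,2,5,6) mn by (metis permutes_in_image)+
  have "(long_cycle n ^^ q) (n + 1) = n + 1 - q"
    using p by (subst long_cycle_power) auto
  moreover have "\<pi> (n + 1) = n + 1" using assms(2) by (simp add: permutes_not_in)
  ultimately show tq: "t (n + 1 - q) = n"
    using fun_cong[OF t, of "n + 1"] \<open>1 \<le> n\<close> by (simp add: long_cycle_apply split: if_splits)
  have k: "p - 1 + q \<le> m + n - 1 + 1" using p by auto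
  show "long_cycle (m + n - 1) \<circ> perm_comp m n 1 \<sigma> \<pi> =
      perm_comp n m n t s \<circ> long_cycle (m + n - 1) ^^ (p - 1 + q)"
  proof
    fix x
    have p1: "1 \<le> p" using p by simp
    from p1 assms(8) show "(long_cycle (m + n - 1) \<circ> perm_comp m n 1 \<sigma> \<pi>) x =
      (perm_comp n m n t s \<circ> long_cycle (m + n - 1) ^^ (p - 1 + q)) x"
    proof (cases rule: make_room_cases[where x = x])
      case (outer z)
      let ?z = "(long_cycle m ^^ p) z"
      have z_eq: "?z = (if z = 0 \<or> m + 1 < z then z else if p < z then z - p else z + (m + 1) - p)"
        using p by (subst long_cycle_power) auto
      have sz: "\<sigma> z \<noteq> 1" using outer assms(1,5) by (metis permutes_inverses(2))
      have zs: "long_cycle m (\<sigma> z) = s ?z" using fun_cong[OF s, of z] by simp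
      show ?thesis
      proof (cases "z \<in> {1..m + 1}")
        case True
        have z': "?z \<in> {1..m}" unfolding z_eq using True p outer by auto
        have "(long_cycle (m + n - 1) ^^ (p - 1 + q)) (make_room p n z) = n + 1 - q - 1 + ?z"
          unfolding z_eq using p outer(1) True
          by (subst long_cycle_power[OF k]) (auto simp: make_room_def)
        moreover have "\<sigma> z \<in> {1..m + 1}"
          using True permutes_in_image[OF permutes_subset[OF assms(1)], of "{1..m+1}"] by auto
        then have "long_cycle (m + n - 1) (make_room 1 n (\<sigma> z)) = n - 1 + long_cycle m (\<sigma> z)"
          using sz assms(8) by (auto simp: make_room_def long_cycle_apply)
        ultimately show ?thesis
          using perm_comp_outer[OF assms(1,5) mn(1) assms(8) outer(1), of \<pi>]
            perm_comp_inner[OF assms(4) tq mn(3) z', of s] outer(2) zs by simp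
      next
        case False
        then have x: "x = 0 \<or> m + n < x" using outer p assms(8) by (auto simp: make_room_def)
        have "(long_cycle (m + n - 1) ^^ (p - 1 + q)) x = x" using x
          using assms(8) by (subst long_cycle_power[OF k]) auto
        moreover have "x < 1 \<or> m + n - 1 < x" "x < 1 \<or> n + m - 1 < x" using x by auto
        then have "perm_comp m n 1 \<sigma> \<pi> x = x" "perm_comp n m n t s x = x"
          by (simp_all only: perm_comp_def Let_def if_True)
        moreover have "long_cycle (m + n - 1) x = x" using x assms(8) by (auto simp: long_cycle_apply)
        ultimately show ?thesis by simp
      qed
    next
      case (inner r)
      let ?r = "(long_cycle n ^^ q) r"
      have r_eq: "?r = (if q < r then r - q else r + (n + 1) - q)"
        using p inner by (subst long_cycle_power) auto
      have r': "?r \<noteq> n + 1 - q" using p inner unfolding r_eq by auto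
      have "(long_cycle (m + n - 1) ^^ (p - 1 + q)) (p - 1 + r) = make_room (n + 1 - q) m ?r"
        unfolding r_eq using p inner(1)
        by (subst long_cycle_power[OF k]) (auto simp: make_room_def)
      moreover have "\<pi> r \<in> {1..n}" using inner assms(2) by (metis permutes_in_image)
      then have "long_cycle (m + n - 1) (\<pi> r) = make_room n m (long_cycle n (\<pi> r))"
        using assms(7,8) by (auto simp: make_room_def long_cycle_apply)
      moreover have "long_cycle n (\<pi> r) = t ?r" using fun_cong[OF t, of r] by simp
      ultimately show ?thesis
        using perm_comp_inner[OF assms(1,5) mn(1) inner(1), of \<pi>]
          perm_comp_outer[OF assms(4) tq mn(3) assms(7) r', of s] inner(2) by simp
    qed
  qed
qed

section \<open>Multilinear maps on spanned subspaces\<close>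

lemma linear_map_on_closed: "linear_map_on sV V sW W f \<Longrightarrow> x \<in> V \<Longrightarrow> f x \<in> W"
  by (simp add: linear_map_on_def)

lemma linear_map_on_add:
  "linear_map_on sV V sW W f \<Longrightarrow> x \<in> V \<Longrightarrow> y \<in> V \<Longrightarrow> f (x + y) = f x + f y"
  by (simp add: linear_map_on_def)

lemma linear_map_on_scale: "linear_map_on sV V sW W f \<Longrightarrow> x \<in> V \<Longrightarrow> f (sV c x) = sW c (f x)"
  by (simp add: linear_map_on_def)

lemma linear_map_on_zero:
  assumes "linear_map_on sV V sW W f" "0 \<in> V"
  shows "f 0 = 0"
  using linear_map_on_add[OF assms(1) assms(2) assms(2)] by simp

lemma linear_map_on_compose:
  "linear_map_on sV V sW W f \<Longrightarrow> linear_map_on sU U sV V g \<Longrightarrow> linear_map_on sU U sW W (\<lambda>x. f (g x))"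
  by (simp add: linear_map_on_def)

lemma linear_map_on_ident: "linear_map_on sV V sV V (\<lambda>x. x)"
  by (simp add: linear_map_on_def)

lemma linear_map_on_funpow:
  "linear_map_on sV V sV V f \<Longrightarrow> linear_map_on sV V sV V (f ^^ k)"
  by (induction k) (auto simp: linear_map_on_def)


lemma linear_map_on_uminus:
  assumes "vector_space sW" "module.subspace sW W" "linear_map_on sV V sW W f"
  shows "linear_map_on sV V sW W (\<lambda>x. - f x)"
proof -
  interpret vector_space sW by fact
  show ?thesis using assms(2,3) by (auto simp: linear_map_on_def subspace_neg)
qed

lemma linear_map_on_sum:
  assumes "vector_space sW" "module.subspace sW W" "\<And>a. a \<in> A \<Longrightarrow> linear_map_on sV V sW W (h a)"
  shows "linear_map_on sV V sW W (\<lambda>x. \<Sum>a\<in>A. h a x)"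
proof -
  interpret vector_space sW by fact
  show ?thesis
    using assms(2,3) by (auto simp: linear_map_on_def sum.distrib scale_sum_right intro!: subspace_sum)
qed

text \<open>
  The axioms of an operad are multilinear identities. This rule and its bilinear and trilinear
  versions reduce them to spanning sets, the tensors \<open>E \<otimes> \<sigma>\<close> for a symmetrization and the basis for Dias.
\<close>

lemma linear_map_on_eqI:
  assumes "vector_space sV" and V: "V = module.span sV B"
    and F: "linear_map_on sV V sW W F" and G: "linear_map_on sV V sW W G"
    and eq: "\<And>b. b \<in> B \<Longrightarrow> F b = G b" and x: "x \<in> V"
  shows "F x = G x"
proof -
  interpret vector_space sV by fact
  from x have "x \<in> span B" by (simp add: V)
  then have "x \<in> V \<and> F x = G x"
  proof (induction rule: span_induct_alt)
    case base
    have "0 \<in> V" by (simp add: V span_zero)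
    then show ?case using linear_map_on_zero[OF F] linear_map_on_zero[OF G] by simp
  next
    case (step c b y)
    have "b \<in> V" "sV c b \<in> V" using step by (auto simp: V span_base span_scale)
    then show ?case
      using step eq linear_map_on_add[OF F] linear_map_on_add[OF G]
        linear_map_on_scale[OF F] linear_map_on_scale[OF G] by (auto simp: V span_add)
  qed
  then show ?thesis by simp
qed

lemma bilinear_map_on_eqI:
  assumes U: "vector_space sU" "U = module.span sU A" and V: "vector_space sV" "V = module.span sV B"
    and 1: "\<And>v. v \<in> V \<Longrightarrow> linear_map_on sU U sW W (\<lambda>u. F u v)"
      "\<And>v. v \<in> V \<Longrightarrow> linear_map_on sU U sW W (\<lambda>u. G u v)"
    and 2: "\<And>u. u \<in> U \<Longrightarrow> linear_map_on sV V sW W (F u)" "\<And>u. u \<in> U \<Longrightarrow> linear_map_on sV V sW W (G u)"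
    and eq: "\<And>a b. a \<in> A \<Longrightarrow> b \<in> B \<Longrightarrow> F a b = G a b"
    and u: "u \<in> U" "v \<in> V"
  shows "F u v = G u v"
proof (rule linear_map_on_eqI[OF U 1[OF u(2)] _ u(1)])
  fix a assume a: "a \<in> A"
  interpret vector_space sU by fact
  have "a \<in> U" using a by (simp add: U(2) span_base)
  then show "F a v = G a v" by (intro linear_map_on_eqI[OF V 2 _ u(2)] eq a)
qed

lemma trilinear_map_on_eqI:
  assumes T: "vector_space sT" "T = module.span sT A" and U: "vector_space sU" "U = module.span sU B"
    and V: "vector_space sV" "V = module.span sV C"
    and 1: "\<And>u v. u \<in> U \<Longrightarrow> v \<in> V \<Longrightarrow> linear_map_on sT T sW W (\<lambda>t. F t u v)"
      "\<And>u v. u \<in> U \<Longrightarrow> v \<in> V \<Longrightarrow> linear_map_on sT T sW W (\<lambda>t. G t u v)"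
    and 2: "\<And>t v. t \<in> T \<Longrightarrow> v \<in> V \<Longrightarrow> linear_map_on sU U sW W (\<lambda>u. F t u v)"
      "\<And>t v. t \<in> T \<Longrightarrow> v \<in> V \<Longrightarrow> linear_map_on sU U sW W (\<lambda>u. G t u v)"
    and 3: "\<And>t u. t \<in> T \<Longrightarrow> u \<in> U \<Longrightarrow> linear_map_on sV V sW W (F t u)"
      "\<And>t u. t \<in> T \<Longrightarrow> u \<in> U \<Longrightarrow> linear_map_on sV V sW W (G t u)"
    and eq: "\<And>a b c. a \<in> A \<Longrightarrow> b \<in> B \<Longrightarrow> c \<in> C \<Longrightarrow> F a b c = G a b c"
    and t: "t \<in> T" "u \<in> U" "v \<in> V"
  shows "F t u v = G t u v"
proof -
  interpret T: vector_space sT by fact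
  interpret U: vector_space sU by fact
  show ?thesis
  proof (rule bilinear_map_on_eqI[where sW = sW and W = W, OF T U _ _ _ _ _ t(1,2)])
    fix a b assume ab: "a \<in> A" "b \<in> B"
    have "a \<in> T" "b \<in> U"
      using ab T.span_base U.span_base by (simp_all add: T(2) U(2))
    then show "F a b v = G a b v" by (intro linear_map_on_eqI[OF V 3 _ t(3)] eq ab)
  qed (intro 1 2 t(3); assumption)+
qed

section \<open>The symmetrization of a non-symmetric operad\<close>

lemma poly_mapping_sum_single: "(\<Sum>k\<in>Poly_Mapping.keys f. Poly_Mapping.single k (Poly_Mapping.lookup f k)) = f"
  by (rule poly_mapping_eqI) (auto simp: lookup_sum lookup_single when_def in_keys_iff)

lemma symmetrization_simps:
  "op_scale (symmetrization P) c = Poly_Mapping.map (op_scale P c)"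
  "op_unit (symmetrization P) = Poly_Mapping.single id (op_unit P)"
  by (simp_all add: symmetrization_def)

lemma symmetrization_space_iff:
  "f \<in> op_space (symmetrization P) n \<longleftrightarrow>
    (\<forall>\<sigma>. Poly_Mapping.lookup f \<sigma> \<noteq> 0 \<longrightarrow> \<sigma> permutes {1..n} \<and> Poly_Mapping.lookup f \<sigma> \<in> op_space P n)"
  by (auto simp: symmetrization_def in_keys_iff)

context ns_operad
begin

abbreviation "Sym \<equiv> symmetrization P"

lemma zero_in_space: "1 \<le> n \<Longrightarrow> 0 \<in> op_space P n"
  using subspace_op_space subspace_0 by blast

lemma lookup_sym_scale:
  "Poly_Mapping.lookup (op_scale Sym c f) \<sigma> = op_scale P c (Poly_Mapping.lookup f \<sigma>)"
  by (simp add: symmetrization_simps Poly_Mapping.map.rep_eq when_def)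

lemma sym_vector_space: "vector_space (op_scale Sym)"
  by standard (auto intro!: poly_mapping_eqI simp: lookup_sym_scale lookup_add algebra_simps scale_left_distrib)

interpretation sym: vector_space "op_scale Sym"
  by (rule sym_vector_space)

lemma sym_scale_single:
  "op_scale Sym c (Poly_Mapping.single \<sigma> E) = Poly_Mapping.single \<sigma> (op_scale P c E)"
  by (rule poly_mapping_eqI) (simp add: lookup_sym_scale lookup_single when_def)

lemma sym_lookup_in:
  assumes "1 \<le> n" "f \<in> op_space Sym n"
  shows "Poly_Mapping.lookup f \<sigma> \<in> op_space P n"
  using assms zero_in_space[OF assms(1)]
  by (cases "Poly_Mapping.lookup f \<sigma> = 0") (auto simp: symmetrization_space_iff)

lemma sym_subspace:
  assumes "1 \<le> n"
  shows "sym.subspace (op_space Sym n)"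
proof -
  note s = subspace_op_space[OF assms]
  have add: "f + g \<in> op_space Sym n" if f: "f \<in> op_space Sym n" "g \<in> op_space Sym n" for f g
    unfolding symmetrization_space_iff
  proof (intro allI impI)
    fix \<sigma> assume "Poly_Mapping.lookup (f + g) \<sigma> \<noteq> 0"
    then have "Poly_Mapping.lookup f \<sigma> \<noteq> 0 \<or> Poly_Mapping.lookup g \<sigma> \<noteq> 0" by (auto simp: lookup_add)
    then show "\<sigma> permutes {1..n} \<and> Poly_Mapping.lookup (f + g) \<sigma> \<in> op_space P n"
      using f sym_lookup_in[OF assms] subspace_add[OF s]
      by (auto simp: symmetrization_space_iff lookup_add)
  qed
  have scale: "op_scale Sym c f \<in> op_space Sym n" if "f \<in> op_space Sym n" for c f
    using that by (auto simp: symmetrization_space_iff lookup_sym_scale intro!: subspace_scale[OF s])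
  show ?thesis
    by (rule sym.subspaceI) (use add scale in \<open>simp_all add: symmetrization_space_iff[of 0]\<close>)
qed

lemma sym_single_in:
  "\<sigma> permutes {1..n} \<Longrightarrow> E \<in> op_space P n \<Longrightarrow> Poly_Mapping.single \<sigma> E \<in> op_space Sym n"
  by (auto simp: symmetrization_space_iff lookup_single when_def)

lemma linear_single:
  assumes "\<sigma> permutes {1..n}"
  shows "linear_map_on (op_scale P) (op_space P n) (op_scale Sym) (op_space Sym n) (Poly_Mapping.single \<sigma>)"
  using assms by (auto simp: linear_map_on_def single_add sym_scale_single sym_single_in)

lemma sym_space_span:
  assumes n: "1 \<le> n"
  shows "op_space Sym n = sym.span {Poly_Mapping.single \<sigma> E |\<sigma> E. \<sigma> permutes {1..n} \<and> E \<in> op_space P n}"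
    (is "_ = sym.span ?B")
proof
  show "op_space Sym n \<subseteq> sym.span ?B"
  proof
    fix f assume "f \<in> op_space Sym n"
    then have "(\<Sum>\<sigma>\<in>Poly_Mapping.keys f. Poly_Mapping.single \<sigma> (Poly_Mapping.lookup f \<sigma>)) \<in> sym.span ?B"
      by (intro sym.span_sum sym.span_base) (auto simp: symmetrization_space_iff in_keys_iff)
    then show "f \<in> sym.span ?B" by (simp add: poly_mapping_sum_single)
  qed
  show "sym.span ?B \<subseteq> op_space Sym n"
    by (rule sym.span_minimal[OF _ sym_subspace[OF n]]) (auto intro: sym_single_in)
qed

lemma sym_linear_eqI:
  assumes n: "1 \<le> n"
    and F: "linear_map_on (op_scale Sym) (op_space Sym n) sW W F"
    and G: "linear_map_on (op_scale Sym) (op_space Sym n) sW W G"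
    and eq: "\<And>\<sigma> E. \<sigma> permutes {1..n} \<Longrightarrow> E \<in> op_space P n \<Longrightarrow>
      F (Poly_Mapping.single \<sigma> E) = G (Poly_Mapping.single \<sigma> E)"
    and f: "f \<in> op_space Sym n"
  shows "F f = G f"
  by (rule linear_map_on_eqI[OF sym_vector_space sym_space_span[OF n] F G _ f]) (use eq in auto)

lemma sym_keys_sum:
  assumes n: "1 \<le> n" and f: "f \<in> op_space Sym n"
    and G: "\<And>\<sigma>. \<sigma> permutes {1..n} \<Longrightarrow> G \<sigma> 0 = 0"
  shows "(\<Sum>\<sigma>\<in>Poly_Mapping.keys f. G \<sigma> (Poly_Mapping.lookup f \<sigma>)) =
    (\<Sum>\<sigma> | \<sigma> permutes {1..n}. G \<sigma> (Poly_Mapping.lookup f \<sigma>))"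
  using f G by (intro sum.mono_neutral_left)
    (auto simp: finite_permutations symmetrization_space_iff in_keys_iff)

lemma linear_lookup:
  assumes "1 \<le> n"
  shows "linear_map_on (op_scale Sym) (op_space Sym n) (op_scale P) (op_space P n) (\<lambda>f. Poly_Mapping.lookup f \<sigma>)"
  using sym_lookup_in[OF assms] by (simp add: linear_map_on_def lookup_add lookup_sym_scale)

text \<open>
  The composition, the action of the symmetric group and the induced action are all sums over the support
  of an argument. The support depends on the argument, so linearity is seen
  only after extending the sum to all permutations.
\<close>

lemma linear_keys_sum:
  assumes n: "1 \<le> n" and N: "1 \<le> N"
    and G: "\<And>\<sigma>. \<sigma> permutes {1..n} \<Longrightarrow>
      linear_map_on (op_scale P) (op_space P n) (op_scale Sym) (op_space Sym N) (G \<sigma>)"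
  shows "linear_map_on (op_scale Sym) (op_space Sym n) (op_scale Sym) (op_space Sym N)
    (\<lambda>f. \<Sum>\<sigma>\<in>Poly_Mapping.keys f. G \<sigma> (Poly_Mapping.lookup f \<sigma>))"
proof -
  have "G \<sigma> 0 = 0" if "\<sigma> permutes {1..n}" for \<sigma>
    using linear_map_on_zero[OF G[OF that] zero_in_space[OF n]] .
  then have eq: "(\<Sum>\<sigma>\<in>Poly_Mapping.keys f. G \<sigma> (Poly_Mapping.lookup f \<sigma>)) =
      (\<Sum>\<sigma> | \<sigma> permutes {1..n}. G \<sigma> (Poly_Mapping.lookup f \<sigma>))" if "f \<in> op_space Sym n" for f
    using that n by (intro sym_keys_sum)
  have "linear_map_on (op_scale Sym) (op_space Sym n) (op_scale Sym) (op_space Sym N)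
    (\<lambda>f. \<Sum>\<sigma> | \<sigma> permutes {1..n}. G \<sigma> (Poly_Mapping.lookup f \<sigma>))"
    using linear_map_on_compose[OF G linear_lookup[OF n]]
    by (intro linear_map_on_sum sym_vector_space sym_subspace[OF N]) auto
  then show ?thesis
    using eq sym.subspace_add[OF sym_subspace[OF n]] sym.subspace_scale[OF sym_subspace[OF n]]
    by (simp add: linear_map_on_def)
qed

lemma inv_in_interval: "\<sigma> permutes {1..m} \<Longrightarrow> 1 \<le> i \<Longrightarrow> i \<le> m \<Longrightarrow> 1 \<le> inv \<sigma> i \<and> inv \<sigma> i \<le> m"
  using permutes_in_image[OF permutes_inv, of \<sigma> "{1..m}" i] by simp

lemma sym_comp_def:
  "op_comp Sym m n i f g = (\<Sum>\<sigma>\<in>Poly_Mapping.keys f. \<Sum>\<pi>\<in>Poly_Mapping.keys g.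
        Poly_Mapping.single (perm_comp m n i \<sigma> \<pi>)
          (op_comp P m n (inv \<sigma> i) (Poly_Mapping.lookup f \<sigma>) (Poly_Mapping.lookup g \<pi>)))"
  by (simp add: symmetrization_def)

lemma sym_comp_linear_left:
  assumes "1 \<le> i" "i \<le> m" "1 \<le> n" "g \<in> op_space Sym n"
  shows "linear_map_on (op_scale Sym) (op_space Sym m) (op_scale Sym) (op_space Sym (m + n - 1))
        (\<lambda>f. op_comp Sym m n i f g)"
proof -
  let ?G = "\<lambda>\<sigma> E. \<Sum>\<pi>\<in>Poly_Mapping.keys g. Poly_Mapping.single (perm_comp m n i \<sigma> \<pi>)
          (op_comp P m n (inv \<sigma> i) E (Poly_Mapping.lookup g \<pi>))"
  have "linear_map_on (op_scale Sym) (op_space Sym m) (op_scale Sym) (op_space Sym (m + n - 1))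
    (\<lambda>f. \<Sum>\<sigma>\<in>Poly_Mapping.keys f. ?G \<sigma> (Poly_Mapping.lookup f \<sigma>))"
  proof (rule linear_keys_sum[where G = ?G])
    show "1 \<le> m" "1 \<le> m + n - 1" using assms by auto
    fix \<sigma> assume \<sigma>: "\<sigma> permutes {1..m}"
    show "linear_map_on (op_scale P) (op_space P m) (op_scale Sym) (op_space Sym (m + n - 1))
       (\<lambda>E. \<Sum>\<pi>\<in>Poly_Mapping.keys g. Poly_Mapping.single (perm_comp m n i \<sigma> \<pi>)
            (op_comp P m n (inv \<sigma> i) E (Poly_Mapping.lookup g \<pi>)))"
    proof (rule linear_map_on_sum[OF sym_vector_space sym_subspace])
      show "1 \<le> m + n - 1" using assms by auto
      fix \<pi> assume "\<pi> \<in> Poly_Mapping.keys g"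
      then have \<pi>: "\<pi> permutes {1..n}" "Poly_Mapping.lookup g \<pi> \<in> op_space P n"
        using assms(4) by (simp_all add: symmetrization_space_iff in_keys_iff)
      have "perm_comp m n i \<sigma> \<pi> permutes {1..m + n - 1}"
        using assms by (intro perm_comp_permutes \<sigma> \<pi>) auto
      moreover have "1 \<le> inv \<sigma> i" "inv \<sigma> i \<le> m" using inv_in_interval[OF \<sigma> assms(1,2)] by auto
      ultimately show "linear_map_on (op_scale P) (op_space P m) (op_scale Sym) (op_space Sym (m + n - 1))
          (\<lambda>E. Poly_Mapping.single (perm_comp m n i \<sigma> \<pi>) (op_comp P m n (inv \<sigma> i) E (Poly_Mapping.lookup g \<pi>)))"
        by (intro linear_map_on_compose[OF linear_single comp_linear_left] \<pi> assms)
    qed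
  qed
  then show ?thesis by (simp only: sym_comp_def)
qed

lemma sym_comp_linear_right:
  assumes "1 \<le> i" "i \<le> m" "1 \<le> n" "f \<in> op_space Sym m"
  shows "linear_map_on (op_scale Sym) (op_space Sym n) (op_scale Sym) (op_space Sym (m + n - 1))
        (\<lambda>g. op_comp Sym m n i f g)"
proof -
  let ?G = "\<lambda>\<pi> E. \<Sum>\<sigma>\<in>Poly_Mapping.keys f. Poly_Mapping.single (perm_comp m n i \<sigma> \<pi>)
          (op_comp P m n (inv \<sigma> i) (Poly_Mapping.lookup f \<sigma>) E)"
  have "linear_map_on (op_scale Sym) (op_space Sym n) (op_scale Sym) (op_space Sym (m + n - 1))
    (\<lambda>g. \<Sum>\<pi>\<in>Poly_Mapping.keys g. ?G \<pi> (Poly_Mapping.lookup g \<pi>))"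
  proof (rule linear_keys_sum[where G = ?G])
    show "1 \<le> n" "1 \<le> m + n - 1" using assms by auto
    fix \<pi> assume \<pi>: "\<pi> permutes {1..n}"
    show "linear_map_on (op_scale P) (op_space P n) (op_scale Sym) (op_space Sym (m + n - 1))
       (\<lambda>E. \<Sum>\<sigma>\<in>Poly_Mapping.keys f. Poly_Mapping.single (perm_comp m n i \<sigma> \<pi>)
            (op_comp P m n (inv \<sigma> i) (Poly_Mapping.lookup f \<sigma>) E))"
    proof (rule linear_map_on_sum[OF sym_vector_space sym_subspace])
      show "1 \<le> m + n - 1" using assms by auto
      fix \<sigma> assume "\<sigma> \<in> Poly_Mapping.keys f"
      then have \<sigma>: "\<sigma> permutes {1..m}" "Poly_Mapping.lookup f \<sigma> \<in> op_space P m"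
        using assms(4) by (simp_all add: symmetrization_space_iff in_keys_iff)
      have "perm_comp m n i \<sigma> \<pi> permutes {1..m + n - 1}"
        using assms by (intro perm_comp_permutes \<sigma> \<pi>) auto
      moreover have "1 \<le> inv \<sigma> i" "inv \<sigma> i \<le> m" using inv_in_interval[OF \<sigma>(1) assms(1,2)] by auto
      ultimately show "linear_map_on (op_scale P) (op_space P n) (op_scale Sym) (op_space Sym (m + n - 1))
          (\<lambda>E. Poly_Mapping.single (perm_comp m n i \<sigma> \<pi>) (op_comp P m n (inv \<sigma> i) (Poly_Mapping.lookup f \<sigma>) E))"
        by (intro linear_map_on_compose[OF linear_single comp_linear_right] \<sigma> assms)
    qed
  qed
  moreover have "op_comp Sym m n i f = (\<lambda>g. \<Sum>\<pi>\<in>Poly_Mapping.keys g. ?G \<pi> (Poly_Mapping.lookup g \<pi>))"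
    by (rule ext, unfold sym_comp_def, rule sum.swap)
  ultimately show ?thesis by simp
qed

lemma sym_comp_single:
  assumes "1 \<le> i" "i \<le> m" "1 \<le> n" "\<sigma> permutes {1..m}" "E \<in> op_space P m" "F \<in> op_space P n"
  shows "op_comp Sym m n i (Poly_Mapping.single \<sigma> E) (Poly_Mapping.single \<pi> F) =
    Poly_Mapping.single (perm_comp m n i \<sigma> \<pi>) (op_comp P m n (inv \<sigma> i) E F)"
proof -
  have i: "1 \<le> inv \<sigma> i" "inv \<sigma> i \<le> m" using inv_in_interval[OF assms(4,1,2)] by auto
  have "op_comp P m n (inv \<sigma> i) 0 F = 0" "op_comp P m n (inv \<sigma> i) E 0 = 0"
    using linear_map_on_zero[OF comp_linear_left[OF i assms(3,6)]]
      linear_map_on_zero[OF comp_linear_right[OF i assms(3,5)]] zero_in_space assms by auto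
  then show ?thesis
    unfolding sym_comp_def by (cases "E = 0"; cases "F = 0") simp_all
qed

lemma sym_act_linear:
  assumes "1 \<le> n" "\<sigma> permutes {1..n}"
  shows "linear_map_on (op_scale Sym) (op_space Sym n) (op_scale Sym) (op_space Sym n) (op_act Sym n \<sigma>)"
proof -
  have "op_act Sym n \<sigma> = (\<lambda>f. \<Sum>\<pi>\<in>Poly_Mapping.keys f. Poly_Mapping.single (\<sigma> \<circ> \<pi>) (Poly_Mapping.lookup f \<pi>))"
    by (simp add: symmetrization_def)
  then show ?thesis
    using assms by (simp only:) (intro linear_keys_sum linear_single permutes_compose)
qed

lemma sym_act_single:
  "op_act Sym n \<sigma> (Poly_Mapping.single \<pi> E) = Poly_Mapping.single (\<sigma> \<circ> \<pi>) E"
  by (cases "E = 0") (simp_all add: symmetrization_def)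

lemma sym_bilinear_eqI:
  assumes n: "1 \<le> l" "1 \<le> m"
    and 1: "\<And>g. g \<in> op_space Sym m \<Longrightarrow> linear_map_on (op_scale Sym) (op_space Sym l) sW W (\<lambda>f. F f g)"
      "\<And>g. g \<in> op_space Sym m \<Longrightarrow> linear_map_on (op_scale Sym) (op_space Sym l) sW W (\<lambda>f. G f g)"
    and 2: "\<And>f. f \<in> op_space Sym l \<Longrightarrow> linear_map_on (op_scale Sym) (op_space Sym m) sW W (\<lambda>g. F f g)"
      "\<And>f. f \<in> op_space Sym l \<Longrightarrow> linear_map_on (op_scale Sym) (op_space Sym m) sW W (\<lambda>g. G f g)"
    and eq: "\<And>\<sigma> \<pi> A B. \<lbrakk>\<sigma> permutes {1..l}; \<pi> permutes {1..m}; A \<in> op_space P l; B \<in> op_space P m\<rbrakk> \<Longrightarrow>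
      F (Poly_Mapping.single \<sigma> A) (Poly_Mapping.single \<pi> B) = G (Poly_Mapping.single \<sigma> A) (Poly_Mapping.single \<pi> B)"
    and f: "f \<in> op_space Sym l" "g \<in> op_space Sym m"
  shows "F f g = G f g"
  by (rule bilinear_map_on_eqI[OF sym_vector_space sym_space_span[OF n(1)]
        sym_vector_space sym_space_span[OF n(2)] 1 2 _ f]) (use eq in auto)

lemma sym_trilinear_eqI:
  assumes n: "1 \<le> l" "1 \<le> m" "1 \<le> n"
    and 1: "\<And>g h. g \<in> op_space Sym m \<Longrightarrow> h \<in> op_space Sym n \<Longrightarrow>
        linear_map_on (op_scale Sym) (op_space Sym l) sW W (\<lambda>f. F f g h)"
      "\<And>g h. g \<in> op_space Sym m \<Longrightarrow> h \<in> op_space Sym n \<Longrightarrow>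
        linear_map_on (op_scale Sym) (op_space Sym l) sW W (\<lambda>f. G f g h)"
    and 2: "\<And>f h. f \<in> op_space Sym l \<Longrightarrow> h \<in> op_space Sym n \<Longrightarrow>
        linear_map_on (op_scale Sym) (op_space Sym m) sW W (\<lambda>g. F f g h)"
      "\<And>f h. f \<in> op_space Sym l \<Longrightarrow> h \<in> op_space Sym n \<Longrightarrow>
        linear_map_on (op_scale Sym) (op_space Sym m) sW W (\<lambda>g. G f g h)"
    and 3: "\<And>f g. f \<in> op_space Sym l \<Longrightarrow> g \<in> op_space Sym m \<Longrightarrow>
        linear_map_on (op_scale Sym) (op_space Sym n) sW W (F f g)"
      "\<And>f g. f \<in> op_space Sym l \<Longrightarrow> g \<in> op_space Sym m \<Longrightarrow>
        linear_map_on (op_scale Sym) (op_space Sym n) sW W (G f g)"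
    and eq: "\<And>\<sigma> \<pi> \<rho> A B C. \<lbrakk>\<sigma> permutes {1..l}; \<pi> permutes {1..m}; \<rho> permutes {1..n};
        A \<in> op_space P l; B \<in> op_space P m; C \<in> op_space P n\<rbrakk> \<Longrightarrow>
      F (Poly_Mapping.single \<sigma> A) (Poly_Mapping.single \<pi> B) (Poly_Mapping.single \<rho> C) =
      G (Poly_Mapping.single \<sigma> A) (Poly_Mapping.single \<pi> B) (Poly_Mapping.single \<rho> C)"
    and f: "f \<in> op_space Sym l" "g \<in> op_space Sym m" "h \<in> op_space Sym n"
  shows "F f g h = G f g h"
  by (rule trilinear_map_on_eqI[OF sym_vector_space sym_space_span[OF n(1)]
        sym_vector_space sym_space_span[OF n(2)] sym_vector_space sym_space_span[OF n(3)] 1 2 3 _ f])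
    (use eq in auto)

lemma sym_comp_closed:
  "\<lbrakk>1 \<le> i; i \<le> m; 1 \<le> n; f \<in> op_space Sym m; g \<in> op_space Sym n\<rbrakk> \<Longrightarrow>
    op_comp Sym m n i f g \<in> op_space Sym (m + n - 1)"
  using linear_map_on_closed[OF sym_comp_linear_left] by blast

lemma comp_closed:
  "\<lbrakk>1 \<le> i; i \<le> m; 1 \<le> n; f \<in> op_space P m; g \<in> op_space P n\<rbrakk> \<Longrightarrow>
    op_comp P m n i f g \<in> op_space P (m + n - 1)"
  using linear_map_on_closed[OF comp_linear_left] by blast

lemma sym_comp_assoc_seq:
  assumes i: "1 \<le> i" "i \<le> l" "1 \<le> j" "j \<le> m" "1 \<le> n"
    and f: "f \<in> op_space Sym l" "g \<in> op_space Sym m" "h \<in> op_space Sym n"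
  shows "op_comp Sym (l + m - 1) n (i - 1 + j) (op_comp Sym l m i f g) h =
       op_comp Sym l (m + n - 1) i f (op_comp Sym m n j g h)"
proof -
  have pos: "1 \<le> i - 1 + j" "i - 1 + j \<le> l + m - 1" "1 \<le> m" "1 \<le> l" "1 \<le> m + n - 1"
    and N: "l + m - 1 + n - 1 = l + (m + n - 1) - 1"
    using i by auto
  show ?thesis
  proof (rule sym_trilinear_eqI[where sW = "op_scale Sym" and W = "op_space Sym (l + m - 1 + n - 1)", OF pos(4,3) i(5) _ _ _ _ _ _ _ f])
    fix \<sigma> \<pi> \<rho> E F G assume p: "\<sigma> permutes {1..l}" "\<pi> permutes {1..m}" "\<rho> permutes {1..n}"
      and E: "E \<in> op_space P l" "F \<in> op_space P m" "G \<in> op_space P n"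
    define p where "p = inv \<sigma> i"
    define q where "q = inv \<pi> j"
    have s: "\<sigma> p = i" "\<pi> q = j" "1 \<le> p" "p \<le> l" "1 \<le> q" "q \<le> m"
      using p i inv_in_interval[of \<sigma> l i] inv_in_interval[of \<pi> m j]
      by (auto simp: p_def q_def permutes_inverses)
    have "inv (perm_comp l m i \<sigma> \<pi>) (i - 1 + \<pi> q) = p - 1 + q"
      using p s i by (intro inv_perm_comp_inner) auto
    then have inv: "inv (perm_comp l m i \<sigma> \<pi>) (i - 1 + j) = p - 1 + q" using s by simp
    have perm: "perm_comp l m i \<sigma> \<pi> permutes {1..l + m - 1}"
      using p i by (intro perm_comp_permutes) auto
    have c: "op_comp P l m p E F \<in> op_space P (l + m - 1)" "op_comp P m n q F G \<in> op_space P (m + n - 1)"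
      by (intro comp_closed s pos i E)+
    have il: "i \<in> {1..l}" "j \<in> {1..m}" using i by auto
    show "op_comp Sym (l + m - 1) n (i - 1 + j) (op_comp Sym l m i (Poly_Mapping.single \<sigma> E) (Poly_Mapping.single \<pi> F))
        (Poly_Mapping.single \<rho> G) =
       op_comp Sym l (m + n - 1) i (Poly_Mapping.single \<sigma> E)
         (op_comp Sym m n j (Poly_Mapping.single \<pi> F) (Poly_Mapping.single \<rho> G))"
      unfolding sym_comp_single[OF i(1,2) pos(3) p(1) E(1,2), folded p_def]
        sym_comp_single[OF i(3,4,5) p(2) E(2,3), folded q_def]
        sym_comp_single[OF pos(1,2) i(5) perm c(1) E(3), unfolded inv]
        sym_comp_single[OF i(1,2) pos(5) p(1) E(1) c(2), folded p_def]
        comp_assoc_seq[OF s(3,4,5,6) i(5) E]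
        perm_comp_assoc_seq[OF p s(1,2) il i(5)] ..
  next
    fix g h assume gh: "g \<in> op_space Sym m" "h \<in> op_space Sym n"
    note cl = sym_comp_closed[OF i(3,4,5) gh]
    show "linear_map_on (op_scale Sym) (op_space Sym l) (op_scale Sym) (op_space Sym (l + m - 1 + n - 1))
      (\<lambda>f. op_comp Sym (l + m - 1) n (i - 1 + j) (op_comp Sym l m i f g) h)"
      by (intro linear_map_on_compose[OF sym_comp_linear_left sym_comp_linear_left] gh i pos)
    show "linear_map_on (op_scale Sym) (op_space Sym l) (op_scale Sym) (op_space Sym (l + m - 1 + n - 1))
      (\<lambda>f. op_comp Sym l (m + n - 1) i f (op_comp Sym m n j g h))"
      unfolding N by (intro sym_comp_linear_left cl i pos)
  next
    fix f h assume gh: "f \<in> op_space Sym l" "h \<in> op_space Sym n"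
    show "linear_map_on (op_scale Sym) (op_space Sym m) (op_scale Sym) (op_space Sym (l + m - 1 + n - 1))
      (\<lambda>g. op_comp Sym (l + m - 1) n (i - 1 + j) (op_comp Sym l m i f g) h)"
      by (intro linear_map_on_compose[OF sym_comp_linear_left sym_comp_linear_right] gh i pos)
    show "linear_map_on (op_scale Sym) (op_space Sym m) (op_scale Sym) (op_space Sym (l + m - 1 + n - 1))
      (\<lambda>g. op_comp Sym l (m + n - 1) i f (op_comp Sym m n j g h))"
      unfolding N by (intro linear_map_on_compose[OF sym_comp_linear_right sym_comp_linear_left] gh i pos)
  next
    fix f g assume gh: "f \<in> op_space Sym l" "g \<in> op_space Sym m"
    note cl = sym_comp_closed[OF i(1,2) pos(3) gh]
    show "linear_map_on (op_scale Sym) (op_space Sym n) (op_scale Sym) (op_space Sym (l + m - 1 + n - 1))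
      (\<lambda>h. op_comp Sym (l + m - 1) n (i - 1 + j) (op_comp Sym l m i f g) h)"
      by (intro sym_comp_linear_right cl i pos)
    show "linear_map_on (op_scale Sym) (op_space Sym n) (op_scale Sym) (op_space Sym (l + m - 1 + n - 1))
      (\<lambda>h. op_comp Sym l (m + n - 1) i f (op_comp Sym m n j g h))"
      unfolding N by (intro linear_map_on_compose[OF sym_comp_linear_right sym_comp_linear_right] gh i pos)
  qed
qed

text \<open>
  The letters \<open>i < k\<close> of the word of \<open>\<sigma>\<close> may stand in either order. According to this order,
  the coefficients satisfy the parallel axiom of the non-symmetric operad read in one direction or in the other.
\<close>

lemma sym_comp_assoc_par:
  assumes i: "1 \<le> i" "i < k" "k \<le> l" "1 \<le> m" "1 \<le> n"
    and f: "f \<in> op_space Sym l" "g \<in> op_space Sym m" "h \<in> op_space Sym n"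
  shows "op_comp Sym (l + m - 1) n (k - 1 + m) (op_comp Sym l m i f g) h =
       op_comp Sym (l + n - 1) m i (op_comp Sym l n k f h) g"
proof -
  have pos: "1 \<le> k - 1 + m" "k - 1 + m \<le> l + m - 1" "1 \<le> l" "i \<le> l" "1 \<le> k" "i \<le> l + n - 1"
    and N: "l + m - 1 + n - 1 = l + n - 1 + m - 1"
    using i by auto
  show ?thesis
  proof (rule sym_trilinear_eqI[where sW = "op_scale Sym" and W = "op_space Sym (l + m - 1 + n - 1)", OF pos(3) i(4,5) _ _ _ _ _ _ _ f])
    fix \<sigma> \<pi> \<rho> E F G assume p: "\<sigma> permutes {1..l}" "\<pi> permutes {1..m}" "\<rho> permutes {1..n}"
      and E: "E \<in> op_space P l" "F \<in> op_space P m" "G \<in> op_space P n"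
    define p where "p = inv \<sigma> i"
    define q where "q = inv \<sigma> k"
    have s: "\<sigma> p = i" "\<sigma> q = k" "1 \<le> p" "p \<le> l" "1 \<le> q" "q \<le> l"
      using p i pos inv_in_interval[of \<sigma> l i] inv_in_interval[of \<sigma> l k]
      by (auto simp: p_def q_def permutes_inverses)
    have pq: "p \<noteq> q" using s i by auto
    have il: "i \<in> {1..l}" "k \<in> {1..l}" using i by auto
    have inv: "inv (perm_comp l m i \<sigma> \<pi>) (k - 1 + m) = make_room p m q"
      using inv_perm_comp_outer[OF p(1,2) s(1) il(1) i(4) pq[symmetric]] i by (simp add: s make_room_def)
    have inv': "inv (perm_comp l n k \<sigma> \<rho>) i = make_room q n p"
      using inv_perm_comp_outer[OF p(1,3) s(2) il(2) i(5) pq] i by (simp add: s make_room_def)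
    have perm: "perm_comp l m i \<sigma> \<pi> permutes {1..l + m - 1}" "perm_comp l n k \<sigma> \<rho> permutes {1..l + n - 1}"
      using p il i by (auto intro!: perm_comp_permutes simp del: One_nat_def)
    have c: "op_comp P l m p E F \<in> op_space P (l + m - 1)" "op_comp P l n q E G \<in> op_space P (l + n - 1)"
      by (intro comp_closed s pos i E)+
    have comp: "op_comp P (l + m - 1) n (make_room p m q) (op_comp P l m p E F) G =
      op_comp P (l + n - 1) m (make_room q n p) (op_comp P l n q E G) F"
    proof (cases "p < q")
      case True
      then show ?thesis
        using comp_assoc_par[OF s(3) True s(6) i(4,5) E] by (simp add: make_room_def)
    next
      case False
      then have "q < p" using pq by simp
      then show ?thesis
        using comp_assoc_par[OF s(5) _ s(4) i(5,4) E(1,3,2)] by (simp add: make_room_def)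
    qed
    show "op_comp Sym (l + m - 1) n (k - 1 + m) (op_comp Sym l m i (Poly_Mapping.single \<sigma> E) (Poly_Mapping.single \<pi> F))
        (Poly_Mapping.single \<rho> G) =
       op_comp Sym (l + n - 1) m i (op_comp Sym l n k (Poly_Mapping.single \<sigma> E) (Poly_Mapping.single \<rho> G)) (Poly_Mapping.single \<pi> F)"
      unfolding sym_comp_single[OF i(1) pos(4) i(4) p(1) E(1,2), folded p_def]
        sym_comp_single[OF pos(5) i(3,5) p(1) E(1,3), folded q_def]
        sym_comp_single[OF pos(1,2) i(5) perm(1) c(1) E(3), unfolded inv]
        sym_comp_single[OF i(1) pos(6) i(4) perm(2) c(2) E(2), unfolded inv']
        comp perm_comp_assoc_par[OF p s(1,2) i] ..
  next
    fix g h assume gh: "g \<in> op_space Sym m" "h \<in> op_space Sym n"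
    show "linear_map_on (op_scale Sym) (op_space Sym l) (op_scale Sym) (op_space Sym (l + m - 1 + n - 1))
      (\<lambda>f. op_comp Sym (l + m - 1) n (k - 1 + m) (op_comp Sym l m i f g) h)"
      by (intro linear_map_on_compose[OF sym_comp_linear_left sym_comp_linear_left] gh i pos)
    show "linear_map_on (op_scale Sym) (op_space Sym l) (op_scale Sym) (op_space Sym (l + m - 1 + n - 1))
      (\<lambda>f. op_comp Sym (l + n - 1) m i (op_comp Sym l n k f h) g)"
      unfolding N by (intro linear_map_on_compose[OF sym_comp_linear_left sym_comp_linear_left] gh i pos)
  next
    fix f h assume gh: "f \<in> op_space Sym l" "h \<in> op_space Sym n"
    note cl = sym_comp_closed[OF pos(5) i(3,5) gh]
    show "linear_map_on (op_scale Sym) (op_space Sym m) (op_scale Sym) (op_space Sym (l + m - 1 + n - 1))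
      (\<lambda>g. op_comp Sym (l + m - 1) n (k - 1 + m) (op_comp Sym l m i f g) h)"
      by (intro linear_map_on_compose[OF sym_comp_linear_left sym_comp_linear_right] gh i pos)
    show "linear_map_on (op_scale Sym) (op_space Sym m) (op_scale Sym) (op_space Sym (l + m - 1 + n - 1))
      (\<lambda>g. op_comp Sym (l + n - 1) m i (op_comp Sym l n k f h) g)"
      unfolding N by (intro sym_comp_linear_right cl i pos)
  next
    fix f g assume gh: "f \<in> op_space Sym l" "g \<in> op_space Sym m"
    note cl = sym_comp_closed[OF i(1) pos(4) i(4) gh]
    show "linear_map_on (op_scale Sym) (op_space Sym n) (op_scale Sym) (op_space Sym (l + m - 1 + n - 1))
      (\<lambda>h. op_comp Sym (l + m - 1) n (k - 1 + m) (op_comp Sym l m i f g) h)"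
      by (intro sym_comp_linear_right cl i pos)
    show "linear_map_on (op_scale Sym) (op_space Sym n) (op_scale Sym) (op_space Sym (l + m - 1 + n - 1))
      (\<lambda>h. op_comp Sym (l + n - 1) m i (op_comp Sym l n k f h) g)"
      unfolding N by (intro linear_map_on_compose[OF sym_comp_linear_left sym_comp_linear_right] gh i pos)
  qed
qed

theorem symmetrization_symmetric_operad: "symmetric_operad Sym"
proof -
  have id1: "id permutes {1..1::nat}" by (rule permutes_id)
  show ?thesis
  proof unfold_locales
    fix n :: nat assume "1 \<le> n" then show "sym.subspace (op_space Sym n)" by (rule sym_subspace)
  next
    show "op_unit Sym \<in> op_space Sym 1"
      unfolding symmetrization_simps by (intro sym_single_in unit_in id1)
  next
    fix i m f assume i: "1 \<le> i" "i \<le> m" and f: "f \<in> op_space Sym m"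
    have m: "1 \<le> m" using i by simp
    have u: "op_unit Sym \<in> op_space Sym 1"
      unfolding symmetrization_simps by (intro sym_single_in unit_in id1)
    show "op_comp Sym m 1 i f (op_unit Sym) = f"
    proof (rule sym_linear_eqI[OF m _ linear_map_on_ident _ f])
      show "linear_map_on (op_scale Sym) (op_space Sym m) (op_scale Sym) (op_space Sym m)
        (\<lambda>f. op_comp Sym m 1 i f (op_unit Sym))"
        using sym_comp_linear_left[OF i _ u] by simp
      fix \<sigma> E assume s: "\<sigma> permutes {1..m}" "E \<in> op_space P m"
      then show "op_comp Sym m 1 i (Poly_Mapping.single \<sigma> E) (op_unit Sym) = Poly_Mapping.single \<sigma> E"
        using i inv_in_interval[OF s(1) i] unit_in
        by (simp add: symmetrization_simps sym_comp_single perm_comp_unit_right comp_unit_right del: One_nat_def)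
    qed
  next
    fix n g assume n: "1 \<le> n" and g: "g \<in> op_space Sym n"
    have u: "op_unit Sym \<in> op_space Sym 1"
      unfolding symmetrization_simps by (intro sym_single_in unit_in id1)
    show "op_comp Sym 1 n 1 (op_unit Sym) g = g"
    proof (rule sym_linear_eqI[OF n _ linear_map_on_ident _ g])
      show "linear_map_on (op_scale Sym) (op_space Sym n) (op_scale Sym) (op_space Sym n)
        (op_comp Sym 1 n 1 (op_unit Sym))"
        using sym_comp_linear_right[OF _ _ n u, of 1] by simp
      fix \<sigma> E assume s: "\<sigma> permutes {1..n}" "E \<in> op_space P n"
      then show "op_comp Sym 1 n 1 (op_unit Sym) (Poly_Mapping.single \<sigma> E) = Poly_Mapping.single \<sigma> E"
        using n unit_in id1
        by (simp add: symmetrization_simps sym_comp_single perm_comp_unit_left comp_unit_left inv_id del: One_nat_def)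
    qed
  next
    fix n f assume n: "1 \<le> n" and f: "f \<in> op_space Sym n"
    show "op_act Sym n id f = f"
      by (rule sym_linear_eqI[OF n sym_act_linear[OF n permutes_id] linear_map_on_ident _ f])
        (simp add: sym_act_single)
  next
    fix n \<sigma> \<pi> f assume n: "1 \<le> n" and p: "\<sigma> permutes {1..n}" "\<pi> permutes {1..n}" and f: "f \<in> op_space Sym n"
    show "op_act Sym n (\<sigma> \<circ> \<pi>) f = op_act Sym n \<sigma> (op_act Sym n \<pi> f)"
      by (rule sym_linear_eqI[OF n sym_act_linear[OF n permutes_compose[OF p(2,1)]]
            linear_map_on_compose[OF sym_act_linear[OF n p(1)] sym_act_linear[OF n p(2)]] _ f])
        (simp add: sym_act_single o_assoc)
  next
    fix i m n \<sigma> \<pi> f g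
    assume i: "1 \<le> i" "i \<le> m" "1 \<le> n" and p: "\<sigma> permutes {1..m}" "\<pi> permutes {1..n}"
      and f: "f \<in> op_space Sym m" "g \<in> op_space Sym n"
    have m: "1 \<le> m" using i by simp
    have im: "i \<in> {1..m}" using i by simp
    have N: "1 \<le> m + n - 1" using i by simp
    have j: "1 \<le> inv \<sigma> i" "inv \<sigma> i \<le> m" using inv_in_interval[OF p(1) i(1,2)] by auto
    have perm: "perm_comp m n i \<sigma> \<pi> permutes {1..m + n - 1}" by (rule perm_comp_permutes[OF p im i(3)])
    show "op_comp Sym m n i (op_act Sym m \<sigma> f) (op_act Sym n \<pi> g) =
       op_act Sym (m + n - 1) (perm_comp m n i \<sigma> \<pi>) (op_comp Sym m n (inv \<sigma> i) f g)"
    proof (rule sym_bilinear_eqI[OF m i(3) _ _ _ _ _ f])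
      fix g assume g: "g \<in> op_space Sym n"
      show "linear_map_on (op_scale Sym) (op_space Sym m) (op_scale Sym) (op_space Sym (m + n - 1))
        (\<lambda>f. op_comp Sym m n i (op_act Sym m \<sigma> f) (op_act Sym n \<pi> g))"
        by (rule linear_map_on_compose[OF sym_comp_linear_left[OF i linear_map_on_closed[OF sym_act_linear[OF i(3) p(2)] g]]
            sym_act_linear[OF m p(1)]])
      show "linear_map_on (op_scale Sym) (op_space Sym m) (op_scale Sym) (op_space Sym (m + n - 1))
        (\<lambda>f. op_act Sym (m + n - 1) (perm_comp m n i \<sigma> \<pi>) (op_comp Sym m n (inv \<sigma> i) f g))"
        by (rule linear_map_on_compose[OF sym_act_linear[OF N perm] sym_comp_linear_left[OF j i(3) g]])
    next
      fix f assume g: "f \<in> op_space Sym m"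
      show "linear_map_on (op_scale Sym) (op_space Sym n) (op_scale Sym) (op_space Sym (m + n - 1))
        (\<lambda>g. op_comp Sym m n i (op_act Sym m \<sigma> f) (op_act Sym n \<pi> g))"
        by (rule linear_map_on_compose[OF sym_comp_linear_right[OF i linear_map_on_closed[OF sym_act_linear[OF m p(1)] g]]
            sym_act_linear[OF i(3) p(2)]])
      show "linear_map_on (op_scale Sym) (op_space Sym n) (op_scale Sym) (op_space Sym (m + n - 1))
        (\<lambda>g. op_act Sym (m + n - 1) (perm_comp m n i \<sigma> \<pi>) (op_comp Sym m n (inv \<sigma> i) f g))"
        by (rule linear_map_on_compose[OF sym_act_linear[OF N perm] sym_comp_linear_right[OF j i(3) g]])
    next
      fix \<sigma>' \<pi>' A B
      assume s: "\<sigma>' permutes {1..m}" "\<pi>' permutes {1..n}" "A \<in> op_space P m" "B \<in> op_space P n"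
      have "inv (\<sigma> \<circ> \<sigma>') i = inv \<sigma>' (inv \<sigma> i)"
        using o_inv_distrib[OF permutes_bij[OF p(1)] permutes_bij[OF s(1)]] by simp
      then show "op_comp Sym m n i (op_act Sym m \<sigma> (Poly_Mapping.single \<sigma>' A)) (op_act Sym n \<pi> (Poly_Mapping.single \<pi>' B)) =
        op_act Sym (m + n - 1) (perm_comp m n i \<sigma> \<pi>) (op_comp Sym m n (inv \<sigma> i) (Poly_Mapping.single \<sigma>' A) (Poly_Mapping.single \<pi>' B))"
        unfolding sym_act_single sym_comp_single[OF i permutes_compose[OF s(1) p(1)] s(3,4)]
          sym_comp_single[OF j i(3) s(1,3,4)] perm_comp_comp[OF p(1) s(1,2) im i(3)] by simp
    qed
  qed (rule sym_comp_linear_left sym_comp_linear_right sym_act_linear sym_comp_assoc_seq sym_comp_assoc_par; assumption)+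
qed

end

section \<open>The induced anticyclic structure\<close>

context ns_anticyclic_operad
begin

interpretation sym: vector_space "op_scale Sym"
  by (rule sym_vector_space)

lemma tau_pow_linear:
  "1 \<le> n \<Longrightarrow> linear_map_on (op_scale P) (op_space P n) (op_scale P) (op_space P n) (\<tau> n ^^ k)"
  by (intro linear_map_on_funpow tau_linear)

lemma tau_pow_closed: "1 \<le> n \<Longrightarrow> f \<in> op_space P n \<Longrightarrow> (\<tau> n ^^ k) f \<in> op_space P n"
  using linear_map_on_closed[OF tau_pow_linear] .

lemma tau_closed: "1 \<le> n \<Longrightarrow> f \<in> op_space P n \<Longrightarrow> \<tau> n f \<in> op_space P n"
  using linear_map_on_closed[OF tau_linear] .

lemma linear_minus:
  assumes "linear_map_on (op_scale P) (op_space P n) (op_scale P) W h" "1 \<le> n" "x \<in> op_space P n"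
  shows "h (- x) = - h x"
proof -
  have x: "- x \<in> op_space P n" using subspace_neg[OF subspace_op_space[OF assms(2)] assms(3)] .
  have "h (- x) + h x = h (- x + x)" using linear_map_on_add[OF assms(1) x assms(3)] by (rule sym)
  also have "\<dots> = 0" using linear_map_on_zero[OF assms(1) zero_in_space[OF assms(2)]] by simp
  finally show ?thesis by (simp add: eq_neg_iff_add_eq_0)
qed

lemma tau_pow_mod:
  assumes "1 \<le> n" "f \<in> op_space P n"
  shows "(\<tau> n ^^ (k mod (n + 1))) f = (\<tau> n ^^ k) f"
proof -
  have "((\<tau> n ^^ (n + 1)) ^^ j) g = g" if "g \<in> op_space P n" for j g
    using tau_power[OF assms(1) that] by (induction j) auto
  then have "((\<tau> n ^^ (n + 1)) ^^ (k div (n + 1))) ((\<tau> n ^^ (k mod (n + 1))) f) = (\<tau> n ^^ (k mod (n + 1))) f"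
    using tau_pow_closed[OF assms] by blast
  moreover have "(\<tau> n ^^ k) f = ((\<tau> n ^^ (n + 1)) ^^ (k div (n + 1))) ((\<tau> n ^^ (k mod (n + 1))) f)"
    by (simp only: o_apply[symmetric, of "_ ^^ _" "_ ^^ _"] funpow_add[symmetric] funpow_mult mult_div_mod_eq)
  ultimately show ?thesis by simp
qed

lemma tau_unit: "\<tau> 1 (op_unit P) = - op_unit P"
  using tau_identities by (simp add: anticyclic_identities_def)

lemma tau_comp:
  "\<lbrakk>2 \<le> i; i \<le> m; 1 \<le> n; f \<in> op_space P m; g \<in> op_space P n\<rbrakk> \<Longrightarrow>
    \<tau> (m + n - 1) (op_comp P m n i f g) = op_comp P m n (i - 1) (\<tau> m f) g"
  using tau_identities unfolding anticyclic_identities_def by simp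

lemma tau_comp_1:
  "\<lbrakk>1 \<le> m; 1 \<le> n; f \<in> op_space P m; g \<in> op_space P n\<rbrakk> \<Longrightarrow>
    \<tau> (m + n - 1) (op_comp P m n 1 f g) = - op_comp P n m n (\<tau> n g) (\<tau> m f)"
  using tau_identities unfolding anticyclic_identities_def by blast

lemma tau_pow_comp_before:
  assumes "q < p" "p \<le> m" "1 \<le> n" "f \<in> op_space P m" "g \<in> op_space P n"
  shows "(\<tau> (m + n - 1) ^^ q) (op_comp P m n p f g) = op_comp P m n (p - q) ((\<tau> m ^^ q) f) g"
  using assms(1)
proof (induction q)
  case (Suc q)
  have "(\<tau> m ^^ q) f \<in> op_space P m" using assms by (intro tau_pow_closed) auto
  then show ?case
    using Suc assms tau_comp[of "p - q" m n "(\<tau> m ^^ q) f" g] by simp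
qed simp

text \<open>
  After \<open>p - 1\<close> rotations the composition takes place at the first input, the next rotation exchanges
  the two operations, and the remaining \<open>q - 1\<close> rotations move the outer operation \<open>\<tau>(g)\<close>.
\<close>

lemma tau_pow_comp_inside:
  assumes "1 \<le> p" "p \<le> m" "1 \<le> q" "q \<le> n" "f \<in> op_space P m" "g \<in> op_space P n"
  shows "(\<tau> (m + n - 1) ^^ (p - 1 + q)) (op_comp P m n p f g) =
    - op_comp P n m (n + 1 - q) ((\<tau> n ^^ q) g) ((\<tau> m ^^ p) f)"
proof -
  have mn: "1 \<le> m" "1 \<le> n" "1 \<le> n + m - 1" "m + n - 1 = n + m - 1" using assms by auto
  define f' where "f' = (\<tau> m ^^ (p - 1)) f"
  have f': "f' \<in> op_space P m" "\<tau> m f' \<in> op_space P m"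
    unfolding f'_def by (intro tau_closed tau_pow_closed mn assms)+
  have tg: "\<tau> n g \<in> op_space P n" by (intro tau_closed mn assms)
  have tf': "\<tau> m f' = (\<tau> m ^^ p) f"
    using assms(1) by (simp add: f'_def flip: funpow.simps(2)[THEN fun_cong, unfolded o_apply])
  have "(\<tau> (m + n - 1) ^^ (p - 1 + q)) (op_comp P m n p f g) =
      (\<tau> (m + n - 1) ^^ (q - 1 + 1 + (p - 1))) (op_comp P m n p f g)"
    using assms by (simp add: add.commute)
  also have "\<dots> = (\<tau> (m + n - 1) ^^ (q - 1)) (\<tau> (m + n - 1) ((\<tau> (m + n - 1) ^^ (p - 1)) (op_comp P m n p f g)))"
    by (simp only: funpow_add o_apply) simp
  also have "(\<tau> (m + n - 1) ^^ (p - 1)) (op_comp P m n p f g) = op_comp P m n 1 f' g"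
    using tau_pow_comp_before[of "p - 1" p m n f g] assms mn by (simp add: f'_def)
  also have "\<tau> (m + n - 1) (op_comp P m n 1 f' g) = - op_comp P n m n (\<tau> n g) (\<tau> m f')"
    by (rule tau_comp_1[OF mn(1,2) f'(1) assms(6)])
  also have "(\<tau> (m + n - 1) ^^ (q - 1)) (- op_comp P n m n (\<tau> n g) (\<tau> m f')) =
      - (\<tau> (n + m - 1) ^^ (q - 1)) (op_comp P n m n (\<tau> n g) (\<tau> m f'))"
    unfolding mn(4) by (rule linear_minus[OF tau_pow_linear[OF mn(3)] mn(3) comp_closed[OF mn(2) order_refl mn(1) tg f'(2)]])
  also have "(\<tau> (n + m - 1) ^^ (q - 1)) (op_comp P n m n (\<tau> n g) (\<tau> m f')) =
      op_comp P n m (n - (q - 1)) ((\<tau> n ^^ (q - 1)) (\<tau> n g)) (\<tau> m f')"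
    using assms(3,4) by (intro tau_pow_comp_before mn tg f') auto
  also have "(\<tau> n ^^ (q - 1)) (\<tau> n g) = (\<tau> n ^^ q) g"
    using assms(3) by (cases q) (auto simp: funpow_swap1)
  finally show ?thesis using assms by (simp add: tf')
qed

text \<open>
  If the inserted block lies before the letter that is rotated out, the rotation runs through the
  whole block. The two operations are then exchanged twice, so that the signs cancel, and \<open>g\<close> is
  rotated \<open>n + 1\<close> times, which is the identity.
\<close>

lemma tau_pow_comp_outside:
  assumes "p \<in> {1..m}" "q \<in> {1..m}" "q \<noteq> p" "1 \<le> n" "f \<in> op_space P m" "g \<in> op_space P n"
  shows "(\<tau> (m + n - 1) ^^ make_room p n q) (op_comp P m n p f g) =
    op_comp P m n ((long_cycle m ^^ q) p) ((\<tau> m ^^ q) f) g"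
proof (cases "q < p")
  case True
  have "(long_cycle m ^^ q) p = p - q" using assms(1,2) True by (subst long_cycle_power) auto
  then show ?thesis using True assms tau_pow_comp_before[OF True _ assms(4-6)] by (simp add: make_room_def)
next
  case False
  then have "p < q" using assms by simp
  \<comment> \<open>Of the rotations, \<open>p - 1 + n\<close> lead to the second exchange of the operations, one performs it, and \<open>r\<close> remain.\<close>
  define r where "r = q - p - 1"
  have r: "q = p + 1 + r" "r < m" using \<open>p < q\<close> assms(2) by (auto simp: r_def)
  have mn: "1 \<le> p" "p \<le> m" "1 \<le> m" "1 \<le> n + m - 1" "m + n - 1 = n + m - 1" using assms by auto
  let ?T = "\<tau> (m + n - 1)"
  define f' where "f' = (\<tau> m ^^ p) f"
  define g' where "g' = (\<tau> n ^^ n) g"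
  have f': "f' \<in> op_space P m" "\<tau> m f' \<in> op_space P m" "g' \<in> op_space P n"
    unfolding f'_def g'_def by (intro tau_closed tau_pow_closed mn assms)+
  have tg': "\<tau> n g' = g"
    using tau_power[OF assms(4,6)] by (simp add: g'_def)
  have tf': "(\<tau> m ^^ r) (\<tau> m f') = (\<tau> m ^^ q) f"
    unfolding f'_def r(1) by (simp add: funpow_add funpow_swap1 add.commute[of p])
  have c: "(long_cycle m ^^ q) p = m - r" using assms(1,2) r by (subst long_cycle_power) auto
  have "make_room p n q = r + 1 + (p - 1 + n)"
    using False r mn by (simp add: make_room_def)
  then have "(?T ^^ make_room p n q) (op_comp P m n p f g) =
      (?T ^^ r) (?T ((?T ^^ (p - 1 + n)) (op_comp P m n p f g)))"
    by (simp only: funpow_add o_apply) simp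
  also have "(?T ^^ (p - 1 + n)) (op_comp P m n p f g) = - op_comp P n m 1 g' f'"
    using tau_pow_comp_inside[OF mn(1,2) assms(4) order_refl assms(5,6)] by (simp add: g'_def f'_def)
  also have "?T (- op_comp P n m 1 g' f') = - \<tau> (n + m - 1) (op_comp P n m 1 g' f')"
    unfolding mn(5) by (rule linear_minus[OF tau_linear[OF mn(4)] mn(4) comp_closed[OF order_refl assms(4) mn(3) f'(3,1)]])
  also have "\<dots> = op_comp P m n m (\<tau> m f') g"
    using tau_comp_1[OF assms(4) mn(3) f'(3,1)] tg' by simp
  also have "(?T ^^ r) (op_comp P m n m (\<tau> m f') g) = op_comp P m n (m - r) ((\<tau> m ^^ r) (\<tau> m f')) g"
    by (rule tau_pow_comp_before[OF r(2) order_refl assms(4) f'(2) assms(6)])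
  finally show ?thesis by (simp add: tf' c)
qed

text \<open>
  Any factorization \<open>s \<circ> c\<^sup>k\<close> may be used, not only the one with \<open>k \<le> n\<close>, since both \<open>c\<close> and \<open>\<tau>\<close> have
  order dividing \<open>n + 1\<close>.
\<close>

lemma induced_action_single:
  assumes "1 \<le> n" "s permutes {1..n}" "\<sigma> \<circ> \<pi> = s \<circ> long_cycle n ^^ k" "E \<in> op_space P n"
  shows "induced_action \<tau> n \<sigma> (Poly_Mapping.single \<pi> E) = Poly_Mapping.single s ((\<tau> n ^^ k) E)"
proof -
  have z: "(\<tau> n ^^ j) 0 = 0" for j
    using linear_map_on_zero[OF tau_pow_linear zero_in_space] assms(1) by simp
  have k: "inv (\<sigma> \<circ> \<pi>) (n + 1) mod (n + 1) = k mod (n + 1)"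
    unfolding assms(3) by (rule permutes_Suc_decomposition_unique[OF assms(2)])
  have "\<sigma> \<circ> \<pi> \<circ> inv (long_cycle n ^^ (k mod (n + 1))) = s"
    unfolding assms(3) long_cycle_power_mod[of k n, symmetric]
    by (simp add: o_assoc[symmetric] permutes_inv_o[OF long_cycle_power_permutes])
  then show ?thesis
    using z k tau_pow_mod[OF assms(1,4), of k] by (cases "E = 0") (simp_all add: induced_action_def Let_def)
qed

lemma induced_action_linear:
  assumes "1 \<le> n" "\<sigma> permutes {1..n + 1}"
  shows "linear_map_on (op_scale Sym) (op_space Sym n) (op_scale Sym) (op_space Sym n) (induced_action \<tau> n \<sigma>)"
proof -
  let ?k = "\<lambda>\<pi>. inv (\<sigma> \<circ> \<pi>) (n + 1) mod (n + 1)"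
  let ?G = "\<lambda>\<pi> E. Poly_Mapping.single (\<sigma> \<circ> \<pi> \<circ> inv (long_cycle n ^^ ?k \<pi>)) ((\<tau> n ^^ ?k \<pi>) E)"
  have "linear_map_on (op_scale Sym) (op_space Sym n) (op_scale Sym) (op_space Sym n)
    (\<lambda>f. \<Sum>\<pi>\<in>Poly_Mapping.keys f. ?G \<pi> (Poly_Mapping.lookup f \<pi>))"
  proof (rule linear_keys_sum[where G = ?G, OF assms(1,1)])
    fix \<pi> assume "\<pi> permutes {1..n}"
    then have "\<pi> permutes {1..n + 1}" by (rule permutes_subset) auto
    then have "\<sigma> \<circ> \<pi> permutes {1..n + 1}" using assms(2) by (rule permutes_compose)
    then show "linear_map_on (op_scale P) (op_space P n) (op_scale Sym) (op_space Sym n) (?G \<pi>)"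
      by (rule linear_map_on_compose[OF linear_single[OF permutes_Suc_decomposition(1)] tau_pow_linear[OF assms(1)]])
  qed
  moreover have "induced_action \<tau> n \<sigma> = (\<lambda>f. \<Sum>\<pi>\<in>Poly_Mapping.keys f. ?G \<pi> (Poly_Mapping.lookup f \<pi>))"
    by (simp add: induced_action_def Let_def fun_eq_iff)
  ultimately show ?thesis by simp
qed

text \<open>
  Factor \<open>\<pi> \<circ> \<mu> = s \<circ> c\<^sup>k\<close> and then \<open>\<sigma> \<circ> s = t \<circ> c\<^sup>l\<close>; this gives the factorization
  \<open>t \<circ> c\<^bsup>l+k\<^esup>\<close> of \<open>\<sigma> \<circ> \<pi> \<circ> \<mu>\<close>.
\<close>

lemma induced_action_comp:
  assumes n: "1 \<le> n" and p: "\<sigma> permutes {1..n + 1}" "\<pi> permutes {1..n + 1}" and f: "f \<in> op_space Sym n"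
  shows "induced_action \<tau> n (\<sigma> \<circ> \<pi>) f = induced_action \<tau> n \<sigma> (induced_action \<tau> n \<pi> f)"
proof (rule sym_linear_eqI[OF n induced_action_linear[OF n permutes_compose[OF p(2,1)]]
      linear_map_on_compose[OF induced_action_linear[OF n p(1)] induced_action_linear[OF n p(2)]] _ f])
  fix \<mu> E assume \<mu>: "\<mu> permutes {1..n}" and E: "E \<in> op_space P n"
  have up: "\<mu> permutes {1..n + 1}" if "\<mu> permutes {1..n}" for \<mu> :: "nat \<Rightarrow> nat"
    using that by (rule permutes_subset) auto
  note d = permutes_Suc_decomposition
  have "\<pi> \<circ> \<mu> permutes {1..n + 1}" using up[OF \<mu>] p(2) by (rule permutes_compose)
  from d[OF this] obtain s k where s: "s permutes {1..n}" "\<pi> \<circ> \<mu> = s \<circ> long_cycle n ^^ k" by metis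
  have "\<sigma> \<circ> s permutes {1..n + 1}" using up[OF s(1)] p(1) by (rule permutes_compose)
  from d[OF this] obtain t l where t: "t permutes {1..n}" "\<sigma> \<circ> s = t \<circ> long_cycle n ^^ l" by metis
  have "\<sigma> \<circ> \<pi> \<circ> \<mu> = t \<circ> long_cycle n ^^ (l + k)"
    using s(2) t(2) by (simp add: funpow_add o_assoc[symmetric]) (simp add: o_assoc)
  then have "induced_action \<tau> n (\<sigma> \<circ> \<pi>) (Poly_Mapping.single \<mu> E) = Poly_Mapping.single t ((\<tau> n ^^ (l + k)) E)"
    by (rule induced_action_single[OF n t(1) _ E])
  then show "induced_action \<tau> n (\<sigma> \<circ> \<pi>) (Poly_Mapping.single \<mu> E) =
    induced_action \<tau> n \<sigma> (induced_action \<tau> n \<pi> (Poly_Mapping.single \<mu> E))"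
    by (simp add: induced_action_single[OF n s E] induced_action_single[OF n t tau_pow_closed[OF n E]] funpow_add)
qed

text \<open>
  The exponent is the position of the letter \<open>1\<close>, since the long cycle sends \<open>1\<close> to \<open>m + 1\<close>.
\<close>

lemma long_cycle_decomposition:
  assumes "\<sigma> permutes {1..m}" "\<sigma> q = 1" "1 \<le> m"
  obtains s where "s permutes {1..m}" "long_cycle m \<circ> \<sigma> = s \<circ> long_cycle m ^^ q"
proof -
  have "1 \<in> {1..m}" using assms by simp
  then have q: "q \<in> {1..m}" using assms(1,2) by (metis permutes_in_image)
  have \<sigma>: "\<sigma> permutes {1..m + 1}" using assms(1) by (rule permutes_subset) auto
  let ?\<mu> = "long_cycle m \<circ> \<sigma>"
  have \<mu>: "?\<mu> permutes {1..m + 1}" by (intro permutes_compose \<sigma> long_cycle_permutes)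
  have "?\<mu> q = m + 1" using assms by (simp add: long_cycle_apply)
  then have "inv ?\<mu> (m + 1) = q" by (simp only: permutes_inv_eq[OF \<mu>])
  then have "inv ?\<mu> (m + 1) mod (m + 1) = q" using q by simp
  then show thesis using permutes_Suc_decomposition[OF \<mu>] that by metis
qed

lemma induced_action_tau_comp:
  assumes i: "2 \<le> i" "i \<le> m" "1 \<le> n" and f: "f \<in> op_space Sym m" "g \<in> op_space Sym n"
  shows "induced_action \<tau> (m + n - 1) (long_cycle (m + n - 1)) (op_comp Sym m n i f g) =
    op_comp Sym m n (i - 1) (induced_action \<tau> m (long_cycle m) f) g"
proof -
  have m: "1 \<le> m" "1 \<le> i" "1 \<le> i - 1" "i - 1 \<le> m" "1 \<le> m + n - 1" using i by auto
  have im: "i \<in> {2..m}" "i \<in> {1..m}" using i by auto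
  show ?thesis
  proof (rule sym_bilinear_eqI[OF m(1) i(3) _ _ _ _ _ f])
    fix g assume g: "g \<in> op_space Sym n"
    show "linear_map_on (op_scale Sym) (op_space Sym m) (op_scale Sym) (op_space Sym (m + n - 1))
      (\<lambda>f. induced_action \<tau> (m + n - 1) (long_cycle (m + n - 1)) (op_comp Sym m n i f g))"
      by (rule linear_map_on_compose[OF induced_action_linear[OF m(5) long_cycle_permutes] sym_comp_linear_left[OF m(2) i(2,3) g]])
    show "linear_map_on (op_scale Sym) (op_space Sym m) (op_scale Sym) (op_space Sym (m + n - 1))
      (\<lambda>f. op_comp Sym m n (i - 1) (induced_action \<tau> m (long_cycle m) f) g)"
      by (rule linear_map_on_compose[OF sym_comp_linear_left[OF m(3,4) i(3) g] induced_action_linear[OF m(1) long_cycle_permutes]])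
  next
    fix f assume g: "f \<in> op_space Sym m"
    show "linear_map_on (op_scale Sym) (op_space Sym n) (op_scale Sym) (op_space Sym (m + n - 1))
      (\<lambda>g. induced_action \<tau> (m + n - 1) (long_cycle (m + n - 1)) (op_comp Sym m n i f g))"
      by (rule linear_map_on_compose[OF induced_action_linear[OF m(5) long_cycle_permutes] sym_comp_linear_right[OF m(2) i(2,3) g]])
    show "linear_map_on (op_scale Sym) (op_space Sym n) (op_scale Sym) (op_space Sym (m + n - 1))
      (\<lambda>g. op_comp Sym m n (i - 1) (induced_action \<tau> m (long_cycle m) f) g)"
      by (rule sym_comp_linear_right[OF m(3,4) i(3) linear_map_on_closed[OF induced_action_linear[OF m(1) long_cycle_permutes] g]])
  next
    fix \<sigma> \<pi> E F
    assume p: "\<sigma> permutes {1..m}" "\<pi> permutes {1..n}" and E: "E \<in> op_space P m" "F \<in> op_space P n"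
    define p where "p = inv \<sigma> i"
    define q where "q = inv \<sigma> 1"
    have s: "\<sigma> p = i" "\<sigma> q = 1" "1 \<le> p" "p \<le> m" "p \<in> {1..m}" "q \<in> {1..m}"
      using p m i inv_in_interval[of \<sigma> m i] inv_in_interval[of \<sigma> m 1]
      by (auto simp: p_def q_def permutes_inverses)
    have pq: "q \<noteq> p" using s i by auto
    obtain s where s': "s permutes {1..m}" "long_cycle m \<circ> \<sigma> = s \<circ> long_cycle m ^^ q"
      using long_cycle_decomposition[OF p(1) s(2) m(1)] by blast
    note rot = long_cycle_perm_comp[OF p s'(1) s(1,2) im(1) i(3) s'(2)]
    have inv_s: "inv s (i - 1) = (long_cycle m ^^ q) p"
      using rot(1) permutes_inv_eq[OF s'(1)] by blast
    have perm: "perm_comp m n (i - 1) s \<pi> permutes {1..m + n - 1}"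
      using m by (intro perm_comp_permutes s' p i) auto
    show "induced_action \<tau> (m + n - 1) (long_cycle (m + n - 1)) (op_comp Sym m n i (Poly_Mapping.single \<sigma> E) (Poly_Mapping.single \<pi> F)) =
      op_comp Sym m n (i - 1) (induced_action \<tau> m (long_cycle m) (Poly_Mapping.single \<sigma> E)) (Poly_Mapping.single \<pi> F)"
      unfolding sym_comp_single[OF m(2) i(2,3) p(1) E, folded p_def]
        induced_action_single[OF m(5) perm rot(2) comp_closed[OF s(3,4) i(3) E]]
        induced_action_single[OF m(1) s' E(1)]
        sym_comp_single[OF m(3,4) i(3) s'(1) tau_pow_closed[OF m(1) E(1)] E(2)]
        tau_pow_comp_outside[OF s(5,6) pq i(3) E] inv_s ..
  qed
qed

lemma induced_action_tau_comp_1: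
  assumes mn: "1 \<le> m" "1 \<le> n" and f: "f \<in> op_space Sym m" "g \<in> op_space Sym n"
  shows "induced_action \<tau> (m + n - 1) (long_cycle (m + n - 1)) (op_comp Sym m n 1 f g) =
    - op_comp Sym n m n (induced_action \<tau> n (long_cycle n) g) (induced_action \<tau> m (long_cycle m) f)"
proof -
  have N: "1 \<le> m + n - 1" "n + m - 1 = m + n - 1" using mn by auto
  note lin = linear_map_on_uminus[OF sym_vector_space sym_subspace[OF N(1)]]
  note L = induced_action_linear[OF _ long_cycle_permutes]
  note cl = linear_map_on_closed[OF L]
  show ?thesis
  proof (rule sym_bilinear_eqI[OF mn _ _ _ _ _ f])
    fix g assume g: "g \<in> op_space Sym n"
    show "linear_map_on (op_scale Sym) (op_space Sym m) (op_scale Sym) (op_space Sym (m + n - 1))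
      (\<lambda>f. induced_action \<tau> (m + n - 1) (long_cycle (m + n - 1)) (op_comp Sym m n 1 f g))"
      by (rule linear_map_on_compose[OF L[OF N(1)] sym_comp_linear_left[OF order_refl mn g]])
    show "linear_map_on (op_scale Sym) (op_space Sym m) (op_scale Sym) (op_space Sym (m + n - 1))
      (\<lambda>f. - op_comp Sym n m n (induced_action \<tau> n (long_cycle n) g) (induced_action \<tau> m (long_cycle m) f))"
      by (rule lin[OF linear_map_on_compose[OF sym_comp_linear_right[OF mn(2) order_refl mn(1) cl[OF mn(2) g], unfolded N(2)] L[OF mn(1)]]])
  next
    fix f assume g: "f \<in> op_space Sym m"
    show "linear_map_on (op_scale Sym) (op_space Sym n) (op_scale Sym) (op_space Sym (m + n - 1))
      (\<lambda>g. induced_action \<tau> (m + n - 1) (long_cycle (m + n - 1)) (op_comp Sym m n 1 f g))"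
      by (rule linear_map_on_compose[OF L[OF N(1)] sym_comp_linear_right[OF order_refl mn g]])
    show "linear_map_on (op_scale Sym) (op_space Sym n) (op_scale Sym) (op_space Sym (m + n - 1))
      (\<lambda>g. - op_comp Sym n m n (induced_action \<tau> n (long_cycle n) g) (induced_action \<tau> m (long_cycle m) f))"
      by (rule lin[OF linear_map_on_compose[OF sym_comp_linear_left[OF mn(2) order_refl mn(1) cl[OF mn(1) g], unfolded N(2)] L[OF mn(2)]]])
  next
    fix \<sigma> \<pi> E F
    assume p: "\<sigma> permutes {1..m}" "\<pi> permutes {1..n}" and E: "E \<in> op_space P m" "F \<in> op_space P n"
    define p where "p = inv \<sigma> 1"
    define q where "q = inv \<pi> 1"
    have s: "\<sigma> p = 1" "\<pi> q = 1" "1 \<le> p" "p \<le> m" "1 \<le> q" "q \<le> n"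
      using p mn inv_in_interval[of \<pi> n 1] inv_in_interval[of \<sigma> m 1]
      by (auto simp: p_def q_def permutes_inverses)
    obtain s where s': "s permutes {1..m}" "long_cycle m \<circ> \<sigma> = s \<circ> long_cycle m ^^ p"
      using long_cycle_decomposition[OF p(1) s(1) mn(1)] by blast
    obtain t where t': "t permutes {1..n}" "long_cycle n \<circ> \<pi> = t \<circ> long_cycle n ^^ q"
      using long_cycle_decomposition[OF p(2) s(2) mn(2)] by blast
    note rot = long_cycle_perm_comp_1[OF p s'(1) t'(1) s(1,2) mn s'(2) t'(2)]
    have inv_t: "inv t n = n + 1 - q"
      using rot(1) permutes_inv_eq[OF t'(1)] by blast
    have n1: "n \<in> {1..n}" using mn by simp
    have perm: "perm_comp n m n t s permutes {1..m + n - 1}"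
      using perm_comp_permutes[OF t'(1) s'(1) n1 mn(1)] unfolding N(2) .
    show "induced_action \<tau> (m + n - 1) (long_cycle (m + n - 1)) (op_comp Sym m n 1 (Poly_Mapping.single \<sigma> E) (Poly_Mapping.single \<pi> F)) =
      - op_comp Sym n m n (induced_action \<tau> n (long_cycle n) (Poly_Mapping.single \<pi> F))
         (induced_action \<tau> m (long_cycle m) (Poly_Mapping.single \<sigma> E))"
      unfolding sym_comp_single[OF order_refl mn p(1) E, folded p_def]
        induced_action_single[OF N(1) perm rot(2) comp_closed[OF s(3,4) mn(2) E]]
        induced_action_single[OF mn(1) s' E(1)] induced_action_single[OF mn(2) t' E(2)]
        sym_comp_single[OF mn(2) order_refl mn(1) t'(1) tau_pow_closed[OF mn(2) E(2)] tau_pow_closed[OF mn(1) E(1)]]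
        tau_pow_comp_inside[OF s(3-6) E] inv_t
      by (simp add: single_uminus)
  qed
qed

theorem symmetrization_anticyclic_operad: "anticyclic_operad Sym (induced_action \<tau>)"
proof -
  interpret S: symmetric_operad Sym by (rule symmetrization_symmetric_operad)
  have id: "id permutes {1..1::nat}" by (rule permutes_id)
  have u: "induced_action \<tau> 1 (long_cycle 1) (op_unit Sym) = - op_unit Sym"
    unfolding symmetrization_simps using linear_map_on_zero[OF tau_linear zero_in_space, of 1]
    by (subst induced_action_long_cycle) (simp_all add: tau_unit single_uminus del: One_nat_def)
  show ?thesis
  proof unfold_locales
    show "anticyclic_identities Sym (\<lambda>n. induced_action \<tau> n (long_cycle n))"
      unfolding anticyclic_identities_def
      by (auto intro!: u induced_action_tau_comp induced_action_tau_comp_1 simp del: One_nat_def)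
  qed (rule induced_action_linear induced_action_comp induced_action_extends; assumption)+
qed

end

section \<open>A basis of Dias\<close>

lemma dias_rel_refl: "f = g \<Longrightarrow> dias_rel f g"
  by (simp add: dias_rel_def dias_ideal.zero)

lemma dias_vector_space: "vector_space dias_scale"
  by standard (transfer, rule dias_rel_refl, rule poly_mapping_eqI, simp add: lookup_add algebra_simps)+

interpretation dias: vector_space dias_scale
  by (rule dias_vector_space)

lemma free_scale_add: "free_scale c (f + g) = free_scale c f + free_scale c g"
  by (rule poly_mapping_eqI) (simp add: lookup_add algebra_simps)

lemma free_scale_single: "free_scale c (Poly_Mapping.single t a) = Poly_Mapping.single t (c * a)"
  by (rule poly_mapping_eqI) (simp add: lookup_single when_def)

lemma free_scale_zero: "free_scale c 0 = 0"
  by (rule poly_mapping_eqI) simp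

lemma free_scale_sum: "free_scale c (sum h A) = (\<Sum>x\<in>A. free_scale c (h x))"
  by (induction A rule: infinite_finite_induct) (simp_all add: free_scale_add free_scale_zero)

lemma keys_free_scale: "Poly_Mapping.keys (free_scale c f) \<subseteq> Poly_Mapping.keys f"
  by (auto simp: in_keys_iff)

lemma free_comp_add_left: "free_comp i (f + f') g = free_comp i f g + free_comp i f' g"
proof -
  have "free_comp i ((f + f') - f') g = free_comp i (f + f') g - free_comp i f' g"
    by (rule free_comp_diff_left)
  then show ?thesis by (simp add: algebra_simps)
qed

lemma free_comp_add_right: "free_comp i f (g + g') = free_comp i f g + free_comp i f g'"
proof -
  have "free_comp i f ((g + g') - g') = free_comp i f (g + g') - free_comp i f g'"
    by (rule free_comp_diff_right)
  then show ?thesis by (simp add: algebra_simps)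
qed

lemma free_comp_scale_left: "free_comp i (free_scale c f) g = free_scale c (free_comp i f g)"
  by (subst (1 2) free_comp_superset[of "Poly_Mapping.keys f" "Poly_Mapping.keys g"])
    (auto simp: keys_free_scale free_scale_sum free_scale_single free_scale_zero mult.assoc
      intro!: sum.cong)

lemma free_comp_scale_right: "free_comp i f (free_scale c g) = free_scale c (free_comp i f g)"
  by (subst (1 2) free_comp_superset[of "Poly_Mapping.keys f" "Poly_Mapping.keys g"])
    (auto simp: keys_free_scale free_scale_sum free_scale_single free_scale_zero mult.left_commute
      intro!: sum.cong)

lemma dias_comp_bilinear:
  "dias_comp i (x + x') y = dias_comp i x y + dias_comp i x' y"
  "dias_comp i x (y + y') = dias_comp i x y + dias_comp i x y'"
  "dias_comp i (dias_scale c x) y = dias_scale c (dias_comp i x y)"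
  "dias_comp i x (dias_scale c y) = dias_scale c (dias_comp i x y)"
  by (transfer, rule dias_rel_refl, rule free_comp_add_left free_comp_add_right free_comp_scale_left free_comp_scale_right)+

lemma dias_comp_zero: "dias_comp i 0 y = 0" "dias_comp i x 0 = 0"
  using dias_comp_bilinear(1)[of i 0 0 y] dias_comp_bilinear(2)[of i x 0 0] by simp_all

lemma dias_comp_diff:
  "dias_comp i (x - x') y = dias_comp i x y - dias_comp i x' y"
  "dias_comp i x (y - y') = dias_comp i x y - dias_comp i x y'"
  using dias_comp_bilinear(1)[of i "x - x'" x' y] dias_comp_bilinear(2)[of i x "y - y'" y']
  by (simp_all add: algebra_simps)

lemma dias_comp_tree:
  "1 \<le> i \<Longrightarrow> i \<le> leaves s \<Longrightarrow> dias_comp i (dias_tree s) (dias_tree t) = dias_tree (tree_graft i s t)"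
  by transfer (simp add: free_comp_def dias_rel_refl)

lemma abs_dias_sum: "abs_dias (sum h A) = (\<Sum>x\<in>A. abs_dias (h x))"
  by (induction A rule: infinite_finite_induct)
    (simp_all add: plus_dias.abs_eq[symmetric] zero_dias.abs_eq[symmetric] zero_dias_def[symmetric])

lemma abs_dias_expand:
  "abs_dias f = (\<Sum>t\<in>Poly_Mapping.keys f. dias_scale (Poly_Mapping.lookup f t) (dias_tree t))"
proof -
  have "abs_dias (Poly_Mapping.single t a) = dias_scale a (dias_tree t)" for t a
    by (simp add: dias_tree.abs_eq dias_scale.abs_eq free_scale_single)
  then show ?thesis
    by (subst poly_mapping_sum_single[of f, symmetric]) (simp only: abs_dias_sum)
qed

text \<open>
  The distinguished leaf of a tree: \<open>\<stileturn>\<close> points to its left factor and \<open>\<turnstile>\<close> to its right factor.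
\<close>

primrec head :: "dtree \<Rightarrow> nat" where
  "head Leaf = 1"
| "head (LProd s t) = head s"
| "head (RProd s t) = leaves s + head t"

lemma head_bounds: "1 \<le> head t \<and> head t \<le> leaves t"
  by (induction t) auto

lemma leaves_pos: "1 \<le> leaves t"
  by (induction t) auto

lemma leaves_tree_graft: "1 \<le> i \<Longrightarrow> i \<le> leaves s \<Longrightarrow> leaves (tree_graft i s t) = leaves s + leaves t - 1"
proof (induction s arbitrary: i)
  case (LProd s1 s2)
  show ?case
    using LProd.prems LProd.IH(1)[of i] LProd.IH(2)[of "i - leaves s1"] leaves_pos[of s1] leaves_pos[of s2] leaves_pos[of t] by auto
next
  case (RProd s1 s2)
  show ?case
    using RProd.prems RProd.IH(1)[of i] RProd.IH(2)[of "i - leaves s1"] leaves_pos[of s1] leaves_pos[of s2] leaves_pos[of t] by auto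
qed auto

text \<open>
  The position of the distinguished leaf \<open>j\<close> after an operation with \<open>n\<close> inputs and distinguished
  leaf \<open>k\<close> has been grafted onto the leaf \<open>i\<close>.
\<close>

definition graft_head :: "nat \<Rightarrow> nat \<Rightarrow> nat \<Rightarrow> nat \<Rightarrow> nat" where
  "graft_head i j n k = (if j = i then i - 1 + k else if j < i then j else j + n - 1)"

lemma head_tree_graft:
  "1 \<le> i \<Longrightarrow> i \<le> leaves s \<Longrightarrow> head (tree_graft i s t) = graft_head i (head s) (leaves t) (head t)"
proof (induction s arbitrary: i)
  case (LProd s1 s2)
  show ?case
    using LProd.prems LProd.IH(1)[of i] head_bounds[of s1] by (auto simp: graft_head_def)
next
  case (RProd s1 s2)
  show ?case
    using RProd.prems RProd.IH(2)[of "i - leaves s1"] head_bounds[of s2] leaves_tree_graft[of i s1 t] leaves_pos[of t]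
    by (auto simp: graft_head_def)
qed (auto simp: graft_head_def)

definition dias_lprod :: "dias \<Rightarrow> dias \<Rightarrow> dias" where
  "dias_lprod x y = dias_comp 1 (dias_comp 2 dias_left y) x"

definition dias_rprod :: "dias \<Rightarrow> dias \<Rightarrow> dias" where
  "dias_rprod x y = dias_comp 1 (dias_comp 2 dias_right y) x"

lemma dias_tree_LProd: "dias_tree (LProd s t) = dias_lprod (dias_tree s) (dias_tree t)"
  by (simp add: dias_lprod_def dias_comp_tree)

lemma dias_tree_RProd: "dias_tree (RProd s t) = dias_rprod (dias_tree s) (dias_tree t)"
  by (simp add: dias_rprod_def dias_comp_tree)

text \<open>
  A relation between two trees with three leaves remains valid when arbitrary trees are grafted onto the
  leaves. Grafting proceeds from the last leaf to the first so that the numbering of the leaves still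
  to be treated does not change.
\<close>

lemma dias_relator:
  assumes "free_tree T - free_tree T' \<in> dias_relators" "leaves T = 3" "leaves T' = 3"
  shows "dias_tree (tree_graft 1 (tree_graft 2 (tree_graft 3 T u) t) s) =
    dias_tree (tree_graft 1 (tree_graft 2 (tree_graft 3 T' u) t) s)"
proof -
  have "dias_tree T = dias_tree T'"
    by (simp add: dias_tree.abs_eq dias.abs_eq_iff dias_rel_def dias_ideal.relator assms(1))
  moreover have "dias_tree (tree_graft 1 (tree_graft 2 (tree_graft 3 S u) t) s) =
      dias_comp 1 (dias_comp 2 (dias_comp 3 (dias_tree S) (dias_tree u)) (dias_tree t)) (dias_tree s)"
    if "leaves S = 3" for S
    using that leaves_pos[of u] leaves_pos[of t] by (simp add: dias_comp_tree leaves_tree_graft)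
  ultimately show ?thesis using assms by simp
qed

lemma dias_relations:
  "dias_tree (LProd s (LProd t u)) = dias_tree (LProd (LProd s t) u)"
  "dias_tree (LProd s (RProd t u)) = dias_tree (LProd (LProd s t) u)"
  "dias_tree (RProd s (LProd t u)) = dias_tree (LProd (RProd s t) u)"
  "dias_tree (RProd (RProd s t) u) = dias_tree (RProd s (RProd t u))"
  "dias_tree (RProd (LProd s t) u) = dias_tree (RProd s (RProd t u))"
proof -
  have r: "free_tree (LProd Leaf (RProd Leaf Leaf)) - free_tree (LProd Leaf (LProd Leaf Leaf)) \<in> dias_relators"
    "free_tree (LProd Leaf (LProd Leaf Leaf)) - free_tree (LProd (LProd Leaf Leaf) Leaf) \<in> dias_relators"
    "free_tree (RProd Leaf (LProd Leaf Leaf)) - free_tree (LProd (RProd Leaf Leaf) Leaf) \<in> dias_relators"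
    "free_tree (RProd Leaf (RProd Leaf Leaf)) - free_tree (RProd (RProd Leaf Leaf) Leaf) \<in> dias_relators"
    "free_tree (RProd (RProd Leaf Leaf) Leaf) - free_tree (RProd (LProd Leaf Leaf) Leaf) \<in> dias_relators"
    by (simp_all add: dias_relators_def)
  note r' = r[THEN dias_relator, of u t s, simplified]
  show "dias_tree (LProd s (LProd t u)) = dias_tree (LProd (LProd s t) u)"
    "dias_tree (LProd s (RProd t u)) = dias_tree (LProd (LProd s t) u)"
    "dias_tree (RProd s (LProd t u)) = dias_tree (LProd (RProd s t) u)"
    "dias_tree (RProd (RProd s t) u) = dias_tree (RProd s (RProd t u))"
    "dias_tree (RProd (LProd s t) u) = dias_tree (RProd s (RProd t u))"
    using r' by simp_all
qed

definition add_right :: "dtree \<Rightarrow> dtree" where "add_right t = LProd t Leaf"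
definition add_left :: "dtree \<Rightarrow> dtree" where "add_left t = RProd Leaf t"

lemma dias_tree_cong:
  assumes "dias_tree s = dias_tree s'"
  shows "dias_tree ((add_right ^^ k) s) = dias_tree ((add_right ^^ k) s')"
    and "dias_tree ((add_left ^^ k) s) = dias_tree ((add_left ^^ k) s')"
  using assms by (induction k) (simp_all add: add_right_def add_left_def dias_tree_LProd dias_tree_RProd)

text \<open>
  By the relations \<open>x \<stileturn> (y \<stileturn> z) = x \<stileturn> (y \<turnstile> z) = (x \<stileturn> y) \<stileturn> z\<close> an unpointed factor can
  be split into single leaves, so that only its number of leaves matters.
\<close>

lemma dias_tree_LProd_eq: "dias_tree (LProd s t) = dias_tree ((add_right ^^ leaves t) s)"
proof (induction t arbitrary: s)
  case (LProd t u)
  have "dias_tree (LProd s (LProd t u)) = dias_tree (LProd (LProd s t) u)" by (rule dias_relations)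
  also have "\<dots> = dias_tree ((add_right ^^ leaves u) (LProd s t))" by (rule LProd.IH)
  also have "\<dots> = dias_tree ((add_right ^^ leaves u) ((add_right ^^ leaves t) s))"
    by (intro dias_tree_cong LProd.IH)
  finally show ?case by (simp add: funpow_add add.commute[of "leaves t"])
next
  case (RProd t u)
  have "dias_tree (LProd s (RProd t u)) = dias_tree (LProd (LProd s t) u)" by (rule dias_relations)
  also have "\<dots> = dias_tree ((add_right ^^ leaves u) (LProd s t))" by (rule RProd.IH)
  also have "\<dots> = dias_tree ((add_right ^^ leaves u) ((add_right ^^ leaves t) s))"
    by (intro dias_tree_cong RProd.IH)
  finally show ?case by (simp add: funpow_add add.commute[of "leaves t"])
qed (simp add: add_right_def)

lemma dias_tree_RProd_eq: "dias_tree (RProd s t) = dias_tree ((add_left ^^ leaves s) t)"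
proof (induction s arbitrary: t)
  case (LProd s u)
  have "dias_tree (RProd (LProd s u) t) = dias_tree (RProd s (RProd u t))" by (rule dias_relations)
  also have "\<dots> = dias_tree ((add_left ^^ leaves s) (RProd u t))" by (rule LProd.IH)
  also have "\<dots> = dias_tree ((add_left ^^ leaves s) ((add_left ^^ leaves u) t))"
    by (intro dias_tree_cong LProd.IH)
  finally show ?case by (simp add: funpow_add)
next
  case (RProd s u)
  have "dias_tree (RProd (RProd s u) t) = dias_tree (RProd s (RProd u t))" by (rule dias_relations)
  also have "\<dots> = dias_tree ((add_left ^^ leaves s) (RProd u t))" by (rule RProd.IH)
  also have "\<dots> = dias_tree ((add_left ^^ leaves s) ((add_left ^^ leaves u) t))"
    by (intro dias_tree_cong RProd.IH)
  finally show ?case by (simp add: funpow_add)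
qed (simp add: add_left_def)

lemma dias_tree_add_commute:
  "dias_tree ((add_right ^^ k) ((add_left ^^ l) t)) = dias_tree ((add_left ^^ l) ((add_right ^^ k) t))"
proof (induction k)
  case (Suc k)
  have "dias_tree (add_right ((add_left ^^ l) t)) = dias_tree ((add_left ^^ l) (add_right t))" for t
  proof (induction l)
    case (Suc l)
    have "dias_tree (add_right ((add_left ^^ Suc l) t)) = dias_tree (add_left (add_right ((add_left ^^ l) t)))"
      by (simp add: add_right_def add_left_def dias_relations)
    then show ?case using Suc dias_tree_cong(2)[OF Suc, of 1] by simp
  qed simp
  then show ?case using dias_tree_cong(1)[OF Suc, of 1] by simp
qed simp

text \<open>
  The representative of the trees with \<open>n\<close> leaves and distinguished leaf \<open>i\<close>:
  \<open>n - i\<close> leaves are first added on the right of the distinguished one, then \<open>i - 1\<close> on the left.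
\<close>

definition canonical_tree :: "nat \<Rightarrow> nat \<Rightarrow> dtree" where
  "canonical_tree n i = (add_left ^^ (i - 1)) ((add_right ^^ (n - i)) Leaf)"

text \<open>
  Extended by \<open>0\<close> to all other indices. The values \<open>0\<close> at \<open>i = 0\<close> and \<open>i = n + 1\<close> make the
  formulas for composition and rotation uniform at the ends.
\<close>

definition dias_basis :: "nat \<Rightarrow> nat \<Rightarrow> dias" where
  "dias_basis n i = (if 1 \<le> i \<and> i \<le> n then dias_tree (canonical_tree n i) else 0)"

lemma leaves_head_canonical_tree:
  assumes "1 \<le> i" "i \<le> n"
  shows "leaves (canonical_tree n i) = n" "head (canonical_tree n i) = i"
proof -
  have r: "leaves ((add_right ^^ k) t) = leaves t + k" "head ((add_right ^^ k) t) = head t" for k t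
    by (induction k) (simp_all add: add_right_def)
  have l: "leaves ((add_left ^^ k) t) = leaves t + k" "head ((add_left ^^ k) t) = head t + k" for k t
    by (induction k) (simp_all add: add_left_def)
  show "leaves (canonical_tree n i) = n" "head (canonical_tree n i) = i"
    using assms by (simp_all add: canonical_tree_def r l)
qed

text \<open>
  A tree is built from its distinguished leaf by adding single leaves on the left and on the right. The two
  kinds of additions commute by the relation
  \<open>x \<turnstile> (y \<stileturn> z) = (x \<turnstile> y) \<stileturn> z\<close>.
\<close>

lemma dias_tree_eq_basis: "dias_tree t = dias_basis (leaves t) (head t)"
proof -
  have "dias_tree t = dias_tree (canonical_tree (leaves t) (head t))"
  proof (induction t)
    case Leaf
    then show ?case by (simp add: canonical_tree_def)
  next
    case (LProd s t)
    let ?x = "(add_right ^^ (leaves s - head s)) Leaf"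
    have "dias_tree (LProd s t) = dias_tree ((add_right ^^ leaves t) s)" by (rule dias_tree_LProd_eq)
    also have "\<dots> = dias_tree ((add_right ^^ leaves t) ((add_left ^^ (head s - 1)) ?x))"
      using dias_tree_cong(1)[OF LProd.IH(1)] by (simp add: canonical_tree_def)
    also have "\<dots> = dias_tree ((add_left ^^ (head s - 1)) ((add_right ^^ leaves t) ?x))"
      by (rule dias_tree_add_commute)
    also have "(add_right ^^ leaves t) ?x = (add_right ^^ (leaves (LProd s t) - head (LProd s t))) Leaf"
      using head_bounds[of s] by (simp add: add.commute[of "leaves t"] funpow_add[THEN fun_cong, unfolded o_apply, symmetric])
    finally show ?case by (simp add: canonical_tree_def)
  next
    case (RProd s t)
    have "dias_tree (RProd s t) = dias_tree ((add_left ^^ leaves s) t)" by (rule dias_tree_RProd_eq)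
    also have "\<dots> = dias_tree ((add_left ^^ leaves s) (canonical_tree (leaves t) (head t)))"
      by (rule dias_tree_cong(2)[OF RProd.IH(2)])
    also have "(add_left ^^ leaves s) (canonical_tree (leaves t) (head t)) =
        canonical_tree (leaves (RProd s t)) (head (RProd s t))"
      using head_bounds[of t] by (simp add: canonical_tree_def funpow_add[THEN fun_cong, unfolded o_apply, symmetric])
    finally show ?case .
  qed
  then show ?thesis using head_bounds[of t] by (simp add: dias_basis_def)
qed

text \<open>
  For \<open>j\<close> outside \<open>{1..m}\<close> both sides vanish, since then the new index lies outside
  \<open>{1..m + n - 1}\<close>.
\<close>

lemma dias_comp_basis:
  assumes "1 \<le> i" "i \<le> m" "1 \<le> k" "k \<le> n"
  shows "dias_comp i (dias_basis m j) (dias_basis n k) = dias_basis (m + n - 1) (graft_head i j n k)"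
proof (cases "1 \<le> j \<and> j \<le> m")
  case True
  let ?s = "canonical_tree m j" and ?t = "canonical_tree n k"
  have s: "leaves ?s = m" "head ?s = j" "leaves ?t = n" "head ?t = k"
    using True assms by (simp_all add: leaves_head_canonical_tree)
  have "dias_comp i (dias_basis m j) (dias_basis n k) = dias_tree (tree_graft i ?s ?t)"
    using True assms s by (simp add: dias_basis_def dias_comp_tree)
  also have "\<dots> = dias_basis (m + n - 1) (graft_head i j n k)"
    using assms s by (simp add: dias_tree_eq_basis[of "tree_graft i ?s ?t"] leaves_tree_graft head_tree_graft)
  finally show ?thesis .
next
  case False
  then have "dias_basis m j = 0" "dias_basis (m + n - 1) (graft_head i j n k) = 0"
    using assms by (auto simp: dias_basis_def graft_head_def)
  then show ?thesis by (simp add: dias_comp_zero)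
qed

lemma dias_simps:
  "op_scale Dias_ns = dias_scale" "op_unit Dias_ns = dias_tree Leaf"
  "op_comp Dias_ns m n i = dias_comp i"
  by (simp_all add: Dias_ns_def fun_eq_iff)

lemma dias_space_span: "op_space Dias_ns n = dias.span (dias_basis n ` {1..n})"
proof
  show "op_space Dias_ns n \<subseteq> dias.span (dias_basis n ` {1..n})"
  proof
    fix x assume "x \<in> op_space Dias_ns n"
    then obtain f where f: "x = abs_dias f" "\<forall>t\<in>Poly_Mapping.keys f. leaves t = n"
      by (auto simp: Dias_ns_def)
    have "dias_tree t \<in> dias.span (dias_basis n ` {1..n})" if "t \<in> Poly_Mapping.keys f" for t
      using f(2) that head_bounds[of t] by (auto simp: dias_tree_eq_basis intro!: dias.span_base)
    then show "x \<in> dias.span (dias_basis n ` {1..n})"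
      unfolding f(1) abs_dias_expand by (intro dias.span_sum dias.span_scale)
  qed
  have sub: "dias.subspace (op_space Dias_ns n)"
  proof (rule dias.subspaceI)
    show "0 \<in> op_space Dias_ns n"
      unfolding Dias_ns_def zero_dias_def by (auto intro!: image_eqI[of _ _ 0])
    fix x y assume "x \<in> op_space Dias_ns n" "y \<in> op_space Dias_ns n"
    then obtain f g where f: "x = abs_dias f" "\<forall>t\<in>Poly_Mapping.keys f. leaves t = n"
      and g: "y = abs_dias g" "\<forall>t\<in>Poly_Mapping.keys g. leaves t = n"
      by (auto simp: Dias_ns_def)
    have "x + y = abs_dias (f + g)" by (simp add: f g plus_dias.abs_eq)
    moreover have "\<forall>t\<in>Poly_Mapping.keys (f + g). leaves t = n" using f g keys_add[of f g] by blast
    ultimately show "x + y \<in> op_space Dias_ns n" by (auto simp: Dias_ns_def)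
  next
    fix c x assume "x \<in> op_space Dias_ns n"
    then obtain f where f: "x = abs_dias f" "\<forall>t\<in>Poly_Mapping.keys f. leaves t = n"
      by (auto simp: Dias_ns_def)
    have "dias_scale c x = abs_dias (free_scale c f)" by (simp add: f dias_scale.abs_eq)
    moreover have "\<forall>t\<in>Poly_Mapping.keys (free_scale c f). leaves t = n" using f keys_free_scale by blast
    ultimately show "dias_scale c x \<in> op_space Dias_ns n" by (auto simp: Dias_ns_def)
  qed
  have "dias_basis n i \<in> op_space Dias_ns n" if "i \<in> {1..n}" for i
    using that leaves_head_canonical_tree(1)[of i n]
    by (auto simp: Dias_ns_def dias_basis_def dias_tree.abs_eq intro!: image_eqI[of _ _ "free_tree (canonical_tree n i)"])
  then show "dias.span (dias_basis n ` {1..n}) \<subseteq> op_space Dias_ns n"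
    by (intro dias.span_minimal sub) auto
qed

lemma dias_subspace: "dias.subspace (op_space Dias_ns n)"
  by (simp add: dias_space_span dias.subspace_span)

lemma dias_basis_in: "dias_basis n i \<in> op_space Dias_ns n"
proof (cases "i \<in> {1..n}")
  case True
  then show ?thesis by (simp add: dias_space_span dias.span_base)
next
  case False
  then show ?thesis by (auto simp: dias_basis_def dias_space_span dias.span_zero)
qed

lemma dias_comp_closed:
  assumes "1 \<le> i" "i \<le> m" "x \<in> op_space Dias_ns m" "y \<in> op_space Dias_ns n"
  shows "dias_comp i x y \<in> op_space Dias_ns (m + n - 1)"
proof -
  have 1: "dias_comp i (dias_basis m j) y \<in> op_space Dias_ns (m + n - 1)" for j
    using assms(4) unfolding dias_space_span[of n]
  proof (induction rule: dias.span_induct_alt)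
    case (step c b y)
    then show ?case
      using dias_subspace assms(1,2)
      by (auto simp: dias_comp_bilinear dias_comp_basis dias_basis_in dias.subspace_add dias.subspace_scale)
  qed (simp add: dias_comp_zero dias_subspace dias.subspace_0)
  show ?thesis
    using assms(3) unfolding dias_space_span[of m]
  proof (induction rule: dias.span_induct_alt)
    case (step c b y)
    then show ?case
      using dias_subspace 1
      by (auto simp: dias_comp_bilinear dias.subspace_add dias.subspace_scale)
  qed (simp add: dias_comp_zero dias_subspace dias.subspace_0)
qed

lemma dias_linear_left:
  assumes "1 \<le> i" "i \<le> m" "y \<in> op_space Dias_ns n"
  shows "linear_map_on dias_scale (op_space Dias_ns m) dias_scale (op_space Dias_ns (m + n - 1)) (\<lambda>x. dias_comp i x y)"
  using dias_comp_closed[OF assms(1,2) _ assms(3)] by (simp add: linear_map_on_def dias_comp_bilinear)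

lemma dias_linear_right:
  assumes "1 \<le> i" "i \<le> m" "x \<in> op_space Dias_ns m"
  shows "linear_map_on dias_scale (op_space Dias_ns n) dias_scale (op_space Dias_ns (m + n - 1)) (\<lambda>y. dias_comp i x y)"
  using dias_comp_closed[OF assms] by (simp add: linear_map_on_def dias_comp_bilinear)

lemma graft_head_assoc_seq:
  assumes "1 \<le> i" "1 \<le> j" "j \<le> m" "1 \<le> n" "1 \<le> b" "b \<le> m"
  shows "graft_head (i - 1 + j) (graft_head i a m b) n c = graft_head i a (m + n - 1) (graft_head j b n c)"
proof -
  consider "a < i" | "a = i" "b < j" | "a = i" "b = j" | "a = i" "j < b" | "i < a" by linarith
  then show ?thesis by cases (use assms in \<open>auto simp: graft_head_def\<close>)
qed

lemma graft_head_assoc_par: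
  assumes "1 \<le> i" "i < k" "1 \<le> m" "1 \<le> n" "1 \<le> b" "b \<le> m" "1 \<le> c" "c \<le> n"
  shows "graft_head (k - 1 + m) (graft_head i a m b) n c = graft_head i (graft_head k a n c) m b"
proof -
  consider "a < i" | "a = i" | "i < a" "a < k" | "a = k" | "k < a" by linarith
  then show ?thesis by cases (use assms in \<open>auto simp: graft_head_def\<close>)
qed

lemma dias_ns_operad: "ns_operad Dias_ns"
proof -
  note V = dias_vector_space dias_space_span
  note linc = linear_map_on_compose[OF dias_linear_left dias_linear_left]
    linear_map_on_compose[OF dias_linear_left dias_linear_right]
    linear_map_on_compose[OF dias_linear_right dias_linear_left]
    linear_map_on_compose[OF dias_linear_right dias_linear_right]
  have unit: "dias_tree Leaf = dias_basis 1 1"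
    by (simp add: dias_tree_eq_basis)
  show ?thesis
  proof (intro ns_operad.intro ns_operad_axioms.intro; unfold dias_simps)
    show "vector_space dias_scale" by (rule dias_vector_space)
    show "dias.subspace (op_space Dias_ns n)" for n by (rule dias_subspace)
    show "dias_tree Leaf \<in> op_space Dias_ns 1" unfolding unit by (rule dias_basis_in)
  next
    fix i m x assume i: "1 \<le> i" "i \<le> m" and x: "x \<in> op_space Dias_ns m"
    show "dias_comp i x (dias_tree Leaf) = x"
    proof (rule linear_map_on_eqI[OF V _ linear_map_on_ident _ x])
      show "linear_map_on dias_scale (op_space Dias_ns m) dias_scale (op_space Dias_ns m) (\<lambda>x. dias_comp i x (dias_tree Leaf))"
        using dias_linear_left[OF i, of "dias_tree Leaf" 1] by (simp add: unit dias_basis_in del: One_nat_def)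
      show "dias_comp i b (dias_tree Leaf) = b" if "b \<in> dias_basis m ` {1..m}" for b
        using that i by (auto simp: unit dias_comp_basis graft_head_def)
    qed
  next
    fix n x assume n: "1 \<le> n" and x: "x \<in> op_space Dias_ns n"
    show "dias_comp 1 (dias_tree Leaf) x = x"
    proof (rule linear_map_on_eqI[OF V _ linear_map_on_ident _ x])
      show "linear_map_on dias_scale (op_space Dias_ns n) dias_scale (op_space Dias_ns n) (\<lambda>x. dias_comp 1 (dias_tree Leaf) x)"
        using dias_linear_right[of 1 1 "dias_tree Leaf" n] by (simp add: unit dias_basis_in del: One_nat_def)
      show "dias_comp 1 (dias_tree Leaf) b = b" if "b \<in> dias_basis n ` {1..n}" for b
        using that by (auto simp: unit dias_comp_basis graft_head_def)
    qed
  next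
    fix i l j m n x y z
    assume i: "1 \<le> i" "i \<le> l" "1 \<le> j" "j \<le> m" "1 \<le> n"
      and x: "x \<in> op_space Dias_ns l" "y \<in> op_space Dias_ns m" "z \<in> op_space Dias_ns n"
    have pos: "1 \<le> i - 1 + j" "i - 1 + j \<le> l + m - 1" and N: "l + m - 1 + n - 1 = l + (m + n - 1) - 1"
      using i by auto
    show "dias_comp (i - 1 + j) (dias_comp i x y) z = dias_comp i x (dias_comp j y z)"
    proof (rule trilinear_map_on_eqI[OF V V V _ _ _ _ _ _ _ x, where sW = dias_scale and W = "op_space Dias_ns (l + m - 1 + n - 1)"])
      fix x y z assume "x \<in> dias_basis l ` {1..l}" "y \<in> dias_basis m ` {1..m}" "z \<in> dias_basis n ` {1..n}"
      then obtain a b c where a: "a \<in> {1..l}" "x = dias_basis l a" "b \<in> {1..m}" "y = dias_basis m b"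
        "c \<in> {1..n}" "z = dias_basis n c" by auto
      have "graft_head j b n c \<in> {1..m + n - 1}" using a i by (auto simp: graft_head_def)
      moreover have "graft_head (i - 1 + j) (graft_head i a m b) n c = graft_head i a (m + n - 1) (graft_head j b n c)"
        using a i by (intro graft_head_assoc_seq) auto
      ultimately show "dias_comp (i - 1 + j) (dias_comp i x y) z = dias_comp i x (dias_comp j y z)"
        using a i pos N by (simp add: dias_comp_basis del: One_nat_def)
    next
      fix y z assume "y \<in> op_space Dias_ns m" "z \<in> op_space Dias_ns n"
      note x = this and cl = dias_comp_closed[OF i(3,4) this]
      show "linear_map_on dias_scale (op_space Dias_ns l) dias_scale (op_space Dias_ns (l + m - 1 + n - 1))
        (\<lambda>x. dias_comp (i - 1 + j) (dias_comp i x y) z)"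
        by (intro linc i pos x)
      show "linear_map_on dias_scale (op_space Dias_ns l) dias_scale (op_space Dias_ns (l + m - 1 + n - 1))
        (\<lambda>x. dias_comp i x (dias_comp j y z))"
        unfolding N by (intro dias_linear_left i cl)
    next
      fix x z assume x: "x \<in> op_space Dias_ns l" "z \<in> op_space Dias_ns n"
      show "linear_map_on dias_scale (op_space Dias_ns m) dias_scale (op_space Dias_ns (l + m - 1 + n - 1))
        (\<lambda>y. dias_comp (i - 1 + j) (dias_comp i x y) z)"
        by (intro linc i pos x)
      show "linear_map_on dias_scale (op_space Dias_ns m) dias_scale (op_space Dias_ns (l + m - 1 + n - 1))
        (\<lambda>y. dias_comp i x (dias_comp j y z))"
        unfolding N by (intro linc i x)
    next
      fix x y assume "x \<in> op_space Dias_ns l" "y \<in> op_space Dias_ns m"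
      note x = this and cl = dias_comp_closed[OF i(1,2) this]
      show "linear_map_on dias_scale (op_space Dias_ns n) dias_scale (op_space Dias_ns (l + m - 1 + n - 1))
        (\<lambda>z. dias_comp (i - 1 + j) (dias_comp i x y) z)"
        by (intro dias_linear_right pos cl)
      show "linear_map_on dias_scale (op_space Dias_ns n) dias_scale (op_space Dias_ns (l + m - 1 + n - 1))
        (\<lambda>z. dias_comp i x (dias_comp j y z))"
        unfolding N by (intro linc i x)
    qed
  next
    fix i k l m n x y z
    assume i: "1 \<le> i" "i < k" "k \<le> l" "1 \<le> m" "1 \<le> n"
      and x: "x \<in> op_space Dias_ns l" "y \<in> op_space Dias_ns m" "z \<in> op_space Dias_ns n"
    have pos: "1 \<le> k - 1 + m" "k - 1 + m \<le> l + m - 1" "i \<le> l" "1 \<le> k" "i \<le> l + n - 1"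
      and N: "l + m - 1 + n - 1 = l + n - 1 + m - 1"
      using i by auto
    show "dias_comp (k - 1 + m) (dias_comp i x y) z = dias_comp i (dias_comp k x z) y"
    proof (rule trilinear_map_on_eqI[OF V V V _ _ _ _ _ _ _ x, where sW = dias_scale and W = "op_space Dias_ns (l + m - 1 + n - 1)"])
      fix x y z assume "x \<in> dias_basis l ` {1..l}" "y \<in> dias_basis m ` {1..m}" "z \<in> dias_basis n ` {1..n}"
      then obtain a b c where a: "a \<in> {1..l}" "x = dias_basis l a" "b \<in> {1..m}" "y = dias_basis m b"
        "c \<in> {1..n}" "z = dias_basis n c" by auto
      have "graft_head (k - 1 + m) (graft_head i a m b) n c = graft_head i (graft_head k a n c) m b"
        using a i by (intro graft_head_assoc_par) auto
      then show "dias_comp (k - 1 + m) (dias_comp i x y) z = dias_comp i (dias_comp k x z) y"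
        using a i pos N by (simp add: dias_comp_basis del: One_nat_def)
    next
      fix y z assume x: "y \<in> op_space Dias_ns m" "z \<in> op_space Dias_ns n"
      show "linear_map_on dias_scale (op_space Dias_ns l) dias_scale (op_space Dias_ns (l + m - 1 + n - 1))
        (\<lambda>x. dias_comp (k - 1 + m) (dias_comp i x y) z)"
        by (intro linc i pos x)
      show "linear_map_on dias_scale (op_space Dias_ns l) dias_scale (op_space Dias_ns (l + m - 1 + n - 1))
        (\<lambda>x. dias_comp i (dias_comp k x z) y)"
        unfolding N by (intro linc i pos x)
    next
      fix x z assume "x \<in> op_space Dias_ns l" "z \<in> op_space Dias_ns n"
      note x = this and cl = dias_comp_closed[OF pos(4) i(3) this]
      show "linear_map_on dias_scale (op_space Dias_ns m) dias_scale (op_space Dias_ns (l + m - 1 + n - 1))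
        (\<lambda>y. dias_comp (k - 1 + m) (dias_comp i x y) z)"
        by (intro linc i pos x)
      show "linear_map_on dias_scale (op_space Dias_ns m) dias_scale (op_space Dias_ns (l + m - 1 + n - 1))
        (\<lambda>y. dias_comp i (dias_comp k x z) y)"
        unfolding N by (intro dias_linear_right i pos cl)
    next
      fix x y assume "x \<in> op_space Dias_ns l" "y \<in> op_space Dias_ns m"
      note x = this and cl = dias_comp_closed[OF i(1) pos(3) this]
      show "linear_map_on dias_scale (op_space Dias_ns n) dias_scale (op_space Dias_ns (l + m - 1 + n - 1))
        (\<lambda>z. dias_comp (k - 1 + m) (dias_comp i x y) z)"
        by (intro dias_linear_right pos cl)
      show "linear_map_on dias_scale (op_space Dias_ns n) dias_scale (op_space Dias_ns (l + m - 1 + n - 1))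
        (\<lambda>z. dias_comp i (dias_comp k x z) y)"
        unfolding N by (intro linc i pos x)
    qed
  qed (rule dias_linear_left dias_linear_right; assumption)+
qed

section \<open>The rotation of Dias\<close>

text \<open>
  The linear maps out of the free operad whose value on a tree depends only on the number of
  leaves and the distinguished leaf. They factor through Dias, which is how \<open>\<tau>\<close> is defined there.
\<close>

definition free_lift :: "(nat \<Rightarrow> nat \<Rightarrow> dias) \<Rightarrow> (dtree \<Rightarrow>\<^sub>0 rat) \<Rightarrow> dias" where
  "free_lift \<phi> f = (\<Sum>t\<in>Poly_Mapping.keys f. dias_scale (Poly_Mapping.lookup f t) (\<phi> (leaves t) (head t)))"

lemma free_lift_superset:
  assumes "finite A" "Poly_Mapping.keys f \<subseteq> A"
  shows "free_lift \<phi> f = (\<Sum>t\<in>A. dias_scale (Poly_Mapping.lookup f t) (\<phi> (leaves t) (head t)))"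
  unfolding free_lift_def using assms by (intro sum.mono_neutral_left) (auto simp: in_keys_iff)

lemma free_lift_add: "free_lift \<phi> (f + g) = free_lift \<phi> f + free_lift \<phi> g"
proof -
  have "Poly_Mapping.keys (f + g) \<subseteq> Poly_Mapping.keys f \<union> Poly_Mapping.keys g" by (rule keys_add)
  then show ?thesis
    by (subst (1 2 3) free_lift_superset[of "Poly_Mapping.keys f \<union> Poly_Mapping.keys g"])
      (auto simp: lookup_add dias.scale_left_distrib sum.distrib)
qed

lemma free_lift_scale: "free_lift \<phi> (free_scale c f) = dias_scale c (free_lift \<phi> f)"
  by (subst (1 2) free_lift_superset[of "Poly_Mapping.keys f"])
    (auto simp: keys_free_scale dias.scale_sum_right)

lemma free_lift_single: "free_lift \<phi> (Poly_Mapping.single t a) = dias_scale a (\<phi> (leaves t) (head t))"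
  by (cases "a = 0") (simp_all add: free_lift_def)

lemma free_lift_zero: "free_lift \<phi> 0 = 0"
  by (simp add: free_lift_def)

lemma free_lift_diff: "free_lift \<phi> (f - g) = free_lift \<phi> f - free_lift \<phi> g"
  using free_lift_add[of \<phi> "f - g" g] by (simp add: algebra_simps)

lemma free_lift_sum: "free_lift \<phi> (sum h A) = (\<Sum>x\<in>A. free_lift \<phi> (h x))"
  by (induction A rule: infinite_finite_induct) (simp_all add: free_lift_add free_lift_zero)

lemma free_lift_comp:
  "free_lift \<phi> (free_comp i f g) = (\<Sum>s\<in>Poly_Mapping.keys f. \<Sum>t\<in>Poly_Mapping.keys g.
     dias_scale (Poly_Mapping.lookup f s * Poly_Mapping.lookup g t)
       (if 1 \<le> i \<and> i \<le> leaves s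
        then \<phi> (leaves s + leaves t - 1) (graft_head i (head s) (leaves t) (head t)) else 0))"
  unfolding free_comp_def free_lift_sum
  by (intro sum.cong refl) (auto simp: free_lift_single free_lift_zero leaves_tree_graft head_tree_graft)

text \<open>
  Both numbers are the same for the two trees of each relator. For the ideal generated by the relators, note
  that the number of leaves and the distinguished leaf of a grafted tree are functions of those of the two factors;
  so after fixing a tree in one factor the map is again of the same kind in the other one, and the induction is over all \<open>\<phi>\<close>.
\<close>

lemma free_lift_ideal: "r \<in> dias_ideal \<Longrightarrow> free_lift \<phi> r = 0"
proof (induction arbitrary: \<phi> rule: dias_ideal.induct)
  case (relator r)
  then show ?case by (auto simp: dias_relators_def free_lift_diff free_lift_single numeral_3_eq_3)
next
  case (comp_left f i g)
  let ?\<psi> = "\<lambda>t l p. if 1 \<le> i \<and> i \<le> l then \<phi> (l + leaves t - 1) (graft_head i p (leaves t) (head t)) else 0"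
  have "free_lift \<phi> (free_comp i f g) =
      (\<Sum>t\<in>Poly_Mapping.keys g. dias_scale (Poly_Mapping.lookup g t) (free_lift (?\<psi> t) f))"
    unfolding free_lift_comp free_lift_def[of _ f] dias.scale_sum_right
    by (subst sum.swap) (intro sum.cong refl, simp add: mult.commute)
  then show ?case by (simp add: comp_left.IH)
next
  case (comp_right g i f)
  let ?\<psi> = "\<lambda>s l p. if 1 \<le> i \<and> i \<le> leaves s then \<phi> (leaves s + l - 1) (graft_head i (head s) l p) else 0"
  have "free_lift \<phi> (free_comp i f g) =
      (\<Sum>s\<in>Poly_Mapping.keys f. dias_scale (Poly_Mapping.lookup f s) (free_lift (?\<psi> s) g))"
    unfolding free_lift_comp free_lift_def[of _ g] dias.scale_sum_right by (intro sum.cong refl) simp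
  then show ?case by (simp add: comp_right.IH)
qed (simp_all add: free_lift_zero free_lift_add free_lift_scale)

lift_definition dias_lift :: "(nat \<Rightarrow> nat \<Rightarrow> dias) \<Rightarrow> dias \<Rightarrow> dias" is free_lift
  unfolding dias_rel_def using free_lift_ideal free_lift_diff by (metis eq_iff_diff_eq_0)

lemma dias_lift_add: "dias_lift \<phi> (x + y) = dias_lift \<phi> x + dias_lift \<phi> y"
  by (induction x; induction y) (simp add: plus_dias.abs_eq dias_lift.abs_eq free_lift_add)

lemma dias_lift_scale: "dias_lift \<phi> (dias_scale c x) = dias_scale c (dias_lift \<phi> x)"
  by (induction x) (simp add: dias_scale.abs_eq dias_lift.abs_eq free_lift_scale)

lemma dias_lift_basis: "1 \<le> i \<Longrightarrow> i \<le> n \<Longrightarrow> dias_lift \<phi> (dias_basis n i) = \<phi> n i"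
  by (simp add: dias_basis_def dias_tree.abs_eq dias_lift.abs_eq free_lift_single leaves_head_canonical_tree)

text \<open>
  Written without a dependence on \<open>n\<close>, as one map on the direct sum of the components.
\<close>

definition dias_rotation :: "dias \<Rightarrow> dias" where
  "dias_rotation = dias_lift (\<lambda>n i. dias_basis n (i - 1) - dias_basis n n)"

lemma dias_rotation_add: "dias_rotation (x + y) = dias_rotation x + dias_rotation y"
  by (simp add: dias_rotation_def dias_lift_add)

lemma dias_rotation_scale: "dias_rotation (dias_scale c x) = dias_scale c (dias_rotation x)"
  by (simp add: dias_rotation_def dias_lift_scale)

lemma dias_rotation_diff: "dias_rotation (x - y) = dias_rotation x - dias_rotation y"
  using dias_rotation_add[of "x - y" y] by (simp add: algebra_simps)

lemma dias_rotation_basis: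
  assumes "1 \<le> i" "i \<le> n + 1"
  shows "dias_rotation (dias_basis n i) = dias_basis n (i - 1) - dias_basis n n"
proof (cases "i = n + 1")
  case True
  then have "dias_basis n i = 0" by (simp add: dias_basis_def)
  moreover have "dias_rotation 0 = 0" using dias_rotation_add[of 0 0] by simp
  ultimately show ?thesis using True by simp
next
  case False
  then show ?thesis using assms by (simp add: dias_rotation_def dias_lift_basis)
qed

lemma dias_rotation_linear:
  "linear_map_on dias_scale (op_space Dias_ns n) dias_scale (op_space Dias_ns n) dias_rotation"
proof -
  have "dias_rotation x \<in> op_space Dias_ns n" if "x \<in> op_space Dias_ns n" for x
    using that unfolding dias_space_span
  proof (induction rule: dias.span_induct_alt)
    case base
    have "dias_rotation 0 = 0" using dias_rotation_add[of 0 0] by simp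
    then show ?case by (simp add: dias.span_zero)
  next
    case (step c b y)
    then have "dias_rotation b \<in> op_space Dias_ns n"
      by (auto simp: dias_rotation_basis intro!: dias.subspace_diff dias_subspace dias_basis_in)
    then show ?case
      using step by (auto simp: dias_rotation_add dias_rotation_scale dias_space_span
          intro!: dias.span_add dias.span_scale)
  qed
  then show ?thesis by (simp add: linear_map_on_def dias_rotation_add dias_rotation_scale)
qed

text \<open>
  With \<open>e\<^sub>i = x\<^sub>i - x\<^bsub>n+1\<^esub>\<close>, the \<open>k\<close>-th power of the rotation sends \<open>e\<^sub>i\<close> to the difference of
  \<open>x\<^sub>j\<close> for \<open>j = c\<^sup>k(i)\<close> and \<open>x\<^sub>l\<close> for \<open>l = c\<^sup>k(n + 1)\<close>. The index
  \<open>n + 1\<close> is admitted, where \<open>e\<^bsub>n+1\<^esub> = 0\<close>.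
\<close>

lemma dias_rotation_power_basis:
  assumes "i \<in> {1..n + 1}"
  shows "(dias_rotation ^^ k) (dias_basis n i) =
    dias_basis n ((long_cycle n ^^ k) i) - dias_basis n ((long_cycle n ^^ k) (n + 1))"
proof (induction k)
  case 0
  then show ?case by (simp add: dias_basis_def)
next
  case (Suc k)
  have step: "dias_rotation (dias_basis n j) = dias_basis n (long_cycle n j) - dias_basis n n"
    if "j \<in> {1..n + 1}" for j
  proof (cases "j = 1")
    case True
    then have "dias_rotation (dias_basis n j) = dias_basis n 0 - dias_basis n n"
      by (simp add: dias_rotation_basis)
    then show ?thesis using True by (simp add: long_cycle_apply dias_basis_def)
  next
    case False
    then show ?thesis using that by (simp add: dias_rotation_basis long_cycle_apply)
  qed
  have mem: "(long_cycle n ^^ k) j \<in> {1..n + 1}" if "j \<in> {1..n + 1}" for j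
    using that permutes_in_image[OF long_cycle_power_permutes] by blast
  have "n + 1 \<in> {1..n + 1}" by simp
  then show ?case
    using step[OF mem[OF assms]] step[OF mem[of "n + 1"]] Suc by (simp add: dias_rotation_diff del: One_nat_def)
qed

lemma dias_rotation_comp:
  assumes "2 \<le> i" "i \<le> m" "1 \<le> n" and x: "x \<in> op_space Dias_ns m" "y \<in> op_space Dias_ns n"
  shows "dias_rotation (dias_comp i x y) = dias_comp (i - 1) (dias_rotation x) y"
proof -
  note V = dias_vector_space dias_space_span
  have i: "1 \<le> i" "1 \<le> i - 1" "i - 1 \<le> m" using assms by auto
  show ?thesis
  proof (rule bilinear_map_on_eqI[OF V V _ _ _ _ _ x, where sW = dias_scale and W = "op_space Dias_ns (m + n - 1)"])
    fix x y assume "x \<in> dias_basis m ` {1..m}" "y \<in> dias_basis n ` {1..n}"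
    then obtain j k where j: "1 \<le> j" "j \<le> m" "x = dias_basis m j" and k: "1 \<le> k" "k \<le> n" "y = dias_basis n k"
      by auto
    have h: "1 \<le> graft_head i j n k" "graft_head i j n k \<le> m + n - 1"
      "graft_head i j n k - 1 = graft_head (i - 1) (j - 1) n k" "graft_head (i - 1) m n k = m + n - 1"
      using assms j k by (auto simp: graft_head_def)
    have "dias_rotation (dias_comp i x y) = dias_rotation (dias_basis (m + n - 1) (graft_head i j n k))"
      using assms i j k by (simp add: dias_comp_basis del: One_nat_def)
    also have "\<dots> = dias_basis (m + n - 1) (graft_head i j n k - 1) - dias_basis (m + n - 1) (m + n - 1)"
      using h(1,2) by (intro dias_rotation_basis) auto
    also have "\<dots> = dias_comp (i - 1) (dias_rotation x) y"
      using assms i j k h(3,4) by (simp add: dias_rotation_basis dias_comp_diff dias_comp_basis del: One_nat_def)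
    finally show "dias_rotation (dias_comp i x y) = dias_comp (i - 1) (dias_rotation x) y" .
  qed (intro linear_map_on_compose[OF dias_rotation_linear dias_linear_left]
      linear_map_on_compose[OF dias_linear_left dias_rotation_linear]
      linear_map_on_compose[OF dias_rotation_linear dias_linear_right] dias_linear_right
      linear_map_on_closed[OF dias_rotation_linear] i assms; assumption)+
qed

text \<open>
  On basis elements \<open>x = e\<^sub>j\<close> and \<open>y = e\<^sub>k\<close>. For \<open>j > 1\<close> both terms of \<open>\<tau>(x) = e\<^bsub>j-1\<^esub> - e\<^sub>m\<close>
  contribute the summand \<open>e\<^bsub>k-1\<^esub>\<close> and these cancel. For \<open>j = 1\<close> the first term is \<open>0\<close> and the
  summand survives.
\<close>

lemma dias_rotation_comp_1:
  assumes mn: "1 \<le> m" "1 \<le> n" and x: "x \<in> op_space Dias_ns m" "y \<in> op_space Dias_ns n"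
  shows "dias_rotation (dias_comp 1 x y) = - dias_comp n (dias_rotation y) (dias_rotation x)"
proof -
  note V = dias_vector_space dias_space_span
  have N: "n + m - 1 = m + n - 1" by simp
  note neg = linear_map_on_uminus[OF dias_vector_space dias_subspace]
  note cl = linear_map_on_closed[OF dias_rotation_linear]
  show ?thesis
  proof (rule bilinear_map_on_eqI[OF V V _ _ _ _ _ x, where sW = dias_scale and W = "op_space Dias_ns (m + n - 1)"])
    fix x y assume "x \<in> dias_basis m ` {1..m}" "y \<in> dias_basis n ` {1..n}"
    then obtain j k where j: "1 \<le> j" "j \<le> m" "x = dias_basis m j" and k: "1 \<le> k" "k \<le> n" "y = dias_basis n k"
      by auto
    let ?e = "dias_basis (m + n - 1)"
    have h: "1 \<le> graft_head 1 j n k" "graft_head 1 j n k \<le> m + n - 1"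
      using j k by (auto simp: graft_head_def)
    have "dias_rotation (dias_comp 1 x y) = dias_rotation (?e (graft_head 1 j n k))"
      using mn j k by (simp add: dias_comp_basis del: One_nat_def)
    also have "\<dots> = ?e (graft_head 1 j n k - 1) - ?e (m + n - 1)"
      using h by (intro dias_rotation_basis) auto
    finally have L: "dias_rotation (dias_comp 1 x y) = ?e (graft_head 1 j n k - 1) - ?e (m + n - 1)" .
    have c: "dias_comp n (dias_basis n l) (dias_basis m p) = ?e (graft_head n l m p)" if "1 \<le> p" "p \<le> m" for l p
      using that mn dias_comp_basis[of n n p m l] by (simp add: add.commute del: One_nat_def)
    have nm: "n - 1 + m = m + n - 1" using mn by simp
    have m: "dias_comp n (dias_rotation y) (dias_basis m m) = ?e (k - 1) - ?e (m + n - 1)"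
      using mn k by (simp add: dias_rotation_basis dias_comp_diff c graft_head_def nm del: One_nat_def)
    show "dias_rotation (dias_comp 1 x y) = - dias_comp n (dias_rotation y) (dias_rotation x)"
    proof (cases "j = 1")
      case True
      then have "dias_rotation x = - dias_basis m m"
        using mn j by (simp add: dias_rotation_basis) (simp add: dias_basis_def)
      then have "- dias_comp n (dias_rotation y) (dias_rotation x) = dias_comp n (dias_rotation y) (dias_basis m m)"
        using dias_comp_diff(2)[of n "dias_rotation y" 0 "dias_basis m m"] by (simp add: dias_comp_zero)
      then show ?thesis using L m True by (simp add: graft_head_def)
    next
      case False
      then have j1: "1 \<le> j - 1" "j - 1 \<le> m" using j by auto
      have "dias_comp n (dias_rotation y) (dias_basis m (j - 1)) = ?e (k - 1) - ?e (n - 1 + (j - 1))"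
        using mn k j1 by (simp add: dias_rotation_basis dias_comp_diff c graft_head_def del: One_nat_def)
      moreover have "graft_head 1 j n k - 1 = n - 1 + (j - 1)" using False j mn by (auto simp: graft_head_def)
      ultimately show ?thesis
        using L m j by (simp add: dias_rotation_basis[of j m] dias_comp_diff(2) del: One_nat_def)
    qed
  next
    fix y assume y: "y \<in> op_space Dias_ns n"
    show "linear_map_on dias_scale (op_space Dias_ns m) dias_scale (op_space Dias_ns (m + n - 1))
      (\<lambda>x. dias_rotation (dias_comp 1 x y))"
      by (rule linear_map_on_compose[OF dias_rotation_linear dias_linear_left[OF order_refl mn(1) y]])
    show "linear_map_on dias_scale (op_space Dias_ns m) dias_scale (op_space Dias_ns (m + n - 1))
      (\<lambda>x. - dias_comp n (dias_rotation y) (dias_rotation x))"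
      by (rule neg[OF linear_map_on_compose[OF dias_linear_right[OF mn(2) order_refl cl[OF y], of m, unfolded N] dias_rotation_linear]])
  next
    fix x assume x: "x \<in> op_space Dias_ns m"
    show "linear_map_on dias_scale (op_space Dias_ns n) dias_scale (op_space Dias_ns (m + n - 1))
      (\<lambda>y. dias_rotation (dias_comp 1 x y))"
      by (rule linear_map_on_compose[OF dias_rotation_linear dias_linear_right[OF order_refl mn(1) x]])
    show "linear_map_on dias_scale (op_space Dias_ns n) dias_scale (op_space Dias_ns (m + n - 1))
      (\<lambda>y. - dias_comp n (dias_rotation y) (dias_rotation x))"
      by (rule neg[OF linear_map_on_compose[OF dias_linear_left[OF mn(2) order_refl cl[OF x], unfolded N] dias_rotation_linear]])
  qed
qed

lemma dias_rotation_power: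
  assumes "x \<in> op_space Dias_ns n"
  shows "(dias_rotation ^^ (n + 1)) x = x"
proof (rule linear_map_on_eqI[OF dias_vector_space dias_space_span
      linear_map_on_funpow[OF dias_rotation_linear] linear_map_on_ident _ assms])
  fix b assume "b \<in> dias_basis n ` {1..n}"
  then obtain i where "i \<in> {1..n}" and b: "b = dias_basis n i" by auto
  then have i: "i \<in> {1..n + 1}" by simp
  have "(long_cycle n ^^ (n + 1)) j = j" for j by (subst long_cycle_power) auto
  then show "(dias_rotation ^^ (n + 1)) b = b"
    unfolding b dias_rotation_power_basis[OF i] by (simp add: dias_basis_def)
qed

lemma dias_rotation_ns_anticyclic: "ns_anticyclic_operad Dias_ns (\<lambda>n. dias_rotation)"
proof (rule ns_anticyclic_operad.intro[OF dias_ns_operad], rule ns_anticyclic_operad_axioms.intro, unfold dias_simps)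
  have "dias_rotation (dias_tree Leaf) = - dias_tree Leaf"
    using dias_rotation_basis[of 1 1] by (simp add: dias_tree_eq_basis) (simp add: dias_basis_def)
  then show "anticyclic_identities Dias_ns (\<lambda>n. dias_rotation)"
    by (auto simp: anticyclic_identities_def dias_simps dias_rotation_comp dias_rotation_comp_1 simp del: One_nat_def)
qed (rule dias_rotation_linear dias_rotation_power; assumption)+

text \<open>
  The rotation satisfies the conditions by which the structure on Dias is specified, so the chosen
  structure satisfies them too.
\<close>

lemma dias_tau:
  "ns_anticyclic_operad Dias_ns dias_tau"
  "dias_tau 2 dias_left = - dias_right"
  "dias_tau 2 dias_right = dias_left - dias_right"
proof -
  have b: "dias_left = dias_basis 2 1" "dias_right = dias_basis 2 2" "dias_basis n 0 = 0" for n
    by (simp_all add: dias_tree_eq_basis numeral_2_eq_2) (simp add: dias_basis_def)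
  have 1: "dias_rotation x = - x" if "x \<in> op_space Dias_ns 1" for x
  proof (rule linear_map_on_eqI[OF dias_vector_space dias_space_span dias_rotation_linear
        linear_map_on_uminus[OF dias_vector_space dias_subspace linear_map_on_ident] _ that])
    show "dias_rotation y = - y" if "y \<in> dias_basis 1 ` {1..1}" for y
      using that by (auto simp: dias_rotation_basis b(3) simp del: One_nat_def)
  qed
  have 2: "dias_rotation dias_left = - dias_right" "dias_rotation dias_right = dias_left - dias_right"
    using dias_rotation_basis[of 1 2] dias_rotation_basis[of 2 2] by (simp_all add: b)
  let ?P = "\<lambda>\<tau>. ns_anticyclic_operad Dias_ns \<tau> \<and>
     (\<forall>f\<in>op_space Dias_ns 1. \<tau> 1 f = - f) \<and>
     \<tau> 2 dias_left = - dias_right \<and> \<tau> 2 dias_right = dias_left - dias_right"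
  have "?P (\<lambda>n. dias_rotation)"
    using dias_rotation_ns_anticyclic 1 2 by blast
  then have "?P (SOME \<tau>. ?P \<tau>)" by (rule someI[of ?P])
  then have "?P dias_tau" unfolding dias_tau_def .
  then show "ns_anticyclic_operad Dias_ns dias_tau"
    "dias_tau 2 dias_left = - dias_right"
    "dias_tau 2 dias_right = dias_left - dias_right" by blast+
qed

section \<open>Suboperads stable under the cyclic action\<close>

lemma suboperad_simps:
  "op_scale (suboperad_generated P G) = op_scale P"
  "op_space (suboperad_generated P G) n = {x. generated P G n x}"
  "op_unit (suboperad_generated P G) = op_unit P"
  "op_comp (suboperad_generated P G) = op_comp P"
  "op_act (suboperad_generated P G) = op_act P"
  by (simp_all add: suboperad_generated_def)

lemma linear_map_on_restrict:
  assumes "linear_map_on sV V sW W f" "V' \<subseteq> V" "\<And>x. x \<in> V' \<Longrightarrow> f x \<in> W'"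
  shows "linear_map_on sV V' sW W' f"
  using assms by (auto simp: linear_map_on_def subset_iff)

context symmetric_operad
begin

lemma generated_in_space:
  assumes "generated P G n x" "\<And>n. 1 \<le> n \<Longrightarrow> G n \<subseteq> op_space P n"
  shows "1 \<le> n \<and> x \<in> op_space P n"
  using assms(1)
proof (induction rule: generated.induct)
  case (comp i m x n y)
  then show ?case using comp_closed[of i m n x y] by auto
next
  case (act \<sigma> n x)
  then show ?case using linear_map_on_closed[OF act_linear] by auto
qed (use assms(2) unit_in subspace_op_space subspace_0 subspace_add subspace_scale in blast)+

lemma suboperad_symmetric_operad:
  assumes G: "\<And>n. 1 \<le> n \<Longrightarrow> G n \<subseteq> op_space P n"
  shows "symmetric_operad (suboperad_generated P G)"
proof -
  have sub: "x \<in> op_space P n" if "generated P G n x" for n x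
    using generated_in_space[OF that G] by blast
  show ?thesis
  proof (intro symmetric_operad.intro ns_operad.intro ns_operad_axioms.intro symmetric_operad_axioms.intro;
      unfold suboperad_simps mem_Collect_eq)
    show "vector_space (op_scale P)" by unfold_locales
    show "subspace {x. generated P G n x}" if "1 \<le> n" for n :: nat
      using that by (intro subspaceI) (auto intro: generated.zero generated.add generated.scale)
    show "generated P G 1 (op_unit P)" by (rule generated.unit)
  next
    fix i m n :: nat and g assume i: "1 \<le> i" "i \<le> m" "1 \<le> n" and g: "generated P G n g"
    show "linear_map_on (op_scale P) {x. generated P G m x} (op_scale P) {x. generated P G (m + n - 1) x}
      (\<lambda>f. op_comp P m n i f g)"
      by (rule linear_map_on_restrict[OF comp_linear_left[OF i sub[OF g]]])
        (auto intro: sub generated.comp[OF i(1,2) _ g] simp del: One_nat_def)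
  next
    fix i m n :: nat and f assume i: "1 \<le> i" "i \<le> m" "1 \<le> n" and f: "generated P G m f"
    show "linear_map_on (op_scale P) {x. generated P G n x} (op_scale P) {x. generated P G (m + n - 1) x}
      (\<lambda>g. op_comp P m n i f g)"
      by (rule linear_map_on_restrict[OF comp_linear_right[OF i sub[OF f]]])
        (auto intro: sub generated.comp[OF i(1,2) f] simp del: One_nat_def)
  next
    fix n :: nat and \<sigma> assume n: "1 \<le> n" and \<sigma>: "\<sigma> permutes {1..n}"
    show "linear_map_on (op_scale P) {x. generated P G n x} (op_scale P) {x. generated P G n x} (op_act P n \<sigma>)"
      by (rule linear_map_on_restrict[OF act_linear[OF n \<sigma>]]) (auto intro: sub generated.act[OF \<sigma>] simp del: One_nat_def)
  qed (rule comp_unit_right comp_unit_left comp_assoc_seq comp_assoc_par act_id act_comp equivariance;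
      (assumption | erule sub))+
qed

end

context anticyclic_operad
begin

lemma rho_id:
  assumes "1 \<le> n" "x \<in> op_space P n"
  shows "\<rho> n id x = x"
  using rho_extends[OF assms(1) permutes_id assms(2)] act_id[OF assms] by simp

lemma rho_closed: "1 \<le> n \<Longrightarrow> \<sigma> permutes {1..n + 1} \<Longrightarrow> x \<in> op_space P n \<Longrightarrow> \<rho> n \<sigma> x \<in> op_space P n"
  using linear_map_on_closed[OF rho_linear] .

lemma rho_uminus:
  assumes "1 \<le> n" "\<sigma> permutes {1..n + 1}" "x \<in> op_space P n"
  shows "\<rho> n \<sigma> (- x) = - \<rho> n \<sigma> x"
  using linear_map_on_scale[OF rho_linear[OF assms(1,2)] assms(3), of "- 1"] by simp

lemma generated_uminus: "generated P G n x \<Longrightarrow> generated P G n (- x)"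
  using generated.scale[of P G n x "- 1"] by simp

text \<open>
  Every permutation of \<open>{1, \<dots>, n + 1}\<close> is a power of the long cycle followed by a permutation of \<open>{1, \<dots>, n}\<close>,
  and a suboperad is stable under the latter.
\<close>

lemma generated_rho_of_cycle_powers:
  assumes n: "1 \<le> n" and x: "x \<in> op_space P n" and \<sigma>: "\<sigma> permutes {1..n + 1}"
    and gen: "\<And>k. k \<le> n \<Longrightarrow> generated P G n (\<rho> n (long_cycle n ^^ k) x)"
  shows "generated P G n (\<rho> n \<sigma> x)"
proof -
  define k where "k = inv \<sigma> (n + 1) mod (n + 1)"
  define s where "s = \<sigma> \<circ> inv (long_cycle n ^^ k)"
  have s: "s permutes {1..n}" "\<sigma> = s \<circ> long_cycle n ^^ k"
    using permutes_Suc_decomposition[OF \<sigma>] by (simp_all add: s_def k_def)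
  have s': "s permutes {1..n + 1}" using s(1) by (rule permutes_subset) auto
  have k: "k \<le> n" using mod_less_divisor[of "n + 1" "inv \<sigma> (n + 1)"] by (simp add: k_def)
  have "\<rho> n \<sigma> x = op_act P n s (\<rho> n (long_cycle n ^^ k) x)"
    unfolding s(2) rho_comp[OF n s' long_cycle_power_permutes x]
    by (rule rho_extends[OF n s(1) rho_closed[OF n long_cycle_power_permutes x]])
  then show ?thesis using generated.act[OF s(1) gen[OF k]] by simp
qed

lemma rho_comp_long_cycle:
  "\<lbrakk>2 \<le> i; i \<le> m; 1 \<le> n; f \<in> op_space P m; g \<in> op_space P n\<rbrakk> \<Longrightarrow>
    \<rho> (m + n - 1) (long_cycle (m + n - 1)) (op_comp P m n i f g) = op_comp P m n (i - 1) (\<rho> m (long_cycle m) f) g"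
  "\<lbrakk>1 \<le> m; 1 \<le> n; f \<in> op_space P m; g \<in> op_space P n\<rbrakk> \<Longrightarrow>
    \<rho> (m + n - 1) (long_cycle (m + n - 1)) (op_comp P m n 1 f g) =
      - op_comp P n m n (\<rho> n (long_cycle n) g) (\<rho> m (long_cycle m) f)"
  using rho_identities by (simp_all add: anticyclic_identities_def del: One_nat_def)

text \<open>
  Induction over the generation of \<open>x\<close>. For a composition one rotates step by step: a rotation of
  \<open>f \<circ>\<^sub>i g\<close> is, up to sign, again a composition of two elements with generated orbits, because all
  of \<open>f\<close>, \<open>g\<close>, \<open>\<tau>(f)\<close>, \<open>\<tau>(g)\<close> have generated orbits. The orbit of the unit consists of the unit and its negative.
\<close>

lemma generated_rho:
  assumes G: "\<And>n. 1 \<le> n \<Longrightarrow> G n \<subseteq> op_space P n"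
    and orbit: "\<And>n x k. 1 \<le> n \<Longrightarrow> x \<in> G n \<Longrightarrow> k \<le> n \<Longrightarrow> generated P G n (\<rho> n (long_cycle n ^^ k) x)"
    and x: "generated P G n x" and \<sigma>: "\<sigma> permutes {1..n + 1}"
  shows "generated P G n (\<rho> n \<sigma> x)"
  using x \<sigma>
proof (induction arbitrary: \<sigma> rule: generated.induct)
  case (gen n x)
  have "x \<in> op_space P n" using G gen.hyps by blast
  then show ?case by (rule generated_rho_of_cycle_powers[OF gen.hyps(1) _ gen.prems orbit[OF gen.hyps]])
next
  case unit
  have pow: "\<rho> 1 (long_cycle 1 ^^ k) (op_unit P) \<in> {op_unit P, - op_unit P}" for k
  proof (induction k)
    case 0
    show ?case unfolding funpow.simps(1) rho_id[OF order_refl unit_in] by simp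
  next
    case (Suc k)
    have eq: "\<rho> 1 (long_cycle 1 ^^ Suc k) (op_unit P) = \<rho> 1 (long_cycle 1) (\<rho> 1 (long_cycle 1 ^^ k) (op_unit P))"
      unfolding funpow.simps by (rule rho_comp[OF order_refl long_cycle_permutes long_cycle_power_permutes unit_in])
    have "\<rho> 1 (long_cycle 1) (op_unit P) = - op_unit P"
      using rho_identities unfolding anticyclic_identities_def by blast
    then show ?case
      unfolding eq using Suc rho_uminus[OF order_refl long_cycle_permutes unit_in] by auto
  qed
  show ?case
  proof (rule generated_rho_of_cycle_powers[OF order_refl unit_in unit])
    show "generated P G 1 (\<rho> 1 (long_cycle 1 ^^ k) (op_unit P))" for k
      using pow[of k] generated.unit[of P G] generated_uminus[OF generated.unit[of P G]] by auto
  qed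
next
  case (zero n)
  have "\<rho> n \<sigma> 0 = 0"
    by (rule linear_map_on_zero[OF rho_linear[OF zero.hyps zero.prems]])
      (use zero.hyps subspace_op_space subspace_0 in blast)
  then show ?case using zero.hyps by (simp add: generated.zero)
next
  case (add n x y)
  have "1 \<le> n" "x \<in> op_space P n" "y \<in> op_space P n"
    using generated_in_space[OF _ G] add.hyps by blast+
  then show ?case
    using linear_map_on_add[OF rho_linear] add by (simp add: generated.add)
next
  case (scale n x c)
  have "1 \<le> n" "x \<in> op_space P n" using generated_in_space[OF _ G] scale.hyps by blast+
  then show ?case
    using linear_map_on_scale[OF rho_linear] scale by (simp add: generated.scale)
next
  case (act \<pi> n x)
  have x: "1 \<le> n" "x \<in> op_space P n" using generated_in_space[OF _ G] act.hyps by blast+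
  have \<pi>: "\<pi> permutes {1..n + 1}" using act.hyps(1) by (rule permutes_subset) auto
  have "\<rho> n \<sigma> (op_act P n \<pi> x) = \<rho> n (\<sigma> \<circ> \<pi>) x"
    using rho_comp[OF x(1) act.prems \<pi> x(2)] rho_extends[OF x(1) act.hyps(1) x(2)] by simp
  then show ?case using act.IH[OF permutes_compose[OF \<pi> act.prems]] by (simp only:)
next
  case (comp i m x n y)
  \<comment> \<open>Induction hypothesis for the rotations: \<open>Q\<close> is stable under \<open>\<tau>\<close>, so \<open>k\<close> can be lowered while the two factors change.\<close>
  define Q where "Q n x \<longleftrightarrow> 1 \<le> n \<and> x \<in> op_space P n \<and> generated P G n x \<and>
    (\<forall>\<sigma>. \<sigma> permutes {1..n + 1} \<longrightarrow> generated P G n (\<rho> n \<sigma> x))" for n x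
  have Q: "Q m x" "Q n y"
    unfolding Q_def using generated_in_space[OF comp.hyps(3) G] generated_in_space[OF comp.hyps(4) G]
      comp.hyps(3,4) comp.IH by blast+
  have QD: "1 \<le> n" "x \<in> op_space P n" "generated P G n x" if "Q n x" for n x
    using that unfolding Q_def by blast+
  have Q_rho: "Q n (\<rho> n (long_cycle n) x)" if "Q n x" for n x
  proof -
    have x: "1 \<le> n" "x \<in> op_space P n" using QD[OF that] by auto
    show ?thesis
      unfolding Q_def
    proof (intro conjI allI impI)
      show "1 \<le> n" "\<rho> n (long_cycle n) x \<in> op_space P n"
        by (rule x(1), rule rho_closed[OF x(1) long_cycle_permutes x(2)])
      show "generated P G n (\<rho> n (long_cycle n) x)"
        using that long_cycle_permutes unfolding Q_def by blast
      fix \<sigma> assume \<sigma>: "\<sigma> permutes {1..n + 1}"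
      show "generated P G n (\<rho> n \<sigma> (\<rho> n (long_cycle n) x))"
        using that permutes_compose[OF long_cycle_permutes \<sigma>] rho_comp[OF x(1) \<sigma> long_cycle_permutes x(2)]
        unfolding Q_def by metis
    qed
  qed
  have pow: "generated P G (m + n - 1) (\<rho> (m + n - 1) (long_cycle (m + n - 1) ^^ k) (op_comp P m n i x y))"
    if "Q m x" "Q n y" "1 \<le> i" "i \<le> m" for k m n i x y
    using that
  proof (induction k arbitrary: m n i x y)
    case 0
    note QD = QD[OF 0(1)] QD[OF 0(2)]
    have c: "op_comp P m n i x y \<in> op_space P (m + n - 1)"
      by (rule comp_closed[OF 0(3,4) QD(4,2,5)])
    have N: "1 \<le> m + n - 1" using QD by simp
    show ?case
      unfolding funpow.simps(1) rho_id[OF N c] by (rule generated.comp[OF 0(3,4) QD(3,6)])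
  next
    case (Suc k)
    let ?N = "m + n - 1"
    have xy: "1 \<le> m" "1 \<le> n" "1 \<le> ?N" "x \<in> op_space P m" "y \<in> op_space P n"
      using QD[OF Suc.prems(1)] QD[OF Suc.prems(2)] by auto
    have N: "n + m - 1 = ?N" by simp
    have c: "op_comp P m n i x y \<in> op_space P ?N"
      by (rule comp_closed[OF Suc.prems(3,4) xy(2,4,5)])
    have "\<rho> ?N (long_cycle ?N ^^ Suc k) (op_comp P m n i x y) =
        \<rho> ?N (long_cycle ?N ^^ k) (\<rho> ?N (long_cycle ?N) (op_comp P m n i x y))"
      unfolding funpow_Suc_right by (rule rho_comp[OF xy(3) long_cycle_power_permutes long_cycle_permutes c])
    moreover have "generated P G ?N (\<rho> ?N (long_cycle ?N ^^ k) (\<rho> ?N (long_cycle ?N) (op_comp P m n i x y)))"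
    proof (cases "i = 1")
      case True
      let ?z = "op_comp P n m n (\<rho> n (long_cycle n) y) (\<rho> m (long_cycle m) x)"
      have Qs: "Q n (\<rho> n (long_cycle n) y)" "Q m (\<rho> m (long_cycle m) x)" using Suc.prems Q_rho by auto
      have "generated P G ?N (\<rho> ?N (long_cycle ?N ^^ k) ?z)"
        using Suc.IH[OF Qs xy(2) order_refl] unfolding N .
      moreover have "?z \<in> op_space P ?N"
        using comp_closed[OF xy(2) order_refl xy(1)] Qs unfolding N Q_def by blast
      ultimately show ?thesis
        using True rho_comp_long_cycle(2)[OF xy(1,2,4,5)]
          rho_uminus[OF xy(3) long_cycle_power_permutes] generated_uminus by simp
    next
      case False
      then have "2 \<le> i" using Suc.prems by simp
      then show ?thesis
        using Suc.IH[of m "\<rho> m (long_cycle m) x" n y "i - 1"] Suc.prems Q_rho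
          rho_comp_long_cycle(1)[OF _ _ xy(2,4,5)] by simp
    qed
    ultimately show ?case by (simp only:)
  qed
  have N: "1 \<le> m + n - 1" "op_comp P m n i x y \<in> op_space P (m + n - 1)"
    using QD(1)[OF Q(1)] QD(1)[OF Q(2)] comp_closed[OF comp.hyps(1,2) QD(1)[OF Q(2)] QD(2)[OF Q(1)] QD(2)[OF Q(2)]]
    by auto
  show ?case
    by (rule generated_rho_of_cycle_powers[OF N comp.prems pow[OF Q comp.hyps(1,2)]])
qed

text \<open>
  The morphism condition prescribes the action on the suboperad as the restriction of \<open>\<rho>\<close>. Stability makes this restriction
  well defined, and it inherits the axioms.
\<close>

theorem suboperad_unique_anticyclic:
  assumes G: "\<And>n. 1 \<le> n \<Longrightarrow> G n \<subseteq> op_space P n"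
    and orbit: "\<And>n x k. 1 \<le> n \<Longrightarrow> x \<in> G n \<Longrightarrow> k \<le> n \<Longrightarrow> generated P G n (\<rho> n (long_cycle n ^^ k) x)"
  defines "S \<equiv> suboperad_generated P G"
  shows "\<exists>!\<rho>'. \<rho>' \<in> action_families S \<and> anticyclic_operad S \<rho>' \<and> anticyclic_morphism S \<rho>' P \<rho> (\<lambda>n x. x)"
proof -
  define \<rho>' where "\<rho>' = (\<lambda>n\<in>{1..}. \<lambda>\<sigma>\<in>{\<sigma>. \<sigma> permutes {1..n + 1}}. \<lambda>x\<in>op_space S n. \<rho> n \<sigma> x)"
  have S: "op_scale S = op_scale P" "op_unit S = op_unit P" "op_comp S = op_comp P" "op_act S = op_act P"
    by (simp_all add: S_def suboperad_simps)
  have sub: "x \<in> op_space P n" if "x \<in> op_space S n" for n x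
    using that generated_in_space[OF _ G] by (simp add: S_def suboperad_simps)
  have closed: "\<rho> n \<sigma> x \<in> op_space S n" if "\<sigma> permutes {1..n + 1}" "x \<in> op_space S n" for n \<sigma> x
    using that generated_rho[OF G orbit] by (simp add: S_def suboperad_simps)
  have \<rho>': "\<rho>' n \<sigma> x = \<rho> n \<sigma> x" if "1 \<le> n" "\<sigma> permutes {1..n + 1}" "x \<in> op_space S n" for n \<sigma> x
    using that by (simp add: \<rho>'_def)
  have fam: "\<rho>' \<in> action_families S"
    unfolding action_families_def \<rho>'_def using closed by auto
  interpret S: symmetric_operad S
    unfolding S_def by (rule suboperad_symmetric_operad[OF G])
  have lin: "linear_map_on (op_scale S) (op_space S n) (op_scale P) (op_space P n) (\<lambda>x. x)" for n
    using sub by (simp add: linear_map_on_def S)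
  have anti: "anticyclic_operad S \<rho>'"
  proof (rule anticyclic_operad.intro[OF S.symmetric_operad_axioms], rule anticyclic_operad_axioms.intro)
    fix n :: nat and \<sigma> assume n: "1 \<le> n" and \<sigma>: "\<sigma> permutes {1..n + 1}"
    have "linear_map_on (op_scale S) (op_space S n) (op_scale S) (op_space S n) (\<rho> n \<sigma>)"
      unfolding S using sub closed[OF \<sigma>] by (intro linear_map_on_restrict[OF rho_linear[OF n \<sigma>]]) auto
    then show "linear_map_on (op_scale S) (op_space S n) (op_scale S) (op_space S n) (\<rho>' n \<sigma>)"
      using \<rho>'[OF n \<sigma>] S.subspace_add[OF S.subspace_op_space[OF n]] S.subspace_scale[OF S.subspace_op_space[OF n]]
      by (simp add: linear_map_on_def)
  next
    fix n :: nat and \<sigma> \<pi> f assume "1 \<le> n" "\<sigma> permutes {1..n + 1}" "\<pi> permutes {1..n + 1}" "f \<in> op_space S n"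
    then show "\<rho>' n (\<sigma> \<circ> \<pi>) f = \<rho>' n \<sigma> (\<rho>' n \<pi> f)"
      using sub closed by (simp add: \<rho>' permutes_compose rho_comp)
  next
    fix n :: nat and \<sigma> f assume a: "1 \<le> n" "\<sigma> permutes {1..n}" "f \<in> op_space S n"
    have "\<sigma> permutes {1..n + 1}" using a(2) by (rule permutes_subset) auto
    then show "\<rho>' n \<sigma> f = op_act S n \<sigma> f"
      using a sub by (simp add: \<rho>' S rho_extends)
  next
    show "anticyclic_identities S (\<lambda>n. \<rho>' n (long_cycle n))"
      unfolding anticyclic_identities_def
    proof (intro conjI allI impI ballI)
      show "\<rho>' 1 (long_cycle 1) (op_unit S) = - op_unit S"
        using \<rho>'[OF order_refl long_cycle_permutes S.unit_in] rho_identities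
        by (simp add: S anticyclic_identities_def del: One_nat_def)
    next
      fix m n i :: nat and f g assume a: "1 \<le> m" "1 \<le> n" "f \<in> op_space S m" "g \<in> op_space S n" "i \<in> {2..m}"
      have "op_comp S m n i f g \<in> op_space S (m + n - 1)" "1 \<le> m + n - 1" using a by (auto intro!: S.comp_closed simp del: One_nat_def)
      then show "\<rho>' (m + n - 1) (long_cycle (m + n - 1)) (op_comp S m n i f g) =
          op_comp S m n (i - 1) (\<rho>' m (long_cycle m) f) g"
        using a sub rho_comp_long_cycle(1)[of i m n f g]
          \<rho>'[OF _ long_cycle_permutes, of "m + n - 1" "op_comp S m n i f g"] \<rho>'[OF a(1) long_cycle_permutes a(3)]
        by (simp add: S)
    next
      fix m n :: nat and f g assume a: "1 \<le> m" "1 \<le> n" "f \<in> op_space S m" "g \<in> op_space S n"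
      have "op_comp S m n 1 f g \<in> op_space S (m + n - 1)" "1 \<le> m + n - 1" using a by (auto intro!: S.comp_closed simp del: One_nat_def)
      then show "\<rho>' (m + n - 1) (long_cycle (m + n - 1)) (op_comp S m n 1 f g) =
          - op_comp S n m n (\<rho>' n (long_cycle n) g) (\<rho>' m (long_cycle m) f)"
        using a sub rho_comp_long_cycle(2)[of m n f g]
          \<rho>'[OF _ long_cycle_permutes, of "m + n - 1" "op_comp S m n 1 f g"]
          \<rho>'[OF a(1) long_cycle_permutes a(3)] \<rho>'[OF a(2) long_cycle_permutes a(4)]
        by (simp add: S)
    qed
  qed
  have mor: "anticyclic_morphism S \<rho>' P \<rho> (\<lambda>n x. x)"
    by (rule anticyclic_morphism.intro[OF anti anticyclic_operad_axioms], rule anticyclic_morphism_axioms.intro)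
      (simp_all add: lin[unfolded S] \<rho>' S)
  show ?thesis
  proof (rule ex1I)
    show "\<rho>' \<in> action_families S \<and> anticyclic_operad S \<rho>' \<and> anticyclic_morphism S \<rho>' P \<rho> (\<lambda>n x. x)"
      using fam anti mor by blast
    fix \<kappa> assume \<kappa>: "\<kappa> \<in> action_families S \<and> anticyclic_operad S \<kappa> \<and> anticyclic_morphism S \<kappa> P \<rho> (\<lambda>n x. x)"
    then interpret K: anticyclic_morphism S \<kappa> P \<rho> "\<lambda>n x. x" by (elim conjE)
    show "\<kappa> = \<rho>'"
    proof (rule PiE_ext[of _ "{1..}" _ ])
      show "\<kappa> \<in> (\<Pi>\<^sub>E n\<in>{1..}. \<Pi>\<^sub>E \<sigma>\<in>{\<sigma>. \<sigma> permutes {1..n + 1}}. op_space S n \<rightarrow>\<^sub>E op_space S n)"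
        "\<rho>' \<in> (\<Pi>\<^sub>E n\<in>{1..}. \<Pi>\<^sub>E \<sigma>\<in>{\<sigma>. \<sigma> permutes {1..n + 1}}. op_space S n \<rightarrow>\<^sub>E op_space S n)"
        using \<kappa> fam by (simp_all add: action_families_def)
      fix n :: nat assume n: "n \<in> {1..}"
      show "\<kappa> n = \<rho>' n"
      proof (rule PiE_ext)
        show "\<kappa> n \<in> (\<Pi>\<^sub>E \<sigma>\<in>{\<sigma>. \<sigma> permutes {1..n + 1}}. op_space S n \<rightarrow>\<^sub>E op_space S n)"
          "\<rho>' n \<in> (\<Pi>\<^sub>E \<sigma>\<in>{\<sigma>. \<sigma> permutes {1..n + 1}}. op_space S n \<rightarrow>\<^sub>E op_space S n)"
          using \<kappa> fam n unfolding action_families_def by (blast dest: PiE_mem)+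
        fix \<sigma> :: "nat \<Rightarrow> nat" assume \<sigma>: "\<sigma> \<in> {\<sigma>. \<sigma> permutes {1..n + 1}}"
        show "\<kappa> n \<sigma> = \<rho>' n \<sigma>"
        proof (rule PiE_ext)
          show "\<kappa> n \<sigma> \<in> op_space S n \<rightarrow>\<^sub>E op_space S n" "\<rho>' n \<sigma> \<in> op_space S n \<rightarrow>\<^sub>E op_space S n"
            using \<kappa> fam n \<sigma> unfolding action_families_def by (blast dest: PiE_mem)+
          fix x assume "x \<in> op_space S n"
          then show "\<kappa> n \<sigma> x = \<rho>' n \<sigma> x"
            using n \<sigma> K.map_rho[of n \<sigma> x] \<rho>'[of n \<sigma> x] by simp
        qed
      qed
    qed
  qed
qed

end

section \<open>The bracket of Leib\<close>

interpretation Dias_ns: ns_anticyclic_operad Dias_ns dias_tau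
  by (rule dias_tau)

lemma leib_bracket_eq:
  "leib_bracket = Poly_Mapping.single id dias_left - Poly_Mapping.single (Transposition.transpose 1 2) dias_right"
  by (simp add: leib_bracket_def Dias_def Dias_ns.sym_act_single)

interpretation Dias: anticyclic_operad Dias Dias_action
  unfolding Dias_def Dias_action_def by (rule Dias_ns.symmetrization_anticyclic_operad)

text \<open>
  Write \<open>l = dias_left\<close> and \<open>r = dias_right\<close>, so that the bracket is \<open>l \<otimes> 1 - r \<otimes> t\<close>. One has \<open>\<tau>(l) = - r\<close>,
  \<open>\<tau>\<^sup>2(l) = r - l\<close>, \<open>\<tau>(r) = l - r\<close> and \<open>\<tau>\<^sup>2(r) = - l\<close>, while \<open>c \<circ> t = t \<circ> c\<^sup>2\<close> and
  \<open>c\<^sup>2 \<circ> t = t \<circ> c\<close> for the long cycle \<open>c\<close> of \<open>{1, 2, 3}\<close>.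
\<close>

lemma leib_bracket_orbit:
  defines "t \<equiv> Transposition.transpose 1 2 :: nat \<Rightarrow> nat"
  shows "leib_bracket \<in> op_space Dias 2"
    and "Dias_action 2 (long_cycle 2) leib_bracket = op_act Dias 2 t leib_bracket"
    and "Dias_action 2 (long_cycle 2 ^^ 2) leib_bracket = - (leib_bracket + op_act Dias 2 t leib_bracket)"
proof -
  have two: "(1::nat) \<le> 2" by simp
  have t: "t permutes {1..2}" unfolding t_def by (rule permutes_swap_id) auto
  have tt: "t \<circ> t = id" by (simp add: t_def)
  have in2: "dias_left \<in> op_space Dias_ns 2" "dias_right \<in> op_space Dias_ns 2"
    using dias_basis_in[of 2 1] dias_basis_in[of 2 2] by (simp_all add: dias_tree_eq_basis numeral_2_eq_2)
  let ?c = "long_cycle 2"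
  have perm: "?c \<circ> id = id \<circ> ?c ^^ 1" "?c \<circ> t = t \<circ> ?c ^^ 2" "?c ^^ 2 \<circ> id = id \<circ> ?c ^^ 2" "?c ^^ 2 \<circ> t = t \<circ> ?c ^^ 1"
    by (rule ext; auto simp: t_def long_cycle_power long_cycle_apply Transposition.transpose_def)+
  have single_in: "Poly_Mapping.single id dias_left \<in> op_space Dias 2" "Poly_Mapping.single t dias_right \<in> op_space Dias 2"
    unfolding Dias_def by (intro Dias_ns.sym_single_in permutes_id t in2)+
  have diff: "h (x - y) = h x - h y"
    if "linear_map_on (op_scale Dias) (op_space Dias 2) (op_scale Dias) (op_space Dias 2) h"
      "x \<in> op_space Dias 2" "y \<in> op_space Dias 2" for h x y
  proof -
    have "x - y \<in> op_space Dias 2"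
      using that Dias.subspace_diff[OF Dias.subspace_op_space[OF two]] by blast
    then show ?thesis using linear_map_on_add[OF that(1) _ that(3), of "x - y"] by simp
  qed
  show "leib_bracket \<in> op_space Dias 2"
    unfolding leib_bracket_eq t_def[symmetric]
    by (rule Dias.subspace_diff[OF Dias.subspace_op_space[OF two] single_in])
  have tau: "(dias_tau 2 ^^ 1) dias_left = - dias_right" "(dias_tau 2 ^^ 1) dias_right = dias_left - dias_right"
    "(dias_tau 2 ^^ 2) dias_left = dias_right - dias_left" "(dias_tau 2 ^^ 2) dias_right = - dias_left"
    using dias_tau(2,3) Dias_ns.linear_minus[OF Dias_ns.tau_linear[OF two] two in2(2)]
      Dias_ns.linear_minus[OF Dias_ns.tau_linear[OF two] two in2(1)]
      linear_map_on_add[OF Dias_ns.tau_linear[OF two] in2(1) Dias_ns.subspace_neg[OF Dias_ns.subspace_op_space[OF two] in2(2)]]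
    by (simp_all add: numeral_2_eq_2)
  note act = Dias_ns.induced_action_single[OF two, folded Dias_action_def]
  have A: "op_act Dias 2 t leib_bracket = Poly_Mapping.single t dias_left - Poly_Mapping.single id dias_right"
    unfolding leib_bracket_eq t_def[symmetric] diff[OF Dias.act_linear[OF two t] single_in]
    by (simp add: Dias_def Dias_ns.sym_act_single tt)
  show "Dias_action 2 ?c leib_bracket = op_act Dias 2 t leib_bracket"
    unfolding A unfolding leib_bracket_eq t_def[symmetric] diff[OF Dias.rho_linear[OF two long_cycle_permutes] single_in]
      act[OF permutes_id perm(1) in2(1)] act[OF t perm(2) in2(2)] tau
    by (simp add: single_uminus)
  show "Dias_action 2 (?c ^^ 2) leib_bracket = - (leib_bracket + op_act Dias 2 t leib_bracket)"
    unfolding A unfolding leib_bracket_eq t_def[symmetric] diff[OF Dias.rho_linear[OF two long_cycle_power_permutes] single_in]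
      act[OF permutes_id perm(3) in2(1)] act[OF t perm(4) in2(2)] tau
    by (simp add: single_diff)
qed

theorem theorem5p4:
  "\<exists>!\<rho>. \<rho> \<in> action_families Leib \<and> anticyclic_operad Leib \<rho> \<and>
         anticyclic_morphism Leib \<rho> Dias Dias_action (\<lambda>n x. x)"
  unfolding Leib_def
proof (rule Dias.suboperad_unique_anticyclic)
  let ?G = "\<lambda>n::nat. if n = 2 then {leib_bracket} else {}"
  let ?t = "Transposition.transpose 1 2 :: nat \<Rightarrow> nat"
  note orbit = leib_bracket_orbit
  show "?G n \<subseteq> op_space Dias n" for n using orbit(1) by simp
  fix n x k assume "x \<in> ?G n" "k \<le> n"
  then have x: "n = 2" "x = leib_bracket" and k: "k \<in> {0, 1, 2}" by (auto split: if_splits)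
  have b: "generated Dias ?G 2 leib_bracket" by (rule generated.gen) auto
  have "?t permutes {1..2}" by (rule permutes_swap_id) auto
  then have t: "generated Dias ?G 2 (op_act Dias 2 ?t leib_bracket)" using b by (rule generated.act)
  have pow: "long_cycle 2 ^^ 0 = id" "long_cycle 2 ^^ 1 = long_cycle 2" by (simp_all add: fun_eq_iff)
  have "generated Dias ?G 2 (Dias_action 2 (long_cycle 2 ^^ 0) leib_bracket)"
    using b Dias.rho_id[OF _ orbit(1)] unfolding pow by simp
  moreover have "generated Dias ?G 2 (Dias_action 2 (long_cycle 2 ^^ 1) leib_bracket)"
    unfolding pow orbit(2) by (rule t)
  moreover have "generated Dias ?G 2 (Dias_action 2 (long_cycle 2 ^^ 2) leib_bracket)"
    unfolding orbit(3) by (rule Dias.generated_uminus[OF generated.add[OF b t]])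
  ultimately have "generated Dias ?G 2 (Dias_action 2 (long_cycle 2 ^^ k) leib_bracket)"
    using k by blast
  then show "generated Dias ?G n (Dias_action n (long_cycle n ^^ k) x)" using x by simp
qed

end
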